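(* Consider the space-times admitting a null conformal Killing-Yano tensor $A$ such that $Z_1\equiv\delta A$ and $Z_2\equiv\delta{*A}$ are Killing vectors verifying $Z_1\wedge Z_2=0$. Then $\Lambda=0$ if, and only if, $Z_1=Z_2=0$, and then the space-time is a pp-wave, whose metric line element is given by $$ds^2=-2\,du\,dv-2H\,du^2+2\,d\xi\,d\bar\xi,\qquad H=H(u,\xi,\bar\xi).$$ The covariantly constant two-form is $$\mathcal A=\ell\wedge m,\qquad \ell=du,\qquad m=d\xi,$$ and the Ricci and Weyl tensors take the expressions $$Ric=\sigma\,\ell\otimes\ell,\quad \sigma=H_{\xi\bar\xi};\qquad \mathcal W=\psi\,\mathcal A\otimes\mathcal A,\quad \psi=H_{\xi\xi}.$$
   Context: A space-time is an oriented 4-dimensional manifold with metric $g$ of signature $(-,+,+,+)$ and volume element $\eta$; vectors and 1-forms are identified through $g$; considerations are local. $\nabla$ is the Levi-Civita connection, $*$ the Hodge dual, and the codifferential is $(\delta\omega)_{\underline p}=-\nabla_\alpha\omega^{\alpha}{}_{\underline p}$. $W$ is the Weyl tensor and $\mathcal W=\frac12(W-\mathrm i*W)$ the self-dual Weyl tensor. The coordinates $u,v$ are real, $\xi$ is complex with conjugate $\bar\xi$, $H$ is a real function, and subscripts on $H$ denote partial derivatives. For a real two-form $A$ put $\mathcal A=\frac1{\sqrt2}(A-\mathrm i*A)$. $A$ is a conformal Killing-Yano (CKY) tensor if $3\nabla\mathcal A=2\,i(\mathcal Z)\mathcal G$ with $\mathcal Z=\delta\mathcal A$, where $i(\mathcal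 Z)$ is the inner product, $\mathcal G=\frac12(G-\mathrm i\eta)$, $G_{\alpha\beta\gamma\delta}=g_{\alpha\gamma}g_{\beta\delta}-g_{\alpha\delta}g_{\beta\gamma}$. $A$ is null if $A\neq0$ and $\mathcal A_{\alpha\beta}\mathcal A^{\alpha\beta}=0$; then $\mathcal A=\ell\wedge m$ with $\ell$ a real null vector (the fundamental vector of $A$) and $m$ a complex null vector with $(m,\ell)=0$, $(m,\bar m)=1$. "Killing vector" is understood to include the possibility that $Z_1,Z_2$ vanish. Under the hypotheses of the claim, $Ric=\sigma\,\ell\otimes\ell+\Lambda g$, so the scalar curvature is $R=4\Lambda$; this defines $\Lambda$.
   Formalization: The Ricci coefficient is corrected from σ = H_{ξξ̄} to σ = 2H_{ξξ̄}: for the stated line element R_uu = 2H_{ξξ̄} (e.g. H = ξξ̄ gives 2, not 1); the two agree exactly when H_{ξξ̄} = 0. *)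

theory Defs
  imports "HOL-Analysis.Analysis"
begin

section \<open>Local tensor calculus on an open subset of \<open>\<real>\<^sup>4\<close>\<close>

text \<open>
  All considerations are local, so a space-time is given by the domain \<open>U\<close> of a positively oriented
  chart (an open subset of \<^typ>\<open>real^4\<close>) and the components \<open>g x $ a $ b\<close> of the metric.
  Covariant tensor fields of rank 1 and 2 are vector- and matrix-valued functions; tensors of higher
  rank take their indices as arguments. All vectors are represented by the associated 1-forms.
\<close>

primrec Ck_on :: "nat \<Rightarrow> 'a::real_normed_vector set \<Rightarrow> ('a \<Rightarrow> 'b::real_normed_vector) \<Rightarrow> bool" where
  "Ck_on 0 S f \<longleftrightarrow> continuous_on S f"
| "Ck_on (Suc k) S f \<longleftrightarrow>
     (\<forall>x\<in>S. f differentiable (at x)) \<and> (\<forall>w. Ck_on k S (\<lambda>x. frechet_derivative f (at x) w))"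

text \<open>Only used for open \<open>S\<close>.\<close>

definition smooth_on :: "'a::real_normed_vector set \<Rightarrow> ('a \<Rightarrow> 'b::real_normed_vector) \<Rightarrow> bool" where
  "smooth_on S f \<longleftrightarrow> (\<forall>k. Ck_on k S f)"

definition pd :: "4 \<Rightarrow> (real^4 \<Rightarrow> 'b::real_normed_vector) \<Rightarrow> real^4 \<Rightarrow> 'b" where
  "pd a f x = frechet_derivative f (at x) (axis a 1)"

definition differential :: "(real^4 \<Rightarrow> 'b::real_normed_vector) \<Rightarrow> real^4 \<Rightarrow> 'b^4" where
  "differential f x = (\<chi> a. pd a f x)"

definition wedge :: "'b::comm_ring^4 \<Rightarrow> 'b^4 \<Rightarrow> 'b^4^4" where
  "wedge \<alpha> \<beta> = (\<chi> a b. \<alpha> $ a * \<beta> $ b - \<alpha> $ b * \<beta> $ a)"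

definition complexify :: "real^4 \<Rightarrow> complex^4" where
  "complexify \<omega> = (\<chi> a. complex_of_real (\<omega> $ a))"

definition minkowski :: "real^4^4" where
  "minkowski = (\<chi> a b. if a \<noteq> b then 0 else if a = 1 then -1 else 1)"

definition lorentzian :: "real^4^4 \<Rightarrow> bool" where
  "lorentzian h \<longleftrightarrow> (\<exists>P. invertible P \<and> transpose P ** h ** P = minkowski)"

definition spacetime :: "(real^4) set \<Rightarrow> (real^4 \<Rightarrow> real^4^4) \<Rightarrow> bool" where
  "spacetime U g \<longleftrightarrow> open U \<and> smooth_on U g \<and> (\<forall>x\<in>U. lorentzian (g x))"


subsection \<open>Levi-Civita connection and codifferential\<close>

definition ginv :: "(real^4 \<Rightarrow> real^4^4) \<Rightarrow> real^4 \<Rightarrow> 4 \<Rightarrow> 4 \<Rightarrow> real" where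
  "ginv g x a b = matrix_inv (g x) $ a $ b"

text \<open>\<open>christoffel g x a b c\<close> has the upper index \<open>a\<close>.\<close>

definition christoffel :: "(real^4 \<Rightarrow> real^4^4) \<Rightarrow> real^4 \<Rightarrow> 4 \<Rightarrow> 4 \<Rightarrow> 4 \<Rightarrow> real" where
  "christoffel g x a b c = (\<Sum>d\<in>UNIV. ginv g x a d *
     (pd b (\<lambda>y. g y $ d $ c) x + pd c (\<lambda>y. g y $ d $ b) x - pd d (\<lambda>y. g y $ b $ c) x)) / 2"

text \<open>In the covariant derivatives the first index argument is the index of differentiation.\<close>

definition nabla1 ::
  "(real^4 \<Rightarrow> real^4^4) \<Rightarrow> (real^4 \<Rightarrow> 'b::real_normed_vector^4) \<Rightarrow> real^4 \<Rightarrow> 4 \<Rightarrow> 4 \<Rightarrow> 'b" where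
  "nabla1 g \<omega> x c a = pd c (\<lambda>y. \<omega> y $ a) x - (\<Sum>d\<in>UNIV. christoffel g x d c a *\<^sub>R \<omega> x $ d)"

definition nabla2 ::
  "(real^4 \<Rightarrow> real^4^4) \<Rightarrow> (real^4 \<Rightarrow> 'b::real_normed_vector^4^4) \<Rightarrow> real^4 \<Rightarrow> 4 \<Rightarrow> 4 \<Rightarrow> 4 \<Rightarrow> 'b" where
  "nabla2 g T x c a b = pd c (\<lambda>y. T y $ a $ b) x
     - (\<Sum>d\<in>UNIV. christoffel g x d c a *\<^sub>R T x $ d $ b)
     - (\<Sum>d\<in>UNIV. christoffel g x d c b *\<^sub>R T x $ a $ d)"

definition codifferential ::
  "(real^4 \<Rightarrow> real^4^4) \<Rightarrow> (real^4 \<Rightarrow> 'b::real_normed_vector^4^4) \<Rightarrow> real^4 \<Rightarrow> 'b^4" where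
  "codifferential g F x = (\<chi> b. - (\<Sum>a\<in>UNIV. \<Sum>c\<in>UNIV. ginv g x a c *\<^sub>R nabla2 g F x a c b))"

definition killing_on :: "(real^4) set \<Rightarrow> (real^4 \<Rightarrow> real^4^4) \<Rightarrow> (real^4 \<Rightarrow> real^4) \<Rightarrow> bool" where
  "killing_on U g Z \<longleftrightarrow> (\<forall>x\<in>U. \<forall>a b. nabla1 g Z x a b + nabla1 g Z x b a = 0)"


subsection \<open>Curvature\<close>

text \<open>
  \<open>riemann_up g x a b c d\<close> is \<open>R\<^sup>a\<^bsub>bcd\<^esub> = \<partial>\<^bsub>c\<^esub>\<Gamma>\<^sup>a\<^bsub>db\<^esub> - \<partial>\<^bsub>d\<^esub>\<Gamma>\<^sup>a\<^bsub>cb\<^esub> + \<dots>\<close>, and the Ricci tensor is the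
  contraction of the first with the third index, so that round spheres have positive curvature.
\<close>

definition riemann_up :: "(real^4 \<Rightarrow> real^4^4) \<Rightarrow> real^4 \<Rightarrow> 4 \<Rightarrow> 4 \<Rightarrow> 4 \<Rightarrow> 4 \<Rightarrow> real" where
  "riemann_up g x a b c d =
     pd c (\<lambda>y. christoffel g y a d b) x - pd d (\<lambda>y. christoffel g y a c b) x
     + (\<Sum>e\<in>UNIV. christoffel g x a c e * christoffel g x e d b
                  - christoffel g x a d e * christoffel g x e c b)"

definition riemann :: "(real^4 \<Rightarrow> real^4^4) \<Rightarrow> real^4 \<Rightarrow> 4 \<Rightarrow> 4 \<Rightarrow> 4 \<Rightarrow> 4 \<Rightarrow> real" where
  "riemann g x a b c d = (\<Sum>e\<in>UNIV. g x $ a $ e * riemann_up g x e b c d)"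

definition ricci :: "(real^4 \<Rightarrow> real^4^4) \<Rightarrow> real^4 \<Rightarrow> 4 \<Rightarrow> 4 \<Rightarrow> real" where
  "ricci g x b d = (\<Sum>a\<in>UNIV. riemann_up g x a b a d)"

definition scalar_curvature :: "(real^4 \<Rightarrow> real^4^4) \<Rightarrow> real^4 \<Rightarrow> real" where
  "scalar_curvature g x = (\<Sum>a\<in>UNIV. \<Sum>b\<in>UNIV. ginv g x a b * ricci g x a b)"

text \<open>\<open>Lambda\<close> is defined by \<open>R = 4 \<Lambda>\<close>; it is a function on the space-time.\<close>

definition Lambda :: "(real^4 \<Rightarrow> real^4^4) \<Rightarrow> real^4 \<Rightarrow> real" where
  "Lambda g x = scalar_curvature g x / 4"

definition Gmetric :: "(real^4 \<Rightarrow> real^4^4) \<Rightarrow> real^4 \<Rightarrow> 4 \<Rightarrow> 4 \<Rightarrow> 4 \<Rightarrow> 4 \<Rightarrow> real" where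
  "Gmetric g x a b c d = g x $ a $ c * g x $ b $ d - g x $ a $ d * g x $ b $ c"

definition weyl :: "(real^4 \<Rightarrow> real^4^4) \<Rightarrow> real^4 \<Rightarrow> 4 \<Rightarrow> 4 \<Rightarrow> 4 \<Rightarrow> 4 \<Rightarrow> real" where
  "weyl g x a b c d = riemann g x a b c d
     - (g x $ a $ c * ricci g x b d - g x $ a $ d * ricci g x b c
        - g x $ b $ c * ricci g x a d + g x $ b $ d * ricci g x a c) / 2
     + scalar_curvature g x / 6 * Gmetric g x a b c d"


subsection \<open>Hodge duality and self-dual parts\<close>

text \<open>The determinant is the Levi-Civita symbol with value \<open>1\<close> at \<open>(1,2,3,4)\<close>.\<close>

definition vol :: "(real^4 \<Rightarrow> real^4^4) \<Rightarrow> real^4 \<Rightarrow> 4 \<Rightarrow> 4 \<Rightarrow> 4 \<Rightarrow> 4 \<Rightarrow> real" where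
  "vol g x a b c d = sqrt \<bar>det (g x)\<bar> *
     det (vector [axis a 1, axis b 1, axis c 1, axis d 1] :: real^4^4)"

definition hodge2 :: "(real^4 \<Rightarrow> real^4^4) \<Rightarrow> real^4 \<Rightarrow> real^4^4 \<Rightarrow> real^4^4" where
  "hodge2 g x F = (\<chi> a b. (\<Sum>c\<in>UNIV. \<Sum>d\<in>UNIV. \<Sum>e\<in>UNIV. \<Sum>f\<in>UNIV.
     vol g x a b c d * ginv g x c e * ginv g x d f * F $ e $ f) / 2)"

definition hodge_field ::
  "(real^4 \<Rightarrow> real^4^4) \<Rightarrow> (real^4 \<Rightarrow> real^4^4) \<Rightarrow> real^4 \<Rightarrow> real^4^4" where
  "hodge_field g A x = hodge2 g x (A x)"

definition self_dual_form ::
  "(real^4 \<Rightarrow> real^4^4) \<Rightarrow> (real^4 \<Rightarrow> real^4^4) \<Rightarrow> real^4 \<Rightarrow> complex^4^4" where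
  "self_dual_form g A x = (\<chi> a b.
     (complex_of_real (A x $ a $ b) - \<i> * complex_of_real (hodge_field g A x $ a $ b))
       / complex_of_real (sqrt 2))"

definition self_dual_G :: "(real^4 \<Rightarrow> real^4^4) \<Rightarrow> real^4 \<Rightarrow> 4 \<Rightarrow> 4 \<Rightarrow> 4 \<Rightarrow> 4 \<Rightarrow> complex" where
  "self_dual_G g x a b c d =
     (complex_of_real (Gmetric g x a b c d) - \<i> * complex_of_real (vol g x a b c d)) / 2"

text \<open>The dual of the Weyl tensor is taken on the first pair of indices.\<close>

definition self_dual_weyl :: "(real^4 \<Rightarrow> real^4^4) \<Rightarrow> real^4 \<Rightarrow> 4 \<Rightarrow> 4 \<Rightarrow> 4 \<Rightarrow> 4 \<Rightarrow> complex" where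
  "self_dual_weyl g x a b c d =
     (complex_of_real (weyl g x a b c d)
      - \<i> * complex_of_real (hodge2 g x (\<chi> e f. weyl g x e f c d) $ a $ b)) / 2"


subsection \<open>Null conformal Killing-Yano tensors\<close>

definition two_form_on :: "(real^4) set \<Rightarrow> (real^4 \<Rightarrow> real^4^4) \<Rightarrow> bool" where
  "two_form_on U A \<longleftrightarrow> smooth_on U A \<and> (\<forall>x\<in>U. \<forall>a b. A x $ a $ b = - A x $ b $ a)"

definition conformal_killing_yano_on ::
  "(real^4) set \<Rightarrow> (real^4 \<Rightarrow> real^4^4) \<Rightarrow> (real^4 \<Rightarrow> real^4^4) \<Rightarrow> bool" where
  "conformal_killing_yano_on U g A \<longleftrightarrow> two_form_on U A \<and>
     (\<forall>x\<in>U. \<forall>b c d. 3 * nabla2 g (self_dual_form g A) x b c d =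
        2 * (\<Sum>a\<in>UNIV. \<Sum>e\<in>UNIV. complex_of_real (ginv g x a e) *
               codifferential g (self_dual_form g A) x $ e * self_dual_G g x a b c d))"

definition null_on ::
  "(real^4) set \<Rightarrow> (real^4 \<Rightarrow> real^4^4) \<Rightarrow> (real^4 \<Rightarrow> real^4^4) \<Rightarrow> bool" where
  "null_on U g A \<longleftrightarrow> (\<forall>x\<in>U. A x \<noteq> 0 \<and>
     (\<Sum>a\<in>UNIV. \<Sum>b\<in>UNIV. \<Sum>c\<in>UNIV. \<Sum>d\<in>UNIV.
        complex_of_real (ginv g x a c * ginv g x b d) *
        self_dual_form g A x $ a $ b * self_dual_form g A x $ c $ d) = 0)"


subsection \<open>The pp-wave line element\<close>

text \<open>
  A function \<open>H(u,\<xi>,\<xi>\<^bsup>*\<^esup>)\<close> that need not be holomorphic in \<open>\<xi>\<close> is a function on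
  \<^typ>\<open>real \<times> complex\<close>; its derivatives with respect to \<open>\<xi>\<close> and the conjugate of \<open>\<xi>\<close> are
  Wirtinger derivatives.
\<close>

definition d_xi :: "(real \<times> complex \<Rightarrow> complex) \<Rightarrow> real \<times> complex \<Rightarrow> complex" where
  "d_xi F p = (frechet_derivative F (at p) (0, 1) - \<i> * frechet_derivative F (at p) (0, \<i>)) / 2"

definition d_xibar :: "(real \<times> complex \<Rightarrow> complex) \<Rightarrow> real \<times> complex \<Rightarrow> complex" where
  "d_xibar F p = (frechet_derivative F (at p) (0, 1) + \<i> * frechet_derivative F (at p) (0, \<i>)) / 2"

definition coordinates_on ::
  "(real^4) set \<Rightarrow> (real^4 \<Rightarrow> real) \<Rightarrow> (real^4 \<Rightarrow> real) \<Rightarrow> (real^4 \<Rightarrow> complex) \<Rightarrow> bool" where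
  "coordinates_on V u v \<xi> \<longleftrightarrow>
     (let \<phi> = (\<lambda>x. (u x, v x, \<xi> x)) in
        open V \<and> smooth_on V \<phi> \<and> inj_on \<phi> V \<and> open (\<phi> ` V) \<and> smooth_on (\<phi> ` V) (inv_into V \<phi>))"

text \<open>
  Products of differentials in a line element are symmetrised: \<open>2 du dv = du \<otimes> dv + dv \<otimes> du\<close>.
  For this line element the only non-zero Christoffel symbols with indices \<open>u, \<xi>, \<xi>\<^bsup>*\<^esup>\<close>
  downstairs and a transverse index upstairs are \<open>\<Gamma>\<^sup>\<xi>\<^bsub>uu\<^esub> = \<partial>H/\<partial>\<xi>\<^bsup>*\<^esup>\<close> and its conjugate, so that the
  Ricci tensor has the single component \<open>R\<^bsub>uu\<^esub> = 2 \<partial>\<^sup>2H/\<partial>\<xi>\<partial>\<xi>\<^bsup>*\<^esup>\<close>, with the factor 2.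
\<close>

definition pp_wave_coordinates_on ::
  "(real^4) set \<Rightarrow> (real^4 \<Rightarrow> real^4^4) \<Rightarrow> (real^4 \<Rightarrow> real) \<Rightarrow> (real^4 \<Rightarrow> real) \<Rightarrow> (real^4 \<Rightarrow> complex)
     \<Rightarrow> (real \<times> complex \<Rightarrow> real) \<Rightarrow> bool" where
  "pp_wave_coordinates_on V g u v \<xi> H \<longleftrightarrow>
     coordinates_on V u v \<xi> \<and> smooth_on ((\<lambda>x. (u x, \<xi> x)) ` V) H \<and>
     (\<forall>x\<in>V. \<forall>a b.
        (let du = differential u x; dv = differential v x;
             d\<xi> = differential \<xi> x; d\<xi>bar = differential (\<lambda>y. cnj (\<xi> y)) x
         in complex_of_real (g x $ a $ b) =
              complex_of_real (- (du $ a * dv $ b + dv $ a * du $ b)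
                               - 2 * H (u x, \<xi> x) * (du $ a * du $ b))
              + (d\<xi> $ a * d\<xi>bar $ b + d\<xi>bar $ a * d\<xi> $ b)))"

end

theory Submission
  imports Defs
begin

text \<open>
  Locally \<open>A = \<ell> \<and> x\<close> and \<open>*A = - \<ell> \<and> y\<close> in a real null coframe with
  \<open>g = - \<ell> n - n \<ell> + x x + y y\<close>; the complex null vector of the paper is \<open>m = (x + i y) / \<surd>2\<close>.
  Contracting the CKY equation with \<open>A\<close> and using \<open>Z1 \<and> Z2 = 0\<close> gives \<open>Z1 = z1 \<ell>\<close> and \<open>Z2 = z2 \<ell>\<close>,
  and the equation then fixes all connection forms except the \<open>\<ell>\<close>-parts of \<open>\<nabla>x\<close> and \<open>\<nabla>y\<close>. In particular
  \<open>\<nabla>\<ell>\<close> is skew, so the Killing equations force \<open>z1\<close> and \<open>z2\<close> to be locally constant. The Ricci identity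
  for \<open>\<ell>\<close> and \<open>x\<close>, together with the symmetries of the curvature tensor, yields
  \<open>\<Lambda> = - (z1\<^sup>2 + z2\<^sup>2) / 3\<close>, whence the equivalence.

  If \<open>Z1 = Z2 = 0\<close>, then \<open>\<ell>\<close> is parallel, hence locally \<open>\<ell> = du\<close>, and \<open>x\<close>, \<open>y\<close> are closed modulo \<open>\<ell>\<close>.
  The Poincare lemma on the leaves \<open>u = const\<close> allows us to adapt the frame so that \<open>x = dX\<close>, \<open>y = dY\<close>,
  and once more to write \<open>n = dv + H du\<close>. Comparing the two expressions for \<open>dn\<close> shows that \<open>H\<close> is a
  function of \<open>u\<close> and \<open>\<xi> = (X + i Y) / \<surd>2\<close>, with \<open>\<nabla>x\<close> and \<open>\<nabla>y\<close> given by its first derivatives, and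
  the curvature is read off from the Ricci identity for the coframe.
\<close>

section \<open>Smooth functions\<close>

text \<open>In the code x and y are \<open>a\<close> and \<open>b\<close>, and v is
  \<open>w\<close>. The equivalence is pointwise: the scalar curvature is -(4/3)(z1^2 + z2^2) at
  every point. Few curvature components suffice for this: all those with a leg along
  \<open>l\<close>, and one sectional component in the plane of \<open>a\<close> and
  \<open>b\<close>. On them the curvature looks like constant curvature -(z1^2 + z2^2)/9, and the
  undetermined \<open>l\<close>-parts of the connection drop out. The obstacle is smoothness: the
  linear algebra of null two-forms yields a frame only point by point. Contracting A with itself
  gives l tensor l, so l is known up to sign, and null rotations (adding multiples of l to a and b,
  and correcting n) bring the whole frame to explicit formulas in A, its dual and g. The same
  rotations later make a and b exact. The sign in the dual of A encodes the orientation. The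
  Poincare lemma along leaves is needed because a, b and n are closed only on the kernel of l. The
  final chart domain is a box, so that each line on which only v varies meets it in an interval;
  this turns a vanishing v-derivative of H into independence of v.\<close>

lemma Ck_on_cong:
  assumes "open S" and "\<And>x. x \<in> S \<Longrightarrow> f x = g x"
  shows "Ck_on k S f \<longleftrightarrow> Ck_on k S g"
  using assms(2)
proof (induction k arbitrary: f g)
  case 0
  then show ?case by (simp cong: continuous_on_cong)
next
  case (Suc k)
  have imp: "Ck_on (Suc k) S f \<Longrightarrow> Ck_on (Suc k) S g"
    if fg: "\<And>x. x \<in> S \<Longrightarrow> f x = g x" for f g :: "'a \<Rightarrow> 'b"
  proof -
    assume f: "Ck_on (Suc k) S f"
    have d: "(g has_derivative frechet_derivative f (at x)) (at x)" if "x \<in> S" for x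
      using f that \<open>open S\<close> fg
      by (auto intro!: has_derivative_transform_within_open[of f _ x UNIV S g]
          simp flip: frechet_derivative_works)
    have "frechet_derivative f (at x) = frechet_derivative g (at x)" if "x \<in> S" for x
      using d[OF that] frechet_derivative_at by blast
    then have "Ck_on k S (\<lambda>x. frechet_derivative g (at x) w)" for w
      using f Suc.IH[of "\<lambda>x. frechet_derivative f (at x) w" "\<lambda>x. frechet_derivative g (at x) w"] by simp
    then show ?thesis using d by (auto simp: differentiable_def)
  qed
  show ?case using imp[of f g, OF Suc.prems] imp[of g f, OF Suc.prems[symmetric]] by blast
qed

text \<open>By uniqueness of Frechet derivatives, any computed formula may stand in for
  \<open>frechet_derivative\<close> in the recursion. Openness enters through
  \<open>Ck_on_cong\<close>, since the formula is correct only on \<open>S\<close>.\<close>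

lemma Ck_on_Suc_I:
  assumes "open S" and "\<And>x. x \<in> S \<Longrightarrow> (f has_derivative f' x) (at x)"
    and "\<And>w. Ck_on k S (\<lambda>x. f' x w)"
  shows "Ck_on (Suc k) S f"
proof -
  have "f' x = frechet_derivative f (at x)" if "x \<in> S" for x
    using assms(2)[OF that] frechet_derivative_at by blast
  then have "Ck_on k S (\<lambda>x. frechet_derivative f (at x) w)" for w
    using assms(3)[of w] Ck_on_cong[OF assms(1), of "\<lambda>x. f' x w" "\<lambda>x. frechet_derivative f (at x) w"] by simp
  then show ?thesis using assms(2) by (auto simp: differentiable_def)
qed

lemma Ck_on_Suc_imp: "Ck_on (Suc k) S f \<Longrightarrow> Ck_on k S f"
proof (induction k arbitrary: f)
  case 0
  then show ?case
    by (auto intro!: continuous_at_imp_continuous_on differentiable_imp_continuous_within)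
qed simp

lemma Ck_on_subset: "Ck_on k S f \<Longrightarrow> T \<subseteq> S \<Longrightarrow> Ck_on k T f"
  by (induction k arbitrary: f) (auto intro: continuous_on_subset)

lemma Ck_on_const: "Ck_on k S (\<lambda>x. c)"
  by (induction k arbitrary: c) auto

lemma Ck_on_add:
  assumes "open S" "Ck_on k S f" "Ck_on k S g"
  shows "Ck_on k S (\<lambda>x. f x + g x)"
  using assms(2,3)
proof (induction k arbitrary: f g)
  case 0 then show ?case by (simp add: continuous_on_add)
next
  case (Suc k)
  show ?case
  proof (rule Ck_on_Suc_I[OF assms(1)])
    show "((\<lambda>x. f x + g x) has_derivative
        (\<lambda>w. frechet_derivative f (at x) w + frechet_derivative g (at x) w)) (at x)" if "x \<in> S" for x
      using Suc.prems that by (auto intro!: has_derivative_add simp flip: frechet_derivative_works)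
  qed (use Suc in auto)
qed

lemma (in bounded_bilinear) Ck_on:
  assumes "open S" "Ck_on k S f" "Ck_on k S g"
  shows "Ck_on k S (\<lambda>x. prod (f x) (g x))"
  using assms(2,3)
proof (induction k arbitrary: f g)
  case 0 then show ?case by (simp add: continuous_on)
next
  case (Suc k)
  show ?case
  proof (rule Ck_on_Suc_I[OF assms(1)])
    show "((\<lambda>x. prod (f x) (g x)) has_derivative
        (\<lambda>w. prod (f x) (frechet_derivative g (at x) w) + prod (frechet_derivative f (at x) w) (g x))) (at x)"
      if "x \<in> S" for x
      using Suc.prems that by (auto intro!: FDERIV simp flip: frechet_derivative_works)
    show "Ck_on k S (\<lambda>x. prod (f x) (frechet_derivative g (at x) w) + prod (frechet_derivative f (at x) w) (g x))" for w
      using Suc.prems by (intro Ck_on_add[OF assms(1)] Suc.IH Ck_on_Suc_imp[of k S f] Ck_on_Suc_imp[of k S g]) auto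
  qed
qed

lemma (in bounded_linear) Ck_on:
  assumes "open S" "Ck_on k S g"
  shows "Ck_on k S (\<lambda>x. f (g x))"
  using assms(2)
proof (induction k arbitrary: g)
  case 0 then show ?case by (simp add: continuous_on)
next
  case (Suc k)
  show ?case
  proof (rule Ck_on_Suc_I[OF assms(1)])
    show "((\<lambda>x. f (g x)) has_derivative (\<lambda>w. f (frechet_derivative g (at x) w))) (at x)" if "x \<in> S" for x
      using Suc.prems that by (auto intro!: has_derivative simp flip: frechet_derivative_works)
  qed (use Suc in auto)
qed

lemma Ck_on_sum:
  assumes "open S" "\<And>i. i \<in> I \<Longrightarrow> Ck_on k S (f i)"
  shows "Ck_on k S (\<lambda>x. \<Sum>i\<in>I. f i x)"
  using assms(2)
  by (induction I rule: infinite_finite_induct) (auto intro: Ck_on_const Ck_on_add[OF assms(1)])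

lemma Ck_on_ident: "Ck_on k S (\<lambda>x. x)"
  by (cases k) (auto intro: Ck_on_const)

text \<open>The chain rule evaluates the derivative of \<open>f\<close> in a direction that moves
  with \<open>x\<close>, which the induction hypothesis does not cover. Expanding that direction in
  a fixed basis gives a finite sum of products to which it applies; hence the Euclidean domain of
  \<open>f\<close>.\<close>

lemma Ck_on_compose:
  fixes f :: "'b::euclidean_space \<Rightarrow> 'c::real_normed_vector"
  assumes "open S" "open T" "Ck_on k T f" "Ck_on k S h" "h ` S \<subseteq> T"
  shows "Ck_on k S (\<lambda>x. f (h x))"
  using assms(3,4)
proof (induction k arbitrary: f)
  case 0 then show ?case using assms(5) by (auto intro: continuous_on_compose2)
next
  case (Suc k)
  let ?f' = "\<lambda>x w. \<Sum>i\<in>Basis. (frechet_derivative h (at x) w \<bullet> i) *\<^sub>R frechet_derivative f (at (h x)) i"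
  show ?case
  proof (rule Ck_on_Suc_I[OF assms(1)])
    fix x assume x: "x \<in> S"
    have h: "(h has_derivative frechet_derivative h (at x)) (at x)"
      using Suc.prems x by (simp flip: frechet_derivative_works)
    have f: "(f has_derivative frechet_derivative f (at (h x))) (at (h x))"
      using Suc.prems x assms(5) by (auto simp flip: frechet_derivative_works)
    have rep: "frechet_derivative f (at (h x)) w = (\<Sum>i\<in>Basis. (w \<bullet> i) *\<^sub>R frechet_derivative f (at (h x)) i)" for w
    proof -
      have l: "linear (frechet_derivative f (at (h x)))"
        using f has_derivative_linear by blast
      show ?thesis
        by (subst euclidean_representation[of w, symmetric]) (simp add: linear_sum[OF l] linear_scale[OF l])
    qed
    have "frechet_derivative f (at (h x)) \<circ> frechet_derivative h (at x) = ?f' x"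
      unfolding o_def by (intro ext rep)
    with diff_chain_at[OF h f] show "((\<lambda>x. f (h x)) has_derivative ?f' x) (at x)"
      by (simp only: o_def)
  next
    fix w
    have "Ck_on k S (\<lambda>x. frechet_derivative f (at (h x)) i)" for i
      using Suc.prems by (intro Suc.IH) (auto dest: Ck_on_Suc_imp simp del: Ck_on.simps simp: Ck_on.simps(2)[of k T])
    moreover have "Ck_on k S (\<lambda>x. frechet_derivative h (at x) w \<bullet> i)" for i
      using Suc.prems by (intro bounded_linear.Ck_on[OF bounded_linear_inner_left assms(1)]) auto
    ultimately show "Ck_on k S (\<lambda>x. ?f' x w)"
      by (intro Ck_on_sum[OF assms(1)] bounded_bilinear.Ck_on[OF bounded_bilinear_scaleR assms(1)])
  qed
qed

text \<open>The derivative is a polynomial in the reciprocal itself and in the derivative of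
  \<open>f\<close>, so the induction on \<open>k\<close> feeds on its own conclusion. The square
  root below works in the same way.\<close>

lemma Ck_on_inverse:
  fixes f :: "'a::real_normed_vector \<Rightarrow> real"
  assumes "open S" "Ck_on k S f" "\<And>x. x \<in> S \<Longrightarrow> f x \<noteq> 0"
  shows "Ck_on k S (\<lambda>x. inverse (f x))"
  using assms(2)
proof (induction k)
  case 0 then show ?case using assms(3) by (auto intro: continuous_on_inverse)
next
  case (Suc k)
  show ?case
  proof (rule Ck_on_Suc_I[OF assms(1)])
    show "((\<lambda>x. inverse (f x)) has_derivative
        (\<lambda>w. - (inverse (f x) * frechet_derivative f (at x) w * inverse (f x)))) (at x)" if "x \<in> S" for x
      using Suc.prems that assms(3)
      by (auto intro!: Deriv.has_derivative_inverse simp flip: frechet_derivative_works)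
    show "Ck_on k S (\<lambda>x. - (inverse (f x) * frechet_derivative f (at x) w * inverse (f x)))" for w
      using Suc Ck_on_Suc_imp[OF Suc.prems]
      by (intro bounded_linear.Ck_on[OF bounded_linear_minus[OF bounded_linear_ident] assms(1)] bounded_bilinear.Ck_on[OF bounded_bilinear_mult assms(1)]) auto
  qed
qed

lemma Ck_on_sqrt:
  fixes f :: "'a::real_normed_vector \<Rightarrow> real"
  assumes "open S" "Ck_on k S f" "\<And>x. x \<in> S \<Longrightarrow> f x > 0"
  shows "Ck_on k S (\<lambda>x. sqrt (f x))"
  using assms(2)
proof (induction k)
  case 0 then show ?case by (auto intro: continuous_on_real_sqrt)
next
  case (Suc k)
  show ?case
  proof (rule Ck_on_Suc_I[OF assms(1)])
    show "((\<lambda>x. sqrt (f x)) has_derivative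
        (\<lambda>w. frechet_derivative f (at x) w * (inverse (sqrt (f x)) / 2))) (at x)" if "x \<in> S" for x
      using Suc.prems that assms(3)
      by (auto intro!: derivative_eq_intros simp flip: frechet_derivative_works)
    have "sqrt (f x) \<noteq> 0" if "x \<in> S" for x using assms(3)[OF that] by simp
    then show "Ck_on k S (\<lambda>x. frechet_derivative f (at x) w * (inverse (sqrt (f x)) / 2))" for w
      using Suc Ck_on_Suc_imp[OF Suc.prems]
      by (intro bounded_bilinear.Ck_on[OF bounded_bilinear_mult assms(1)] Ck_on_inverse[OF assms(1)]
          bounded_linear.Ck_on[OF bounded_linear_divide assms(1)]) auto
  qed
qed

section \<open>Calculus of smooth functions\<close>

lemma smooth_on_differentiable: "smooth_on S f \<Longrightarrow> x \<in> S \<Longrightarrow> f differentiable (at x)"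
  unfolding smooth_on_def by (metis Ck_on.simps(2))

lemma smooth_on_has_derivative:
  "smooth_on S f \<Longrightarrow> x \<in> S \<Longrightarrow> (f has_derivative frechet_derivative f (at x)) (at x)"
  by (simp add: smooth_on_differentiable flip: frechet_derivative_works)

lemma smooth_on_frechet_derivative:
  "smooth_on S f \<Longrightarrow> smooth_on S (\<lambda>x. frechet_derivative f (at x) w)"
  unfolding smooth_on_def by (metis Ck_on.simps(2))

lemma smooth_on_continuous: "smooth_on S f \<Longrightarrow> continuous_on S f"
  unfolding smooth_on_def by (metis Ck_on.simps(1))

lemma smooth_on_subset: "smooth_on S f \<Longrightarrow> T \<subseteq> S \<Longrightarrow> smooth_on T f"
  unfolding smooth_on_def using Ck_on_subset by blast

lemma smooth_on_cong:
  "open S \<Longrightarrow> (\<And>x. x \<in> S \<Longrightarrow> f x = g x) \<Longrightarrow> smooth_on S f \<longleftrightarrow> smooth_on S g"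
  unfolding smooth_on_def using Ck_on_cong by blast

lemma smooth_on_const: "smooth_on S (\<lambda>x. c)"
  by (simp add: smooth_on_def Ck_on_const)

lemma smooth_on_ident: "smooth_on S (\<lambda>x. x)"
  by (simp add: smooth_on_def Ck_on_ident)

lemma smooth_on_add: "open S \<Longrightarrow> smooth_on S f \<Longrightarrow> smooth_on S g \<Longrightarrow> smooth_on S (\<lambda>x. f x + g x)"
  by (simp add: smooth_on_def Ck_on_add)

lemma smooth_on_sum:
  "open S \<Longrightarrow> (\<And>i. i \<in> I \<Longrightarrow> smooth_on S (f i)) \<Longrightarrow> smooth_on S (\<lambda>x. \<Sum>i\<in>I. f i x)"
  by (simp add: smooth_on_def Ck_on_sum)

lemma (in bounded_linear) smooth_on:
  "open S \<Longrightarrow> smooth_on S g \<Longrightarrow> smooth_on S (\<lambda>x. f (g x))"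
  by (simp add: smooth_on_def Ck_on)

lemma (in bounded_bilinear) smooth_on:
  "open S \<Longrightarrow> smooth_on S f \<Longrightarrow> smooth_on S g \<Longrightarrow> smooth_on S (\<lambda>x. prod (f x) (g x))"
  by (simp add: smooth_on_def Ck_on)

lemmas smooth_on_mult = bounded_bilinear.smooth_on[OF bounded_bilinear_mult]
lemmas smooth_on_scaleR = bounded_bilinear.smooth_on[OF bounded_bilinear_scaleR]
lemmas smooth_on_inner = bounded_bilinear.smooth_on[OF bounded_bilinear_inner]
lemmas smooth_on_minus = bounded_linear.smooth_on[OF bounded_linear_minus[OF bounded_linear_ident]]
lemmas smooth_on_nth = bounded_linear.smooth_on[OF bounded_linear_vec_nth]

lemma smooth_on_diff:
  "open S \<Longrightarrow> smooth_on S f \<Longrightarrow> smooth_on S g \<Longrightarrow> smooth_on S (\<lambda>x. f x - g x)"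
  using smooth_on_add[of S f "\<lambda>x. - g x"] smooth_on_minus[of S g] by simp

lemma smooth_on_inverse:
  fixes f :: "'a::real_normed_vector \<Rightarrow> real"
  shows "open S \<Longrightarrow> smooth_on S f \<Longrightarrow> (\<And>x. x \<in> S \<Longrightarrow> f x \<noteq> 0) \<Longrightarrow> smooth_on S (\<lambda>x. inverse (f x))"
  by (simp add: smooth_on_def Ck_on_inverse)

lemma smooth_on_divide:
  fixes f g :: "'a::real_normed_vector \<Rightarrow> real"
  shows "open S \<Longrightarrow> smooth_on S f \<Longrightarrow> smooth_on S g \<Longrightarrow> (\<And>x. x \<in> S \<Longrightarrow> g x \<noteq> 0) \<Longrightarrow>
    smooth_on S (\<lambda>x. f x / g x)"
  unfolding divide_inverse by (intro smooth_on_mult smooth_on_inverse)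

lemma smooth_on_divide_const:
  fixes f :: "'a::real_normed_vector \<Rightarrow> real"
  shows "open S \<Longrightarrow> smooth_on S f \<Longrightarrow> smooth_on S (\<lambda>x. f x / c)"
  by (rule bounded_linear.smooth_on[OF bounded_linear_divide])

lemma smooth_on_sqrt:
  fixes f :: "'a::real_normed_vector \<Rightarrow> real"
  shows "open S \<Longrightarrow> smooth_on S f \<Longrightarrow> (\<And>x. x \<in> S \<Longrightarrow> f x > 0) \<Longrightarrow> smooth_on S (\<lambda>x. sqrt (f x))"
  by (simp add: smooth_on_def Ck_on_sqrt)

lemma smooth_on_prod:
  fixes f :: "'i \<Rightarrow> 'a::real_normed_vector \<Rightarrow> real"
  assumes "open S" "\<And>i. i \<in> I \<Longrightarrow> smooth_on S (f i)"
  shows "smooth_on S (\<lambda>x. \<Prod>i\<in>I. f i x)"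
  using assms(2)
  by (induction I rule: infinite_finite_induct) (auto intro: smooth_on_const smooth_on_mult[OF assms(1)])

lemma smooth_on_compose:
  fixes f :: "'b::euclidean_space \<Rightarrow> 'c::real_normed_vector"
  shows "open S \<Longrightarrow> open T \<Longrightarrow> smooth_on T f \<Longrightarrow> smooth_on S h \<Longrightarrow> h ` S \<subseteq> T \<Longrightarrow> smooth_on S (\<lambda>x. f (h x))"
  by (simp add: smooth_on_def Ck_on_compose)

lemma Ck_on_componentwise:
  fixes f :: "'a::real_normed_vector \<Rightarrow> 'b::euclidean_space"
  assumes "open S" "\<And>i. i \<in> Basis \<Longrightarrow> Ck_on k S (\<lambda>x. f x \<bullet> i)"
  shows "Ck_on k S f"
proof -
  have "Ck_on k S (\<lambda>x. \<Sum>i\<in>Basis. (f x \<bullet> i) *\<^sub>R i)"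
    using assms
    by (intro Ck_on_sum bounded_bilinear.Ck_on[OF bounded_bilinear_scaleR] Ck_on_const)
  then show ?thesis by (simp only: euclidean_representation)
qed

lemma smooth_on_componentwise:
  fixes f :: "'a::real_normed_vector \<Rightarrow> 'b::euclidean_space"
  shows "open S \<Longrightarrow> (\<And>i. i \<in> Basis \<Longrightarrow> smooth_on S (\<lambda>x. f x \<bullet> i)) \<Longrightarrow> smooth_on S f"
  unfolding smooth_on_def by (blast intro: Ck_on_componentwise)

lemma smooth_on_vec_lambda:
  fixes f :: "'n::finite \<Rightarrow> 'a::real_normed_vector \<Rightarrow> 'b::euclidean_space"
  assumes "open S" "\<And>i. smooth_on S (f i)"
  shows "smooth_on S (\<lambda>x. \<chi> i. f i x)"
proof (rule smooth_on_componentwise[OF assms(1)])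
  fix b :: "'b^'n" assume "b \<in> Basis"
  then obtain i u where "b = axis i u" by (auto simp: Basis_vec_def)
  then show "smooth_on S (\<lambda>x. (\<chi> i. f i x) \<bullet> b)"
    using smooth_on_inner[OF assms(1) assms(2)[of i] smooth_on_const[of S u]] by (simp add: inner_axis)
qed

lemma smooth_on_Pair:
  fixes f :: "'a::real_normed_vector \<Rightarrow> 'b::euclidean_space" and g :: "'a \<Rightarrow> 'c::euclidean_space"
  assumes "open S" "smooth_on S f" "smooth_on S g"
  shows "smooth_on S (\<lambda>x. (f x, g x))"
proof (rule smooth_on_componentwise[OF assms(1)])
  fix b :: "'b \<times> 'c" assume "b \<in> Basis"
  show "smooth_on S (\<lambda>x. (f x, g x) \<bullet> b)"
    using assms by (cases b) (auto simp: inner_Pair intro!: smooth_on_add smooth_on_inner smooth_on_const)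
qed

lemma smooth_on_det:
  fixes M :: "'a::real_normed_vector \<Rightarrow> real^'n^'n"
  assumes "open S" "\<And>i j. smooth_on S (\<lambda>x. M x $ i $ j)"
  shows "smooth_on S (\<lambda>x. det (M x))"
  unfolding det_def
  by (intro smooth_on_sum smooth_on_mult smooth_on_const smooth_on_prod assms)

section \<open>Smooth inversion of matrices\<close>

lemma matrix_inv:
  assumes "invertible M"
  shows "M ** matrix_inv M = mat 1" "matrix_inv M ** M = mat 1"
proof -
  have "M ** matrix_inv M = mat 1 \<and> matrix_inv M ** M = mat 1"
    unfolding matrix_inv_def by (rule someI_ex) (use assms invertible_def in blast)
  then show "M ** matrix_inv M = mat 1" "matrix_inv M ** M = mat 1" by auto
qed

text \<open>Cramer's rule for the columns of the inverse presents its entries as quotients of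
  polynomials in the entries of \<open>M\<close>, which is what smoothness of the inverse metric
  rests on.\<close>

lemma matrix_inv_cramer:
  fixes M :: "real^'n^'n"
  assumes "invertible M"
  shows "matrix_inv M $ a $ b = det (\<chi> i j. if j = a then axis b 1 $ i else M $ i $ j) / det M"
proof -
  have "M *v (matrix_inv M *v axis b 1) = axis b 1"
    using assms by (simp add: matrix_vector_mul_assoc matrix_inv(1))
  then have "matrix_inv M *v axis b 1 = (\<chi> k. det (\<chi> i j. if j = k then axis b 1 $ i else M $ i $ j) / det M)"
    using cramer invertible_det_nz assms by blast
  then have "(matrix_inv M *v axis b 1) $ a = det (\<chi> i j. if j = a then axis b 1 $ i else M $ i $ j) / det M"
    by simp
  then show ?thesis by (simp add: matrix_vector_mul_component inner_axis column_def matrix_vector_mult_basis)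
qed

lemma smooth_on_matrix_inv:
  fixes M :: "'a::real_normed_vector \<Rightarrow> real^'n^'n"
  assumes "open S" "\<And>i j. smooth_on S (\<lambda>x. M x $ i $ j)" "\<And>x. x \<in> S \<Longrightarrow> invertible (M x)"
  shows "smooth_on S (\<lambda>x. matrix_inv (M x) $ a $ b)"
proof -
  have "smooth_on S (\<lambda>x. if j = a then axis b 1 $ i else M x $ i $ j)" for i j
    by (cases "j = a") (auto intro: smooth_on_const assms)
  then have "smooth_on S (\<lambda>x. det (\<chi> i j. if j = a then axis b 1 $ i else M x $ i $ j) / det (M x))"
    using assms by (intro smooth_on_divide smooth_on_det) (auto simp: invertible_det_nz)
  then show ?thesis
    by (subst smooth_on_cong[OF assms(1) matrix_inv_cramer[OF assms(3)]])
qed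

section \<open>Local analysis: Poincare lemma and inverse functions\<close>

abbreviation fd :: "('a::real_normed_vector \<Rightarrow> 'b::real_normed_vector) \<Rightarrow> 'a \<Rightarrow> 'a \<Rightarrow> 'b" where
  "fd f x \<equiv> frechet_derivative f (at x)"

lemma fd_eqI: "(f has_derivative f') (at x) \<Longrightarrow> fd f x w = f' w"
  using frechet_derivative_at by metis

lemma linear_fd: "f differentiable (at x) \<Longrightarrow> linear (fd f x)"
  using frechet_derivative_works has_derivative_linear by blast

lemma bounded_linear_fd: "f differentiable (at x) \<Longrightarrow> bounded_linear (fd f x)"
  using frechet_derivative_works has_derivative_bounded_linear by blast

text \<open>The Leibniz rule, with the parameter in the second factor. The partial derivative is
  packed into a bounded linear map whose joint continuity is checked on basis vectors; at the end
  the integral is evaluated on \<open>w\<close>.\<close>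

lemma fd_integral:
  fixes F :: "real \<times> 'a::euclidean_space \<Rightarrow> real"
  assumes B: "open B" "convex B" "x0 \<in> B"
    and F: "smooth_on W F" and W: "{0..1} \<times> B \<subseteq> W"
  shows "((\<lambda>x. integral {0..1} (\<lambda>t. F (t, x))) has_derivative
    (\<lambda>w. integral {0..1} (\<lambda>t. fd F (t, x0) (0, w)))) (at x0)"
proof -
  define fx where "fx x t = Blinfun (\<lambda>w. fd F (t, x) (0, w))" for x t
  have der: "(F has_derivative fd F (t, x)) (at (t, x))" if "x \<in> B" "t \<in> {0..1}" for t x
    using smooth_on_has_derivative[OF F] W that by blast
  have der2: "((\<lambda>x. F (t, x)) has_derivative (\<lambda>w. fd F (t, x) (0, w))) (at x)"
    if "x \<in> B" "t \<in> {0..1}" for t x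
    using diff_chain_at[OF has_derivative_Pair[OF has_derivative_const has_derivative_ident] der[OF that]]
    by (simp add: o_def)
  have fx: "blinfun_apply (fx x t) = (\<lambda>w. fd F (t, x) (0, w))" if "x \<in> B" "t \<in> {0..1}" for t x
    unfolding fx_def using der2[OF that] by (intro bounded_linear_Blinfun_apply has_derivative_bounded_linear)
  have cont: "continuous_on (B \<times> {0..1}) (\<lambda>(x, t). fd F (t, x) (0, w))" for w
  proof -
    have "continuous_on W (\<lambda>z. fd F z (0, w))"
      using smooth_on_continuous smooth_on_frechet_derivative F by blast
    then have "continuous_on (B \<times> {0..1}) (\<lambda>z. fd F (snd z, fst z) (0, w))"
      using W by (intro continuous_on_compose2[of W "\<lambda>z. fd F z (0, w)" _ "\<lambda>z. (snd z, fst z)"]) (auto intro!: continuous_intros)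
    then show ?thesis by (simp add: case_prod_beta)
  qed
  have contfx: "continuous_on (B \<times> {0..1}) (\<lambda>(x, t). fx x t)"
  proof (rule continuous_on_blinfun_componentwise)
    fix i :: 'a
    show "continuous_on (B \<times> {0..1}) (\<lambda>z. blinfun_apply (case z of (x, t) \<Rightarrow> fx x t) i)"
      using cont[of i] by (rule continuous_on_eq) (auto simp: fx)
  qed
  have "((\<lambda>x. integral (cbox 0 1) (\<lambda>t. F (t, x))) has_derivative
      blinfun_apply (integral (cbox 0 1) (fx x0))) (at x0 within B)"
  proof (rule leibniz_rule)
    show "((\<lambda>x. F (t, x)) has_derivative blinfun_apply (fx x t)) (at x within B)"
      if "x \<in> B" "t \<in> cbox 0 1" for x t
      using der2[of x t] fx[of x t] that by (auto intro: has_derivative_at_withinI)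
    show "(\<lambda>t. F (t, x)) integrable_on cbox 0 1" if "x \<in> B" for x
    proof (rule integrable_continuous)
      show "continuous_on (cbox 0 1) (\<lambda>t. F (t, x))"
        using smooth_on_continuous[OF F] W that
        by (auto intro!: continuous_on_compose2[of W F] continuous_intros)
    qed
  qed (use B contfx in auto)
  moreover have "blinfun_apply (integral (cbox 0 1) (fx x0)) = (\<lambda>w. integral {0..1} (\<lambda>t. fd F (t, x0) (0, w)))"
  proof (rule ext)
    fix w
    have "continuous_on (cbox 0 1) (\<lambda>t. (x0, t))" by (intro continuous_intros)
    from continuous_on_compose2[OF contfx this] B have "continuous_on (cbox 0 1) (fx x0)"
      by (auto simp: image_subset_iff)
    then have "integral (cbox 0 1) ((\<lambda>L. blinfun_apply L w) \<circ> fx x0) = blinfun_apply (integral (cbox 0 1) (fx x0)) w"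
      by (intro integral_linear integrable_continuous blinfun.bounded_linear_left)
    moreover have "integral (cbox 0 1) ((\<lambda>L. blinfun_apply L w) \<circ> fx x0) = integral {0..1} (\<lambda>t. fd F (t, x0) (0, w))"
      using B by (auto simp: fx intro!: integral_cong)
    ultimately show "blinfun_apply (integral (cbox 0 1) (fx x0)) w = integral {0..1} (\<lambda>t. fd F (t, x0) (0, w))"
      by simp
  qed
  ultimately show ?thesis using B by (simp add: at_within_open[OF B(3,1)] cbox_interval)
qed

text \<open>Each derivative is again an integral of the same kind, with a smooth integrand on the
  same \<open>W\<close>, so differentiation under the integral can be iterated.\<close>

lemma smooth_on_integral:
  fixes F :: "real \<times> 'a::euclidean_space \<Rightarrow> real"
  assumes B: "open B" "convex B" and F: "smooth_on W F" and W: "{0..1} \<times> B \<subseteq> W"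
  shows "smooth_on B (\<lambda>x. integral {0..1} (\<lambda>t. F (t, x)))"
proof -
  have "Ck_on k B (\<lambda>x. integral {0..1} (\<lambda>t. F (t, x)))" if "smooth_on W F" for k and F :: "real \<times> 'a \<Rightarrow> real"
    using that
  proof (induction k arbitrary: F)
    case 0
    have "isCont (\<lambda>x. integral {0..1} (\<lambda>t. F (t, x))) x" if "x \<in> B" for x
      by (rule has_derivative_continuous[OF fd_integral[OF B that 0 W]])
    then show ?case by (auto intro!: continuous_at_imp_continuous_on)
  next
    case (Suc k)
    show ?case
      by (rule Ck_on_Suc_I[OF B(1) fd_integral[OF B _ Suc.prems W]])
        (auto intro!: Suc.IH smooth_on_frechet_derivative Suc.prems)
  qed
  then show ?thesis using F by (simp add: smooth_on_def)
qed

text \<open>The increment of \<open>f\<close> along \<open>v\<close> is an integral of its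
  \<open>v\<close>-derivative. Differentiating this identity along \<open>w\<close> under the
  integral, dividing by the step \<tau> and letting it tend to 0 turns one side into one mixed
  derivative and the other side into the other.\<close>

lemma symmetric_second_derivative:
  fixes f :: "'a::euclidean_space \<Rightarrow> real"
  assumes S: "open S" "x \<in> S" and f: "smooth_on S f"
  shows "fd (\<lambda>y. fd f y v) x w = fd (\<lambda>y. fd f y w) x v"
proof -
  obtain e where e: "e > 0" "ball x e \<subseteq> S" using S open_contains_ball by blast
  \<comment> \<open>Shifts by \<tau> v with |\<tau>| < d have length below e/2, so they move the
    ball of radius e/2 inside the ball of radius e. The summand 1 covers the case v = 0.\<close>
  define d where "d = e / (2 * (norm v + 1))"
  have nv: "norm v + 1 > 0" by (simp add: add_nonneg_pos)
  have d: "d > 0" using e nv by (simp add: d_def)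
  have dv: "\<bar>\<tau>\<bar> < d \<Longrightarrow> norm (\<tau> *\<^sub>R v) < e / 2" for \<tau>
  proof -
    assume "\<bar>\<tau>\<bar> < d"
    then have "\<bar>\<tau>\<bar> * (norm v + 1) < d * (norm v + 1)" using nv by (rule mult_strict_right_mono)
    also have "\<dots> = e / 2" using nv by (simp add: d_def field_simps)
    finally have "\<bar>\<tau>\<bar> * (norm v + 1) < e / 2" .
    moreover have "\<bar>\<tau>\<bar> * norm v \<le> \<bar>\<tau>\<bar> * (norm v + 1)" by (intro mult_left_mono) auto
    ultimately show ?thesis by simp
  qed
  let ?g = "\<lambda>y. fd f y v"
  have g: "smooth_on S ?g" using f by (rule smooth_on_frechet_derivative)
  define B where "B = ball x (e/2)"
  have B: "open B" "convex B" "x \<in> B" using e by (auto simp: B_def)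
  have inS: "y + \<tau> *\<^sub>R v \<in> S" if "y \<in> B" "\<bar>\<tau>\<bar> < d" for y \<tau>
  proof -
    have "dist x (y + \<tau> *\<^sub>R v) \<le> dist x y + norm (\<tau> *\<^sub>R v)"
      using dist_triangle[of x "y + \<tau> *\<^sub>R v" y] by (simp add: dist_norm)
    then show ?thesis using dv[OF that(2)] that(1) e by (auto simp: B_def)
  qed
  have scale: "\<bar>t * \<tau>\<bar> < d" if "\<bar>\<tau>\<bar> < d" "t \<in> {0..1}" for t \<tau>
    using that mult_left_le_one_le[of "\<bar>\<tau>\<bar>" t] by (auto simp: abs_mult)
  have eq: "fd f (x + \<tau> *\<^sub>R v) w - fd f x w = \<tau> * integral {0..1} (\<lambda>t. fd ?g (x + (t * \<tau>) *\<^sub>R v) w)"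
    if \<tau>: "\<bar>\<tau>\<bar> < d" for \<tau>
  proof -
    let ?W = "(\<lambda>z. snd z + (fst z * \<tau>) *\<^sub>R v) -` S"
    have W: "open ?W" by (intro open_vimage S continuous_intros)
    have BW: "{0..1} \<times> B \<subseteq> ?W" using inS scale[OF \<tau>] by auto
    have "bounded_linear (\<lambda>z. snd z + (fst z * \<tau>) *\<^sub>R v)"
      by (intro bounded_linear_intros)
    then have sm: "smooth_on ?W (\<lambda>z. ?g (snd z + (fst z * \<tau>) *\<^sub>R v))"
      by (intro smooth_on_compose[OF W S(1) g] bounded_linear.smooth_on[OF _ W smooth_on_ident]) auto
    have "f (y + \<tau> *\<^sub>R v) - f y = \<tau> * integral {0..1} (\<lambda>t. ?g (y + (t * \<tau>) *\<^sub>R v))" if "y \<in> B" for y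
    proof -
      have "((\<lambda>t. \<tau> * ?g (y + (t * \<tau>) *\<^sub>R v)) has_integral
        (f (y + (1 * \<tau>) *\<^sub>R v) - f (y + (0 * \<tau>) *\<^sub>R v))) {0..1}"
      proof (rule fundamental_theorem_of_calculus)
        fix t :: real assume t: "t \<in> {0..1}"
        have h: "(f has_derivative fd f (y + (t * \<tau>) *\<^sub>R v)) (at (y + (t * \<tau>) *\<^sub>R v))"
          by (rule smooth_on_has_derivative[OF f inS[OF that scale[OF \<tau> t]]])
        have "((\<lambda>t. y + (t * \<tau>) *\<^sub>R v) has_derivative (\<lambda>s. (s * \<tau>) *\<^sub>R v)) (at t)"
          by (auto intro!: derivative_eq_intros)
        from diff_chain_at[OF this h]
        have "((\<lambda>t. f (y + (t * \<tau>) *\<^sub>R v)) has_derivative (\<lambda>s. fd f (y + (t * \<tau>) *\<^sub>R v) ((s * \<tau>) *\<^sub>R v))) (at t)"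
          by (simp add: o_def)
        moreover have "fd f (y + (t * \<tau>) *\<^sub>R v) ((s * \<tau>) *\<^sub>R v) = s * (\<tau> * ?g (y + (t * \<tau>) *\<^sub>R v))" for s
          using linear_scale[OF has_derivative_linear[OF h]] by simp
        ultimately show "((\<lambda>t. f (y + (t * \<tau>) *\<^sub>R v)) has_vector_derivative \<tau> * ?g (y + (t * \<tau>) *\<^sub>R v))
            (at t within {0..1})"
          by (auto simp: has_vector_derivative_def intro: has_derivative_at_withinI)
      qed simp
      then show ?thesis by (simp add: integral_unique flip: integral_mult_right)
    qed
    then have "(\<lambda>y. f (y + \<tau> *\<^sub>R v) - f y) x = \<tau> * integral {0..1} (\<lambda>t. ?g (x + (t * \<tau>) *\<^sub>R v))"
      and eqB: "\<And>y. y \<in> B \<Longrightarrow> f (y + \<tau> *\<^sub>R v) - f y = \<tau> * integral {0..1} (\<lambda>t. ?g (y + (t * \<tau>) *\<^sub>R v))"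
      using B by auto
    have "((\<lambda>y. f (y + \<tau> *\<^sub>R v) - f y) has_derivative (\<lambda>w. fd f (x + \<tau> *\<^sub>R v) w - fd f x w)) (at x)"
    proof (rule has_derivative_diff)
      have h: "(f has_derivative fd f (x + \<tau> *\<^sub>R v)) (at (x + \<tau> *\<^sub>R v))"
        by (rule smooth_on_has_derivative[OF f inS[OF B(3) \<tau>]])
      have "((\<lambda>y. y + \<tau> *\<^sub>R v) has_derivative (\<lambda>w. w)) (at x)" by (auto intro!: derivative_eq_intros)
      from diff_chain_at[OF this h] show "((\<lambda>y. f (y + \<tau> *\<^sub>R v)) has_derivative fd f (x + \<tau> *\<^sub>R v)) (at x)"
        by (simp add: o_def)
    qed (rule smooth_on_has_derivative[OF f S(2)])
    then have 1: "((\<lambda>y. \<tau> * integral {0..1} (\<lambda>t. ?g (y + (t * \<tau>) *\<^sub>R v))) has_derivative (\<lambda>w. fd f (x + \<tau> *\<^sub>R v) w - fd f x w)) (at x)"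
      by (rule has_derivative_transform_within_open[OF _ B(1,3)]) (rule eqB)
    have 2: "((\<lambda>y. \<tau> * integral {0..1} (\<lambda>t. ?g (y + (t * \<tau>) *\<^sub>R v))) has_derivative
        (\<lambda>w. \<tau> * integral {0..1} (\<lambda>t. fd (\<lambda>z. ?g (snd z + (fst z * \<tau>) *\<^sub>R v)) (t, x) (0, w)))) (at x)"
      using has_derivative_mult_right[OF fd_integral[OF B sm BW]] by simp
    have "integral {0..1} (\<lambda>t. fd (\<lambda>z. ?g (snd z + (fst z * \<tau>) *\<^sub>R v)) (t, x) (0, w))
        = integral {0..1} (\<lambda>t. fd ?g (x + (t * \<tau>) *\<^sub>R v) w)"
    proof (rule integral_cong)
      fix t :: real assume t: "t \<in> {0..1}"
      have h: "(?g has_derivative fd ?g (x + (t * \<tau>) *\<^sub>R v)) (at (snd (t, x) + (fst (t, x) * \<tau>) *\<^sub>R v))"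
        using smooth_on_has_derivative[OF g inS[OF B(3) scale[OF \<tau> t]]] by simp
      have "((\<lambda>z. snd z + (fst z * \<tau>) *\<^sub>R v) has_derivative (\<lambda>z. snd z + (fst z * \<tau>) *\<^sub>R v)) (at (t, x))"
        by (intro bounded_linear_imp_has_derivative bounded_linear_intros)
      from diff_chain_at[OF this h]
      have "((\<lambda>z. ?g (snd z + (fst z * \<tau>) *\<^sub>R v)) has_derivative
          (\<lambda>z. fd ?g (x + (t * \<tau>) *\<^sub>R v) (snd z + (fst z * \<tau>) *\<^sub>R v))) (at (t, x))"
        by (simp only: o_def)
      from fd_eqI[OF this, of "(0, w)"]
      show "fd (\<lambda>z. ?g (snd z + (fst z * \<tau>) *\<^sub>R v)) (t, x) (0, w) = fd ?g (x + (t * \<tau>) *\<^sub>R v) w"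
        by simp
    qed
    with fun_cong[OF has_derivative_unique[OF 1 2], of w] show ?thesis by simp
  qed
  define c where "c \<tau> = integral {0..1} (\<lambda>t. fd ?g (x + (t * \<tau>) *\<^sub>R v) w)" for \<tau>
  have cont: "isCont c 0"
  proof -
    let ?W = "(\<lambda>z. x + (fst z * snd z) *\<^sub>R v) -` S"
    have W: "open ?W" by (intro open_vimage S continuous_intros)
    have gw: "smooth_on S (\<lambda>y. fd ?g y w)" by (rule smooth_on_frechet_derivative[OF g])
    have sm: "smooth_on ?W (\<lambda>z. fd ?g (x + (fst z * snd z) *\<^sub>R v) w)"
      by (intro smooth_on_compose[OF W S(1) gw] smooth_on_add smooth_on_const smooth_on_scaleR smooth_on_mult W
          bounded_linear.smooth_on[OF bounded_linear_fst W smooth_on_ident]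
          bounded_linear.smooth_on[OF bounded_linear_snd W smooth_on_ident]) auto
    have sub: "{0..1} \<times> {-d<..<d} \<subseteq> ?W"
    proof safe
      fix t s :: real assume "t \<in> {0..1}" "s \<in> {-d<..<d}"
      then show "(t, s) \<in> ?W" using inS[OF B(3)] scale[of s t] by auto
    qed
    show ?thesis
      using has_derivative_continuous[OF fd_integral[OF _ _ _ sm sub, of 0]] d by (simp add: c_def[abs_def])
  qed
  have h: "((\<lambda>y. fd f y w) has_derivative fd (\<lambda>y. fd f y w) x) (at (x + 0 *\<^sub>R v))"
    using smooth_on_has_derivative[OF smooth_on_frechet_derivative[OF f] S(2)] by simp
  have "((\<lambda>\<tau>. x + \<tau> *\<^sub>R v) has_derivative (\<lambda>s. s *\<^sub>R v)) (at 0)" by (auto intro!: derivative_eq_intros)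
  from diff_chain_at[OF this h]
  have "((\<lambda>\<tau>. fd f (x + \<tau> *\<^sub>R v) w) has_derivative (\<lambda>s. s * fd (\<lambda>y. fd f y w) x v)) (at 0)"
    using linear_scale[OF has_derivative_linear[OF h]] by (simp add: o_def)
  then have "((\<lambda>\<tau>. fd f (x + \<tau> *\<^sub>R v) w) has_field_derivative fd (\<lambda>y. fd f y w) x v) (at 0)"
    by (simp add: has_field_derivative_def mult.commute[of _ "fd (\<lambda>y. fd f y w) x v"] mult_commute_abs)
  then have l1: "((\<lambda>\<tau>. (fd f (x + \<tau> *\<^sub>R v) w - fd f x w) / \<tau>) \<longlongrightarrow> fd (\<lambda>y. fd f y w) x v) (at 0)"
    by (simp add: has_field_derivative_iff)
  have "\<forall>\<^sub>F \<tau> in at 0. (fd f (x + \<tau> *\<^sub>R v) w - fd f x w) / \<tau> = c \<tau>"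
    unfolding eventually_at
    by (rule exI[of _ d]) (use d eq in \<open>auto simp: c_def\<close>)
  with l1 have "(c \<longlongrightarrow> fd (\<lambda>y. fd f y w) x v) (at 0)"
    by (rule Lim_transform_eventually)
  moreover have "(c \<longlongrightarrow> c 0) (at 0)" using cont by (simp add: isCont_def)
  ultimately have "c 0 = fd (\<lambda>y. fd f y w) x v" using LIM_unique by blast
  then show ?thesis by (simp add: c_def)
qed

text \<open>The inverse function theorem gives a differentiable inverse \<psi>. Its derivative at
  \<open>y\<close> is the inverse Jacobian taken at \<psi> y, with entries that are smooth functions
  of \<psi> y; so if \<psi> is C^k, its derivative is C^k, and \<psi> gains one order at a
  time.\<close>

lemma smooth_inverse_function:
  fixes \<phi> :: "real^'n \<Rightarrow> real^'n"
  assumes U: "open U" "p \<in> U" and \<phi>: "smooth_on U \<phi>" and inj: "\<And>w. fd \<phi> p w = 0 \<Longrightarrow> w = 0"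
  obtains U' V \<psi> where "open U'" "U' \<subseteq> U" "p \<in> U'" "open V" "\<phi> p \<in> V" "homeomorphism U' V \<phi> \<psi>"
    "smooth_on V \<psi>" "\<And>y e. y \<in> V \<Longrightarrow> fd \<phi> (\<psi> y) (fd \<psi> y e) = e"
    "\<And>x w. x \<in> U' \<Longrightarrow> fd \<psi> (\<phi> x) (fd \<phi> x w) = w"
proof -
  have bl: "bounded_linear (fd \<phi> x)" if "x \<in> U" for x
    using \<phi> that by (intro bounded_linear_fd smooth_on_differentiable)
  then have B: "blinfun_apply (Blinfun (fd \<phi> x)) = fd \<phi> x" if "x \<in> U" for x
    using that by (simp add: bounded_linear_Blinfun_apply)
  have lin: "linear (fd \<phi> p)" using bl U bounded_linear.linear by blast
  have "inj (fd \<phi> p)" using inj linear_injective_0[OF lin] by blast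
  then obtain g where g: "linear g" "\<And>x. g (fd \<phi> p x) = x"
    using linear_injective_isomorphism[OF lin] by metis
  have "continuous_on U (\<lambda>x. Blinfun (fd \<phi> x))"
  proof (rule continuous_on_blinfun_componentwise)
    fix i show "continuous_on U (\<lambda>x. blinfun_apply (Blinfun (fd \<phi> x)) i)"
      using smooth_on_continuous[OF smooth_on_frechet_derivative[OF \<phi>]] by (rule continuous_on_eq) (simp add: B)
  qed
  moreover have "Blinfun g o\<^sub>L Blinfun (fd \<phi> p) = id_blinfun"
    using g B[OF U(2)] by (intro blinfun_eqI) (simp add: bounded_linear_Blinfun_apply linear_conv_bounded_linear)
  ultimately obtain U' V \<psi> \<psi>' where r: "open U'" "U' \<subseteq> U" "p \<in> U'" "open V" "\<phi> p \<in> V" "homeomorphism U' V \<phi> \<psi>"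
    "\<And>y. y \<in> V \<Longrightarrow> (\<psi> has_derivative (\<psi>' y)) (at y)"
    "\<And>y. y \<in> V \<Longrightarrow> \<psi>' y = inv (blinfun_apply (Blinfun (fd \<phi> (\<psi> y))))"
    "\<And>y. y \<in> V \<Longrightarrow> bij (blinfun_apply (Blinfun (fd \<phi> (\<psi> y))))"
    using inverse_function_theorem[OF U(1) _ _ U(2), of \<phi> "\<lambda>x. Blinfun (fd \<phi> x)" "Blinfun g"]
      smooth_on_has_derivative[OF \<phi>] B by (metis (no_types, lifting))
  have \<psi>U: "\<psi> y \<in> U'" "\<phi> (\<psi> y) = y" if "y \<in> V" for y
    using r(6) that by (auto simp: homeomorphism_def)
  have bij: "bij (fd \<phi> (\<psi> y))" if "y \<in> V" for y
    using r(9)[OF that] B \<psi>U[OF that] r(2) by auto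
  have fd\<psi>: "fd \<psi> y e = inv (fd \<phi> (\<psi> y)) e" if "y \<in> V" for y e
    using fd_eqI[OF r(7)[OF that]] r(8)[OF that] B \<psi>U[OF that] r(2) by auto
  have 1: "fd \<phi> (\<psi> y) (fd \<psi> y e) = e" if "y \<in> V" for y e
    unfolding fd\<psi>[OF that] using bij[OF that] by (simp add: bij_is_surj surj_f_inv_f)
  have 2: "fd \<psi> (\<phi> x) (fd \<phi> x w) = w" if "x \<in> U'" for x w
  proof -
    have "\<phi> x \<in> V" "\<psi> (\<phi> x) = x" using r(6) that by (auto simp: homeomorphism_def)
    then show ?thesis using fd\<psi>[of "\<phi> x"] bij[of "\<phi> x"] by (simp add: bij_is_inj)
  qed
  define M where "M x = matrix (fd \<phi> x)" for x
  have M: "M x *v w = fd \<phi> x w" if "x \<in> U" for x w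
    unfolding M_def using bl[OF that] by (simp add: matrix_works bounded_linear.linear)
  have invM: "invertible (M x)" if "x \<in> U'" for x
  proof -
    have "x \<in> U" "x = \<psi> (\<phi> x)" "\<phi> x \<in> V" using r(2,6) that by (auto simp: homeomorphism_def)
    then have "inj ((*v) (M x))" using M bij[of "\<phi> x"] by (metis (no_types, lifting) bij_is_inj ext)
    then show ?thesis using invertible_left_inverse matrix_left_invertible_injective by blast
  qed
  have smM: "smooth_on U' (\<lambda>x. matrix_inv (M x) $ a $ b)" for a b
  proof (rule smooth_on_matrix_inv[OF r(1) _ invM])
    show "smooth_on U' (\<lambda>x. M x $ i $ j)" for i j
      unfolding M_def matrix_def
      using smooth_on_subset[OF smooth_on_nth[OF U(1) smooth_on_frechet_derivative[OF \<phi>]] r(2)] by simp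
  qed
  have inv: "fd \<psi> y w = matrix_inv (M (\<psi> y)) *v w" if "y \<in> V" for y w
  proof -
    have "w = M (\<psi> y) *v fd \<psi> y w" using 1[OF that] M \<psi>U[OF that] r(2) by auto
    then have "matrix_inv (M (\<psi> y)) *v w = (matrix_inv (M (\<psi> y)) ** M (\<psi> y)) *v fd \<psi> y w"
      by (metis matrix_vector_mul_assoc)
    then show ?thesis using matrix_inv(2)[OF invM] \<psi>U[OF that] by simp
  qed
  have "Ck_on k V \<psi>" for k
  proof (induction k)
    case 0 then show ?case using r(6) by (simp add: homeomorphism_def)
  next
    case (Suc k)
    show ?case
    proof (rule Ck_on_Suc_I[OF r(4)])
      show "(\<psi> has_derivative (\<lambda>w. matrix_inv (M (\<psi> y)) *v w)) (at y)" if "y \<in> V" for y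
      proof -
        have "\<psi>' y = (\<lambda>w. matrix_inv (M (\<psi> y)) *v w)"
          using inv[OF that] fd_eqI[OF r(7)[OF that]] by (metis ext)
        then show ?thesis using r(7)[OF that] by simp
      qed
      fix w
      have comp: "Ck_on k V (\<lambda>y. \<Sum>b\<in>UNIV. matrix_inv (M (\<psi> y)) $ a $ b * w $ b)" for a
        using smM Suc \<psi>U
        by (intro Ck_on_sum[OF r(4)] bounded_bilinear.Ck_on[OF bounded_bilinear_mult r(4)] Ck_on_const
            Ck_on_compose[OF r(4) r(1), of k "\<lambda>x. matrix_inv (M x) $ a $ b" \<psi> for b]) (auto simp: smooth_on_def)
      show "Ck_on k V (\<lambda>y. matrix_inv (M (\<psi> y)) *v w)"
      proof (rule Ck_on_componentwise[OF r(4)])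
        fix i :: "real^'n" assume "i \<in> Basis"
        then obtain a where "i = axis a 1" by (auto simp: Basis_vec_def)
        then show "Ck_on k V (\<lambda>y. (matrix_inv (M (\<psi> y)) *v w) \<bullet> i)"
          using comp[of a] by (simp only: inner_axis matrix_vector_mult_def vec_lambda_beta inner_real_def mult_1_right)
      qed
    qed
  qed
  then have "smooth_on V \<psi>" by (simp add: smooth_on_def)
  then show ?thesis using that r(1-6) 1 2 by blast
qed

text \<open>The homotopy contracts the ball along the range of the projection \<open>Q\<close> only: \<open>Q = id\<close> is the
  usual Poincare lemma, and a projection of corank one gives the version with a parameter.\<close>

lemma poincare_projection:
  fixes \<omega> :: "'a::euclidean_space \<Rightarrow> 'a" and Q :: "'a \<Rightarrow> 'a"
  assumes \<omega>: "smooth_on (ball p r) \<omega>" and Q: "linear Q" "\<And>w. Q (Q w) = Q w" "\<And>z. norm (z - Q z) \<le> norm z"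
    and closed: "\<And>y w w'. y \<in> ball p r \<Longrightarrow> Q w = w \<Longrightarrow> Q w' = w' \<Longrightarrow> fd \<omega> y w \<bullet> w' = fd \<omega> y w' \<bullet> w"
  obtains f where "smooth_on (ball p r) f" "\<And>x w. x \<in> ball p r \<Longrightarrow> Q w = w \<Longrightarrow> fd f x w = \<omega> x \<bullet> w"
proof -
  define B where "B = ball p r"
  have B: "open B" "convex B" by (auto simp: B_def)
  have blQ: "bounded_linear Q" using Q(1) linear_conv_bounded_linear by blast
  \<comment> \<open>The homotopy moves only the \<open>Q\<close>-part of x - p: it starts at x - Q
    (x - p) for t = 0 and ends at x for t = 1. The primitive \<open>f\<close> integrates \<omega>
    along this path.\<close>
  define c where "c z = snd z + (fst z - 1) *\<^sub>R Q (snd z - p)" for z :: "real \<times> 'a"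
  define F where "F z = \<omega> (c z) \<bullet> Q (snd z - p)" for z
  define W where "W = c -` B"
  have contc: "continuous_on UNIV c"
    unfolding c_def by (intro continuous_intros bounded_linear.continuous_on[OF blQ])
  then have W: "open W" unfolding W_def by (intro open_vimage B)
  have inB: "c (t, x) \<in> B" if "t \<in> {0..1}" "x \<in> B" for t x
  proof -
    \<comment> \<open>Relative to p the path is a convex combination of z - Q z and z, both of norm
      at most that of z, so it stays in the ball.\<close>
    let ?z = "x - p"
    have "c (t, x) - p = (1 - t) *\<^sub>R (?z - Q ?z) + t *\<^sub>R ?z"
      by (simp add: c_def algebra_simps)
    then have "norm (c (t, x) - p) \<le> norm ((1 - t) *\<^sub>R (?z - Q ?z)) + norm (t *\<^sub>R ?z)"
      using norm_triangle_ineq by metis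
    also have "\<dots> \<le> (1 - t) * norm ?z + t * norm ?z"
      using that Q(3)[of ?z] by (auto intro!: mult_left_mono)
    also have "\<dots> = norm ?z" by (simp add: algebra_simps)
    finally show ?thesis using that by (simp add: B_def dist_norm norm_minus_commute)
  qed
  then have BW: "{0..1} \<times> B \<subseteq> W" by (auto simp: W_def)
  have sfst: "smooth_on W fst" and ssnd: "smooth_on W snd"
    using bounded_linear.smooth_on[OF bounded_linear_fst W smooth_on_ident]
      bounded_linear.smooth_on[OF bounded_linear_snd W smooth_on_ident] by auto
  have sQ: "smooth_on W (\<lambda>z. Q (snd z - p))"
    by (intro bounded_linear.smooth_on[OF blQ W] smooth_on_diff[OF W] ssnd smooth_on_const)
  have sc: "smooth_on W c"
    unfolding c_def
    by (intro smooth_on_add[OF W] smooth_on_scaleR[OF W] smooth_on_diff[OF W] sQ sfst ssnd smooth_on_const)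
  have "smooth_on W (\<lambda>z. \<omega> (c z))"
    by (rule smooth_on_compose[OF W B(1) _ sc]) (use \<omega> in \<open>auto simp: B_def W_def\<close>)
  from smooth_on_inner[OF W this sQ] have sF: "smooth_on W F" by (simp add: F_def[abs_def])
  define f where "f x = integral {0..1} (\<lambda>t. F (t, x))" for x
  have "smooth_on B f" unfolding f_def by (rule smooth_on_integral[OF B sF BW])
  moreover have "fd f x w = \<omega> x \<bullet> w" if x: "x \<in> B" and w: "Q w = w" for x w
  proof -
    have "fd f x w = integral {0..1} (\<lambda>t. fd F (t, x) (0, w))"
      unfolding f_def using fd_eqI[OF fd_integral[OF B x sF BW]] .
    also have "\<dots> = integral {0..1} (\<lambda>t. \<omega> (c (t, x)) \<bullet> w + t * (fd \<omega> (c (t, x)) (Q (x - p)) \<bullet> w))"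
    proof (rule integral_cong)
      fix t :: real assume t: "t \<in> {0..1}"
      let ?c' = "\<lambda>z. snd z + (fst z *\<^sub>R Q (x - p) + (t - 1) *\<^sub>R Q (snd z))"
      have Q': "((\<lambda>z. Q (snd z - p)) has_derivative (\<lambda>z. Q (snd z))) (at (t, x))"
        by (rule bounded_linear.has_derivative[OF blQ]) (auto intro!: derivative_eq_intros)
      have c': "(c has_derivative ?c') (at (t, x))"
        unfolding c_def
        by (auto intro!: derivative_eq_intros Q' simp: algebra_simps)
      have "(\<omega> has_derivative fd \<omega> (c (t, x))) (at (c (t, x)))"
        using smooth_on_has_derivative[OF \<omega>] inB[OF t x] by (simp add: B_def)
      then have l: "linear (fd \<omega> (c (t, x)))" and "((\<lambda>z. \<omega> (c z)) has_derivative (\<lambda>z. fd \<omega> (c (t, x)) (?c' z))) (at (t, x))"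
        using diff_chain_at[OF c'] by (auto simp: o_def has_derivative_linear)
      from fd_eqI[OF has_derivative_inner[OF this(2) Q'], of "(0, w)"]
      have "fd F (t, x) (0, w) = \<omega> (c (t, x)) \<bullet> w + fd \<omega> (c (t, x)) (w + (t - 1) *\<^sub>R w) \<bullet> Q (x - p)"
        unfolding F_def using w by simp
      also have "w + (t - 1) *\<^sub>R w = t *\<^sub>R w" by (simp add: algebra_simps)
      also have "fd \<omega> (c (t, x)) (t *\<^sub>R w) \<bullet> Q (x - p) = t * (fd \<omega> (c (t, x)) (Q (x - p)) \<bullet> w)"
        using closed[of "c (t, x)" w "Q (x - p)"] inB[OF t x] w Q(2) by (simp add: linear_scale[OF l] B_def)
      finally show "fd F (t, x) (0, w) = \<omega> (c (t, x)) \<bullet> w + t * (fd \<omega> (c (t, x)) (Q (x - p)) \<bullet> w)" .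
    qed
    \<comment> \<open>After closedness has exchanged the two directions, the integrand is the
      derivative in t of t times the value of \<omega> at c (t, x) on w.\<close>
    also have "\<dots> = 1 * (\<omega> (c (1, x)) \<bullet> w) - 0 * (\<omega> (c (0, x)) \<bullet> w)"
    proof (rule integral_unique, rule fundamental_theorem_of_calculus)
      fix t :: real assume t: "t \<in> {0..1}"
      have c': "((\<lambda>t. c (t, x)) has_derivative (\<lambda>s. s *\<^sub>R Q (x - p))) (at t)"
        unfolding c_def by (auto intro!: derivative_eq_intros)
      have "(\<omega> has_derivative fd \<omega> (c (t, x))) (at (c (t, x)))"
        using smooth_on_has_derivative[OF \<omega>] inB[OF t x] by (simp add: B_def)
      then have l: "linear (fd \<omega> (c (t, x)))" and "((\<lambda>t. \<omega> (c (t, x))) has_derivative (\<lambda>s. fd \<omega> (c (t, x)) (s *\<^sub>R Q (x - p)))) (at t)"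
        using diff_chain_at[OF c'] by (auto simp: o_def has_derivative_linear)
      note * = this
      have "((\<lambda>t. t * (\<omega> (c (t, x)) \<bullet> w)) has_derivative
          (\<lambda>s. t * (fd \<omega> (c (t, x)) (s *\<^sub>R Q (x - p)) \<bullet> w) + s * (\<omega> (c (t, x)) \<bullet> w))) (at t)"
        by (intro has_derivative_mult has_derivative_ident has_derivative_inner_left *(2))
      moreover have "t * (fd \<omega> (c (t, x)) (s *\<^sub>R Q (x - p)) \<bullet> w) + s * (\<omega> (c (t, x)) \<bullet> w)
          = s *\<^sub>R (\<omega> (c (t, x)) \<bullet> w + t * (fd \<omega> (c (t, x)) (Q (x - p)) \<bullet> w))" for s
        unfolding linear_scale[OF l] inner_scaleR_left real_scaleR_def by algebra
      ultimately have "((\<lambda>t. t * (\<omega> (c (t, x)) \<bullet> w)) has_derivative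
          (\<lambda>s. s *\<^sub>R (\<omega> (c (t, x)) \<bullet> w + t * (fd \<omega> (c (t, x)) (Q (x - p)) \<bullet> w)))) (at t)"
        by (simp only:)
      then show "((\<lambda>t. t * (\<omega> (c (t, x)) \<bullet> w)) has_vector_derivative
          \<omega> (c (t, x)) \<bullet> w + t * (fd \<omega> (c (t, x)) (Q (x - p)) \<bullet> w)) (at t within {0..1})"
        unfolding has_vector_derivative_def by (rule has_derivative_at_withinI)
    qed simp
    also have "\<dots> = \<omega> x \<bullet> w" by (simp add: c_def)
    finally show ?thesis .
  qed
  ultimately show ?thesis using that by (simp add: B_def)
qed

section \<open>The Poincare lemma and its version along the leaves of a function\<close>

lemma fd_cong:
  assumes "open S" "x \<in> S" "\<And>y. y \<in> S \<Longrightarrow> f y = g y" "g differentiable (at x)"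
  shows "fd f x = fd g x"
proof -
  have "(f has_derivative fd g x) (at x)"
    using assms by (intro has_derivative_transform_within_open[of g "fd g x" x UNIV S f])
      (auto simp flip: frechet_derivative_works)
  then show ?thesis using frechet_derivative_at by metis
qed

lemma fd_inner_left: "f differentiable (at x) \<Longrightarrow> fd (\<lambda>y. f y \<bullet> b) x w = fd f x w \<bullet> b"
  by (rule fd_eqI[OF has_derivative_inner_left]) (simp flip: frechet_derivative_works)

lemma symmetric_second_derivative_euclidean:
  fixes f :: "'a::euclidean_space \<Rightarrow> 'b::euclidean_space"
  assumes S: "open S" "x \<in> S" and f: "smooth_on S f"
  shows "fd (\<lambda>y. fd f y v) x w = fd (\<lambda>y. fd f y w) x v"
proof (rule euclidean_eqI)
  fix b :: 'b
  have fb: "smooth_on S (\<lambda>y. f y \<bullet> b)"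
    by (intro smooth_on_inner S f smooth_on_const)
  have "fd (\<lambda>y. fd f y v) x w \<bullet> b = fd (\<lambda>y. fd (\<lambda>z. f z \<bullet> b) y v) x w" for v w
  proof -
    have "fd (\<lambda>y. fd f y v) x w \<bullet> b = fd (\<lambda>y. fd f y v \<bullet> b) x w"
      by (intro fd_inner_left[symmetric] smooth_on_differentiable[OF smooth_on_frechet_derivative[OF f] S(2)])
    also have "fd (\<lambda>y. fd f y v \<bullet> b) x = fd (\<lambda>y. fd (\<lambda>z. f z \<bullet> b) y v) x"
      by (rule fd_cong[OF S])
        (auto simp: fd_inner_left smooth_on_differentiable[OF f]
          intro: smooth_on_differentiable[OF smooth_on_frechet_derivative[OF fb] S(2)])
    finally show ?thesis .
  qed
  then show "fd (\<lambda>y. fd f y v) x w \<bullet> b = fd (\<lambda>y. fd f y w) x v \<bullet> b"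
    using symmetric_second_derivative[OF S fb] by simp
qed

lemma linear_functional_eq_inner:
  fixes g :: "real^'n \<Rightarrow> real"
  assumes "linear g"
  shows "(\<chi> a. g (axis a 1)) \<bullet> e = g e"
proof -
  have "e = (\<Sum>a\<in>UNIV. e $ a *\<^sub>R axis a 1)"
    using basis_expansion[of e] by (simp add: scalar_mult_eq_scaleR)
  then have "g e = g (\<Sum>a\<in>UNIV. e $ a *\<^sub>R axis a 1)" by simp
  also have "\<dots> = (\<Sum>a\<in>UNIV. e $ a * g (axis a 1))"
    by (simp add: linear_sum[OF assms] linear_scale[OF assms])
  finally show ?thesis by (simp add: inner_vec_def mult.commute)
qed

lemma poincare:
  fixes \<omega> :: "'a::euclidean_space \<Rightarrow> 'a"
  assumes U: "open U" "p \<in> U" and \<omega>: "smooth_on U \<omega>"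
    and closed: "\<And>y w w'. y \<in> U \<Longrightarrow> fd \<omega> y w \<bullet> w' = fd \<omega> y w' \<bullet> w"
  obtains V f where "open V" "p \<in> V" "V \<subseteq> U" "smooth_on V f" "\<forall>x\<in>V. \<forall>w. fd f x w = \<omega> x \<bullet> w"
proof -
  obtain r where r: "r > 0" "ball p r \<subseteq> U" using U open_contains_ball by blast
  obtain f where "smooth_on (ball p r) f" "\<And>x w. x \<in> ball p r \<Longrightarrow> fd f x w = \<omega> x \<bullet> w"
  proof (rule poincare_projection[of p r \<omega> "\<lambda>w. w"])
    show "smooth_on (ball p r) \<omega>" using smooth_on_subset[OF \<omega> r(2)] .
  qed (use closed r in \<open>auto simp: linear_id[unfolded id_def]\<close>)
  then show ?thesis using that[of "ball p r" f] r by auto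
qed

text \<open>A form that is closed on the leaves u = const is exact there, with a primitive that is
  smooth also across the leaves. After straightening the leaves to coordinate hyperplanes this is
  \<open>poincare_projection\<close> for the projection along the remaining axis; a form that
  vanishes on the leaves is a multiple of du = l.\<close>

lemma poincare_relative:
  fixes u :: "real^'n \<Rightarrow> real" and l \<omega> :: "real^'n \<Rightarrow> real^'n"
  assumes U: "open U" "p \<in> U" and u: "smooth_on U u" and \<omega>: "smooth_on U \<omega>"
    and du: "\<And>x w. x \<in> U \<Longrightarrow> fd u x w = l x \<bullet> w" and lp: "l p \<noteq> 0"
    and closed: "\<And>x w w'. x \<in> U \<Longrightarrow> l x \<bullet> w = 0 \<Longrightarrow> l x \<bullet> w' = 0 \<Longrightarrow> fd \<omega> x w \<bullet> w' = fd \<omega> x w' \<bullet> w"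
  obtains V f h where "open V" "p \<in> V" "V \<subseteq> U" "smooth_on V f" "smooth_on V h"
    "\<forall>x\<in>V. \<forall>w. \<omega> x \<bullet> w = fd f x w + h x * (l x \<bullet> w)"
proof -
  obtain i where i: "l p $ i \<noteq> 0" using lp by (auto simp: vec_eq_iff)
  let ?e = "axis i 1 :: real^'n"
  \<comment> \<open>The \<open>i\<close>-th coordinate is replaced by \<open>u\<close>. Since
    \<open>l\<close> has a nonzero \<open>i\<close>-th component at \<open>p\<close>, this is a
    local diffeomorphism, and the leaves become the hyperplanes of constant \<open>i\<close>-th
    coordinate.\<close>
  define \<phi> where "\<phi> x = x + (u x - x $ i) *\<^sub>R ?e" for x
  have s\<phi>: "smooth_on U \<phi>" unfolding \<phi>_def
    by (intro smooth_on_add[OF U(1)] smooth_on_scaleR[OF U(1)] smooth_on_diff[OF U(1)] u smooth_on_nth[OF U(1)]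
        smooth_on_ident smooth_on_const)
  have d\<phi>: "fd \<phi> x w = w + (l x \<bullet> w - w $ i) *\<^sub>R ?e" if "x \<in> U" for x w
  proof -
    have "(\<phi> has_derivative (\<lambda>w. w + (fd u x w - w $ i) *\<^sub>R ?e)) (at x)"
      unfolding \<phi>_def
      by (intro has_derivative_add has_derivative_ident has_derivative_scaleR_left has_derivative_diff
          smooth_on_has_derivative[OF u that] bounded_linear_imp_has_derivative[OF bounded_linear_vec_nth])
    from fd_eqI[OF this] show ?thesis using du[OF that] by simp
  qed
  have d\<phi>i: "fd \<phi> x w $ i = l x \<bullet> w" if "x \<in> U" for x w
    using d\<phi>[OF that] by simp
  have "w = 0" if "fd \<phi> p w = 0" for w
  proof -
    have lw: "l p \<bullet> w = 0" using d\<phi>i[OF U(2), of w] that by simp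
    then have w: "w = w $ i *\<^sub>R ?e" using d\<phi>[OF U(2), of w] that by (simp add: algebra_simps)
    then have "l p \<bullet> w = w $ i * (l p $ i)" by (metis inner_axis inner_real_def inner_scaleR_right mult.right_neutral)
    then show ?thesis using lw i w by simp
  qed
  then obtain U' V \<psi> where r: "open U'" "U' \<subseteq> U" "p \<in> U'" "open V" "\<phi> p \<in> V" "homeomorphism U' V \<phi> \<psi>"
    "smooth_on V \<psi>" and r1: "\<And>y e. y \<in> V \<Longrightarrow> fd \<phi> (\<psi> y) (fd \<psi> y e) = e"
    and r2: "\<And>x w. x \<in> U' \<Longrightarrow> fd \<psi> (\<phi> x) (fd \<phi> x w) = w"
    using smooth_inverse_function[OF U s\<phi>] by metis
  obtain \<rho> where \<rho>: "\<rho> > 0" "ball (\<phi> p) \<rho> \<subseteq> V" using r(4,5) open_contains_ball by blast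
  define B where "B = ball (\<phi> p) \<rho>"
  have B: "open B" "B \<subseteq> V" "\<phi> p \<in> B" using \<rho> by (auto simp: B_def)
  have s\<psi>: "smooth_on B \<psi>" using smooth_on_subset[OF r(7) B(2)] .
  have \<psi>: "\<psi> y \<in> U" "\<phi> (\<psi> y) = y" if "y \<in> B" for y
  proof -
    have "y \<in> V" using B that by blast
    then have "\<psi> y \<in> U'" "\<phi> (\<psi> y) = y" using r(6) unfolding homeomorphism_def by blast+
    then show "\<psi> y \<in> U" "\<phi> (\<psi> y) = y" using r(2) by auto
  qed
  define \<omega>' where "\<omega>' y = (\<chi> a. \<omega> (\<psi> y) \<bullet> fd \<psi> y (axis a 1))" for y
  have \<omega>': "\<omega>' y \<bullet> e = \<omega> (\<psi> y) \<bullet> fd \<psi> y e" if "y \<in> B" for y e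
  proof -
    have l: "linear (fd \<psi> y)" by (rule linear_fd[OF smooth_on_differentiable[OF s\<psi> that]])
    have "linear (\<lambda>e. \<omega> (\<psi> y) \<bullet> fd \<psi> y e)"
      by (rule linearI) (simp_all add: linear_add[OF l] linear_scale[OF l] inner_add_right)
    from linear_functional_eq_inner[OF this] show ?thesis by (simp add: \<omega>'_def)
  qed
  have s\<omega>\<psi>: "smooth_on B (\<lambda>y. \<omega> (\<psi> y))"
    by (rule smooth_on_compose[OF B(1) U(1) \<omega> s\<psi>]) (use \<psi> in auto)
  have s\<omega>': "smooth_on B \<omega>'"
    unfolding \<omega>'_def
    by (intro smooth_on_vec_lambda[OF B(1)] smooth_on_inner[OF B(1)] s\<omega>\<psi> smooth_on_frechet_derivative[OF s\<psi>])
  \<comment> \<open>The fixed vectors of \<open>Q\<close> are those tangent to the straightened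
    leaves, and z - Q z is just the \<open>i\<close>-th component, which never exceeds z in
    norm.\<close>
  define Q where "Q w = w - w $ i *\<^sub>R ?e" for w :: "real^'n"
  have Qi: "w $ i = 0" if "Q w = w" for w using that by (simp add: Q_def)
  have cl: "fd \<omega>' y e \<bullet> e' = fd \<omega>' y e' \<bullet> e" if y: "y \<in> B" and e: "e $ i = 0" "e' $ i = 0" for y e e'
  proof -
    \<comment> \<open>Derivative of the pull-back \<omega>' of \<omega>. Its second summand contains
      a second derivative of \<psi>, which is symmetric and cancels in the closedness
      condition.\<close>
    have *: "fd \<omega>' y e \<bullet> e' = fd \<omega> (\<psi> y) (fd \<psi> y e) \<bullet> fd \<psi> y e' + \<omega> (\<psi> y) \<bullet> fd (\<lambda>y. fd \<psi> y e') y e" for e e'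
    proof -
      have "(\<lambda>y. \<omega> (\<psi> y)) = \<omega> \<circ> \<psi>" by (simp add: o_def)
      then have h1: "((\<lambda>y. \<omega> (\<psi> y)) has_derivative (\<lambda>e. fd \<omega> (\<psi> y) (fd \<psi> y e))) (at y)"
        using diff_chain_at[OF smooth_on_has_derivative[OF s\<psi> y] smooth_on_has_derivative[OF \<omega> \<psi>(1)[OF y]]]
        by (simp only: o_def)
      have h2: "((\<lambda>y. fd \<psi> y e') has_derivative fd (\<lambda>y. fd \<psi> y e') y) (at y)"
        by (rule smooth_on_has_derivative[OF smooth_on_frechet_derivative[OF s\<psi>] y])
      have h: "((\<lambda>y. \<omega> (\<psi> y) \<bullet> fd \<psi> y e') has_derivative
        (\<lambda>e. \<omega> (\<psi> y) \<bullet> fd (\<lambda>y. fd \<psi> y e') y e + fd \<omega> (\<psi> y) (fd \<psi> y e) \<bullet> fd \<psi> y e')) (at y)"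
        by (rule has_derivative_inner[OF h1 h2])
      have "fd \<omega>' y e \<bullet> e' = fd (\<lambda>y. \<omega>' y \<bullet> e') y e"
        by (rule fd_inner_left[symmetric, OF smooth_on_differentiable[OF s\<omega>' y]])
      also have "fd (\<lambda>y. \<omega>' y \<bullet> e') y = fd (\<lambda>y. \<omega> (\<psi> y) \<bullet> fd \<psi> y e') y"
        by (rule fd_cong[OF B(1) y]) (use \<omega>' h in \<open>auto simp: differentiable_def\<close>)
      finally show ?thesis using fd_eqI[OF h] by (simp add: add.commute)
    qed
    have "l (\<psi> y) \<bullet> fd \<psi> y e = 0" if "e $ i = 0" for e
      using d\<phi>i[OF \<psi>(1)[OF y], of "fd \<psi> y e"] r1[of y e] y B(2) that by auto
    then have "fd \<omega> (\<psi> y) (fd \<psi> y e) \<bullet> fd \<psi> y e' = fd \<omega> (\<psi> y) (fd \<psi> y e') \<bullet> fd \<psi> y e"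
      using closed[OF \<psi>(1)[OF y]] e by blast
    then show ?thesis
      unfolding * using symmetric_second_derivative_euclidean[OF B(1) y s\<psi>, of e' e] by simp
  qed
  obtain f' where f': "smooth_on B f'" "\<And>y e. y \<in> B \<Longrightarrow> Q e = e \<Longrightarrow> fd f' y e = \<omega>' y \<bullet> e"
  proof (rule poincare_projection[of "\<phi> p" \<rho> \<omega>' Q])
    show "smooth_on (ball (\<phi> p) \<rho>) \<omega>'" using s\<omega>' by (simp add: B_def)
    show "linear Q" by (rule linearI) (auto simp: Q_def algebra_simps)
    show "Q (Q w) = Q w" for w by (simp add: Q_def)
    show "norm (z - Q z) \<le> norm z" for z
      by (simp add: Q_def component_le_norm_cart)
    show "fd \<omega>' y w \<bullet> w' = fd \<omega>' y w' \<bullet> w" if "y \<in> ball (\<phi> p) \<rho>" "Q w = w" "Q w' = w'" for y w w'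
      using cl[of y w w'] that Qi by (simp add: B_def)
  qed (auto simp: B_def)
  define f where "f x = f' (\<phi> x)" for x
  have cu: "continuous_on U' (\<lambda>x. fd u x ?e)"
    using smooth_on_continuous[OF smooth_on_frechet_derivative[OF u]] r(2) continuous_on_subset by blast
  define V1 where "V1 = U' \<inter> \<phi> -` B"
  define V2 where "V2 = U' \<inter> (\<lambda>x. fd u x ?e) -` (- {0})"
  define V' where "V' = V1 \<inter> V2"
  have "open V1" unfolding V1_def
    using r(6) by (intro continuous_open_preimage r(1) B(1)) (simp add: homeomorphism_def)
  moreover have "open V2" unfolding V2_def
    by (intro continuous_open_preimage r(1) cu) auto
  ultimately have V': "open V'" unfolding V'_def by blast
  have le: "l x $ i = fd u x ?e" if "x \<in> U" for x using du[OF that] by (simp add: inner_axis)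
  have pV: "p \<in> V'" using r(3) B(3) i U(2) le by (simp add: V'_def V1_def V2_def)
  have VU: "V' \<subseteq> U'" by (auto simp: V'_def V1_def)
  have sf: "smooth_on V' f" unfolding f_def
    by (rule smooth_on_compose[OF V' B(1) f'(1) smooth_on_subset[OF s\<phi>]]) (use VU r(2) in \<open>auto simp: V'_def V1_def\<close>)
  \<comment> \<open>On the kernel of \<open>l\<close> the forms \<omega> and df agree, so the factor
    \<open>h\<close> is determined by one transversal direction, here the \<open>i\<close>-th axis.
    The set \<open>V2\<close> keeps the denominator away from zero.\<close>
  define h where "h x = (\<omega> x $ i - fd f x ?e) / fd u x ?e" for x
  have sh: "smooth_on V' h" unfolding h_def
  proof (intro smooth_on_divide[OF V'] smooth_on_diff[OF V'] smooth_on_nth[OF V'] smooth_on_frechet_derivative sf)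
    show "smooth_on V' \<omega>" "smooth_on V' u" using VU r(2) smooth_on_subset \<omega> u by blast+
  qed (auto simp: V'_def V2_def)
  have eq: "\<omega> x \<bullet> w = fd f x w + h x * (l x \<bullet> w)" if x: "x \<in> V'" for x w
  proof -
    have xU: "x \<in> U" "x \<in> U'" "\<phi> x \<in> B" "l x $ i \<noteq> 0"
      using x VU r(2) le by (auto simp: V'_def V1_def V2_def)
    have lf: "linear (fd f x)" by (rule linear_fd[OF smooth_on_differentiable[OF sf x]])
    have ker: "fd f x w = \<omega> x \<bullet> w" if "l x \<bullet> w = 0" for w
    proof -
      have "fd f x w = fd f' (\<phi> x) (fd \<phi> x w)"
        using fd_eqI[OF diff_chain_at[OF smooth_on_has_derivative[OF s\<phi> xU(1)] smooth_on_has_derivative[OF f'(1) xU(3)]]]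
        by (simp add: f_def[abs_def] o_def)
      also have "\<dots> = \<omega>' (\<phi> x) \<bullet> fd \<phi> x w"
        using d\<phi>i[OF xU(1), of w] that by (intro f'(2) xU(3)) (simp add: Q_def)
      also have "\<dots> = \<omega> x \<bullet> w"
        using \<omega>'[OF xU(3)] r2[OF xU(2)] r(6) xU(2) by (simp add: homeomorphism_def)
      finally show ?thesis .
    qed
    define k where "k = (l x \<bullet> w) / l x $ i"
    define w0 where "w0 = w - k *\<^sub>R ?e"
    have w: "w = w0 + k *\<^sub>R ?e" by (simp add: w0_def)
    have "l x \<bullet> w0 = 0" using xU(4) by (simp add: w0_def k_def inner_diff_right inner_axis)
    from ker[OF this] have "fd f x w = \<omega> x \<bullet> w0 + k * fd f x ?e"
      unfolding w linear_add[OF lf] linear_scale[OF lf] by simp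
    moreover have "\<omega> x \<bullet> w = \<omega> x \<bullet> w0 + k * \<omega> x $ i" by (simp add: w inner_add_right inner_axis)
    moreover have "h x * (l x \<bullet> w) = k * (\<omega> x $ i - fd f x ?e)"
      using le[OF xU(1)] by (simp add: h_def k_def)
    ultimately show ?thesis by (simp add: algebra_simps)
  qed
  have "V' \<subseteq> U" using VU r(2) by blast
  then show ?thesis using that[OF V' pV _ sf sh] eq by blast
qed

section \<open>The Levi-Civita connection without indices\<close>

definition gmet :: "(real^4 \<Rightarrow> real^4^4) \<Rightarrow> real^4 \<Rightarrow> real^4 \<Rightarrow> real^4 \<Rightarrow> real" where
  "gmet g x s t = s \<bullet> (g x *v t)"

definition gam :: "(real^4 \<Rightarrow> real^4^4) \<Rightarrow> real^4 \<Rightarrow> real^4 \<Rightarrow> real^4 \<Rightarrow> real^4" where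
  "gam g x v t = (\<chi> d. \<Sum>b\<in>UNIV. \<Sum>c\<in>UNIV. christoffel g x d b c * (v $ b * t $ c))"

definition cd :: "(real^4 \<Rightarrow> real^4^4) \<Rightarrow> (real^4 \<Rightarrow> real^4) \<Rightarrow> real^4 \<Rightarrow> real^4 \<Rightarrow> real^4 \<Rightarrow> real" where
  "cd g \<omega> x v t = fd \<omega> x v \<bullet> t - \<omega> x \<bullet> gam g x v t"

text \<open>The second covariant derivative without the term in which the connection acts on the
  slot \<open>w\<close>. That term is symmetric in \<open>v\<close> and \<open>w\<close> because the
  torsion vanishes, so the commutator is unaffected.\<close>

definition cd2 :: "(real^4 \<Rightarrow> real^4^4) \<Rightarrow> (real^4 \<Rightarrow> real^4) \<Rightarrow> real^4 \<Rightarrow> real^4 \<Rightarrow> real^4 \<Rightarrow> real^4 \<Rightarrow> real" where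
  "cd2 g \<omega> x v w t = fd (\<lambda>y. cd g \<omega> y w t) x v - cd g \<omega> x w (gam g x v t)"

text \<open>The curvature operator R(v,w)t for vectors with constant components. Their brackets
  vanish, so no further term appears.\<close>

definition curv :: "(real^4 \<Rightarrow> real^4^4) \<Rightarrow> real^4 \<Rightarrow> real^4 \<Rightarrow> real^4 \<Rightarrow> real^4 \<Rightarrow> real^4" where
  "curv g x v w t = fd (\<lambda>y. gam g y w t) x v - fd (\<lambda>y. gam g y v t) x w
     + gam g x v (gam g x w t) - gam g x w (gam g x v t)"

text \<open>Symmetry is not part of the definition of \<open>lorentzian\<close>; it is inherited
  from the symmetric Minkowski matrix by congruence.\<close>

lemma lorentzian_transpose:
  assumes "lorentzian h" shows "transpose h = h"
proof -
  obtain P where P: "invertible P" "transpose P ** h ** P = minkowski"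
    using assms by (auto simp: lorentzian_def)
  then obtain Q where Q: "P ** Q = mat 1" "Q ** P = mat 1" by (auto simp: invertible_def)
  have TQ: "transpose Q ** transpose P = mat 1"
    using Q by (metis matrix_transpose_mul transpose_mat)
  have "h = transpose Q ** minkowski ** Q"
  proof -
    have "transpose Q ** minkowski ** Q = (transpose Q ** transpose P) ** h ** (P ** Q)"
      unfolding P(2)[symmetric] by (simp add: matrix_mul_assoc)
    then show ?thesis using Q TQ by simp
  qed
  moreover have "transpose minkowski = minkowski"
    by (auto simp: transpose_def minkowski_def vec_eq_iff)
  ultimately show ?thesis by (simp add: matrix_transpose_mul matrix_mul_assoc)
qed

lemma lorentzian_invertible:
  assumes "lorentzian h" shows "invertible h"
proof -
  obtain P where P: "invertible P" "transpose P ** h ** P = minkowski"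
    using assms by (auto simp: lorentzian_def)
  have "minkowski ** minkowski = mat 1"
    by (simp add: minkowski_def matrix_matrix_mult_def mat_def vec_eq_iff forall_4 sum_4)
  then have "invertible minkowski" by (auto simp: invertible_def)
  then have "det minkowski \<noteq> 0" by (simp add: invertible_det_nz)
  then have "det h \<noteq> 0" unfolding P(2)[symmetric] by (auto simp: det_mul)
  then show ?thesis by (simp add: invertible_det_nz)
qed

lemma axis_expansion: "v = (\<Sum>a\<in>UNIV. v $ a *\<^sub>R axis a 1)" for v :: "real^'n"
  using basis_expansion[of v] by (simp add: scalar_mult_eq_scaleR)

lemma fd_axis_expansion:
  fixes f :: "real^4 \<Rightarrow> 'b::real_normed_vector"
  assumes "f differentiable (at x)"
  shows "fd f x v = (\<Sum>c\<in>UNIV. v $ c *\<^sub>R pd c f x)"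
proof -
  have l: "linear (fd f x)" by (rule linear_fd[OF assms])
  show ?thesis unfolding pd_def
    by (subst axis_expansion[of v]) (simp add: linear_sum[OF l] linear_scale[OF l])
qed

lemma gam_add1: "gam g x (v + w) t = gam g x v t + gam g x w t"
  and gam_scale1: "gam g x (r *\<^sub>R v) t = r *\<^sub>R gam g x v t"
  and gam_add2: "gam g x v (s + t) = gam g x v s + gam g x v t"
  and gam_scale2: "gam g x v (r *\<^sub>R t) = r *\<^sub>R gam g x v t"
  by (simp_all add: gam_def vec_eq_iff algebra_simps sum.distrib sum_distrib_left)

lemma bilinear_gmet: "linear (gmet g x s)" "linear (\<lambda>s. gmet g x s t)"
  by (rule linearI; simp add: gmet_def matrix_vector_right_distrib matrix_vector_mult_scaleR inner_add_right inner_add_left)+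

locale spacetime_chart =
  fixes U :: "(real^4) set" and g :: "real^4 \<Rightarrow> real^4^4"
  assumes spacetime: "spacetime U g"
begin

lemma open_U: "open U"
  and smooth_g: "smooth_on U g"
  and lorentz: "x \<in> U \<Longrightarrow> lorentzian (g x)"
  using spacetime by (auto simp: spacetime_def)

lemma g_sym:
  assumes "x \<in> U" shows "g x $ a $ b = g x $ b $ a"
proof -
  have "transpose (g x) $ a $ b = g x $ a $ b" by (simp only: lorentzian_transpose[OF lorentz[OF assms]])
  then show ?thesis by (simp add: transpose_def)
qed

lemma smooth_g_comp: "smooth_on U (\<lambda>x. g x $ a $ b)"
  by (intro smooth_on_nth open_U smooth_g)

lemma smooth_ginv: "smooth_on U (\<lambda>x. ginv g x a b)"
  unfolding ginv_def
  by (intro smooth_on_matrix_inv open_U smooth_g_comp lorentzian_invertible lorentz)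

lemma smooth_pd: "smooth_on U f \<Longrightarrow> smooth_on U (\<lambda>x. pd c f x)"
  unfolding pd_def by (rule smooth_on_frechet_derivative)

lemma smooth_christoffel: "smooth_on U (\<lambda>x. christoffel g x a b c)"
  unfolding christoffel_def
  by (intro smooth_on_divide_const smooth_on_sum smooth_on_mult smooth_on_diff smooth_on_add smooth_pd open_U
      smooth_ginv smooth_g_comp)

lemma smooth_gam: "smooth_on U (\<lambda>x. gam g x v t)"
  unfolding gam_def
  by (intro smooth_on_vec_lambda smooth_on_sum smooth_on_mult smooth_christoffel smooth_on_const open_U)

lemma smooth_gmet: "smooth_on U (\<lambda>x. gmet g x s t)"
  unfolding gmet_def matrix_vector_mult_def
  by (intro smooth_on_inner smooth_on_const smooth_on_vec_lambda smooth_on_sum smooth_on_mult smooth_g_comp open_U)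

lemma smooth_gv: "smooth_on U (\<lambda>x. g x *v t)"
  unfolding matrix_vector_mult_def
  by (intro smooth_on_const smooth_on_vec_lambda smooth_on_sum smooth_on_mult smooth_g_comp open_U)

lemma gmet_sym:
  assumes "x \<in> U" shows "gmet g x s t = gmet g x t s"
proof -
  have "gmet g x s t = (s v* g x) \<bullet> t" by (simp add: gmet_def dot_lmul_matrix)
  also have "s v* g x = transpose (g x) *v s" by (simp only: transpose_matrix_vector)
  also have "transpose (g x) = g x" by (rule lorentzian_transpose[OF lorentz[OF assms]])
  finally show ?thesis by (simp add: gmet_def inner_commute)
qed

lemma gam_sym:
  assumes "x \<in> U" shows "gam g x v t = gam g x t v"
proof -
  have "fd (\<lambda>y. g y $ b $ c) x = fd (\<lambda>y. g y $ c $ b) x" for b c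
    by (rule fd_cong[OF open_U assms]) (auto simp: g_sym intro: smooth_on_differentiable[OF smooth_g_comp assms])
  then have "christoffel g x d b c = christoffel g x d c b" for b c d
    by (simp add: christoffel_def pd_def add.commute)
  then show ?thesis unfolding gam_def vec_eq_iff
    by (subst (2) sum.swap) (simp add: mult.assoc mult.commute mult.left_commute)
qed

lemma fd_gmet:
  assumes "x \<in> U"
  shows "fd (\<lambda>y. gmet g y s t) x v = (\<Sum>a\<in>UNIV. \<Sum>b\<in>UNIV. \<Sum>c\<in>UNIV. pd c (\<lambda>y. g y $ a $ b) x * (s $ a * t $ b * v $ c))"
proof -
  have "gmet g y s t = (\<Sum>a\<in>UNIV. \<Sum>b\<in>UNIV. s $ a * (g y $ a $ b * t $ b))" for y
    by (simp add: gmet_def inner_vec_def matrix_vector_mult_def sum_distrib_left)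
  moreover have "((\<lambda>y. \<Sum>a\<in>UNIV. \<Sum>b\<in>UNIV. s $ a * (g y $ a $ b * t $ b)) has_derivative
     (\<lambda>v. \<Sum>a\<in>UNIV. \<Sum>b\<in>UNIV. s $ a * (fd (\<lambda>y. g y $ a $ b) x v * t $ b))) (at x)"
    by (intro has_derivative_sum has_derivative_mult_right has_derivative_mult_left
        smooth_on_has_derivative[OF smooth_g_comp assms])
  ultimately have "fd (\<lambda>y. gmet g y s t) x v = (\<Sum>a\<in>UNIV. \<Sum>b\<in>UNIV. s $ a * (fd (\<lambda>y. g y $ a $ b) x v * t $ b))"
    using fd_eqI by fastforce
  then show ?thesis
    by (simp add: fd_axis_expansion[OF smooth_on_differentiable[OF smooth_g_comp assms]] sum_distrib_left sum_distrib_right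
        mult.assoc mult.commute mult.left_commute)
qed

text \<open>The Koszul formula on constant fields. It trades the Christoffel symbols, with their
  inverse metric, for directional derivatives of the metric; after this no index computation with
  them is needed for metric compatibility.\<close>

lemma koszul:
  assumes "x \<in> U"
  shows "gmet g x s (gam g x v t) = (fd (\<lambda>y. gmet g y s t) x v + fd (\<lambda>y. gmet g y s v) x t - fd (\<lambda>y. gmet g y v t) x s) / 2"
proof -
  let ?d = "\<lambda>c a b. pd c (\<lambda>y. g y $ a $ b) x"
  define k where "k = (\<chi> e. \<Sum>b\<in>UNIV. \<Sum>c\<in>UNIV. (?d b e c + ?d c e b - ?d e b c) / 2 * (v $ b * t $ c))"
  have "gam g x v t = matrix_inv (g x) *v k"
  proof -
    have "gam g x v t $ d = (matrix_inv (g x) *v k) $ d" for d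
    proof -
      have "gam g x v t $ d = (\<Sum>b\<in>UNIV. \<Sum>c\<in>UNIV. \<Sum>e\<in>UNIV. matrix_inv (g x) $ d $ e * ((?d b e c + ?d c e b - ?d e b c) / 2 * (v $ b * t $ c)))"
        by (simp add: gam_def christoffel_def ginv_def sum_distrib_right sum_divide_distrib mult.assoc)
      also have "\<dots> = (\<Sum>e\<in>UNIV. \<Sum>b\<in>UNIV. \<Sum>c\<in>UNIV. matrix_inv (g x) $ d $ e * ((?d b e c + ?d c e b - ?d e b c) / 2 * (v $ b * t $ c)))"
        by (subst (2) sum.swap, subst sum.swap) (rule refl)
      also have "\<dots> = (matrix_inv (g x) *v k) $ d"
        by (simp add: k_def matrix_vector_mult_def sum_distrib_left)
      finally show ?thesis .
    qed
    then show ?thesis by (simp add: vec_eq_iff)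
  qed
  then have "g x *v gam g x v t = k"
    using matrix_inv(1)[OF lorentzian_invertible[OF lorentz[OF assms]]] by (simp add: matrix_vector_mul_assoc)
  then have "gmet g x s (gam g x v t) = (\<Sum>e\<in>UNIV. \<Sum>b\<in>UNIV. \<Sum>c\<in>UNIV. (?d b e c + ?d c e b - ?d e b c) / 2 * (s $ e * v $ b * t $ c))"
    by (simp add: gmet_def k_def inner_vec_def sum_distrib_left mult.assoc mult.commute mult.left_commute)
  also have "\<dots> = ((\<Sum>e\<in>UNIV. \<Sum>b\<in>UNIV. \<Sum>c\<in>UNIV. ?d b e c * (s $ e * v $ b * t $ c))
      + (\<Sum>e\<in>UNIV. \<Sum>b\<in>UNIV. \<Sum>c\<in>UNIV. ?d c e b * (s $ e * v $ b * t $ c))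
      - (\<Sum>e\<in>UNIV. \<Sum>b\<in>UNIV. \<Sum>c\<in>UNIV. ?d e b c * (s $ e * v $ b * t $ c))) / 2"
    by (simp only: sum.distrib[symmetric] sum_subtractf[symmetric] sum_divide_distrib, intro sum.cong refl) (simp add: field_simps)
  also have "(\<Sum>e\<in>UNIV. \<Sum>b\<in>UNIV. \<Sum>c\<in>UNIV. ?d b e c * (s $ e * v $ b * t $ c)) = fd (\<lambda>y. gmet g y s t) x v"
    unfolding fd_gmet[OF assms] by (rule sum.cong[OF refl], subst sum.swap) (simp add: mult.assoc mult.commute mult.left_commute)
  also have "(\<Sum>e\<in>UNIV. \<Sum>b\<in>UNIV. \<Sum>c\<in>UNIV. ?d c e b * (s $ e * v $ b * t $ c)) = fd (\<lambda>y. gmet g y s v) x t"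
    unfolding fd_gmet[OF assms] by simp
  also have "(\<Sum>e\<in>UNIV. \<Sum>b\<in>UNIV. \<Sum>c\<in>UNIV. ?d e b c * (s $ e * v $ b * t $ c)) = fd (\<lambda>y. gmet g y v t) x s"
    unfolding fd_gmet[OF assms] by (subst sum.swap, rule sum.cong[OF refl], subst sum.swap) (simp add: mult.assoc mult.commute mult.left_commute)
  finally show ?thesis .
qed

text \<open>Metric compatibility: in the sum of two Koszul formulas all terms but the derivative
  along \<open>v\<close> cancel.\<close>

lemma fd_gmet_gam:
  assumes "x \<in> U"
  shows "fd (\<lambda>y. gmet g y s t) x v = gmet g x (gam g x v s) t + gmet g x s (gam g x v t)"
proof -
  have sym: "fd (\<lambda>y. gmet g y s t) x v = fd (\<lambda>y. gmet g y t s) x v" for s t v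
    by (subst fd_cong[OF open_U assms gmet_sym smooth_on_differentiable[OF smooth_gmet assms]]) auto
  show ?thesis
    using koszul[OF assms, of s v t] koszul[OF assms, of t v s] sym[of s t v] sym[of s v t] sym[of t v s]
      gmet_sym[OF assms, of "gam g x v s" t] by simp
qed

end

lemma fd_nth: "f differentiable (at x) \<Longrightarrow> fd (\<lambda>y. f y $ a) x w = fd f x w $ a"
  by (rule fd_eqI[OF bounded_linear.has_derivative[OF bounded_linear_vec_nth]]) (simp flip: frechet_derivative_works)

lemma sum_axis:
  fixes f :: "'n::finite \<Rightarrow> real"
  shows "(\<Sum>b\<in>UNIV. f b * axis c 1 $ b) = f c" "(\<Sum>b\<in>UNIV. f b * (axis c 1 $ b * r)) = f c * r"
proof -
  show 1: "(\<Sum>b\<in>UNIV. f b * axis c 1 $ b) = f c" for f :: "'n \<Rightarrow> real"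
    by (simp add: axis_def if_distrib[of "\<lambda>u. f _ * u"] cong: if_cong)
  show "(\<Sum>b\<in>UNIV. f b * (axis c 1 $ b * r)) = f c * r"
    using 1[of "\<lambda>b. f b * r"] by (simp add: mult.assoc mult.commute[of r])
qed

text \<open>The classical octahedron argument: the four cyclic identities are added with suitable
  signs, and the two antisymmetries identify all but two of the terms.\<close>

lemma pair_symmetry:
  fixes F :: "'a \<Rightarrow> 'a \<Rightarrow> 'a \<Rightarrow> 'a \<Rightarrow> real"
  assumes "\<And>a b c d. F a b c d = - F b a c d" "\<And>a b c d. F a b c d = - F a b d c"
    and "\<And>a b c d. F a b c d + F a c d b + F a d b c = 0"
  shows "F a b c d = F c d a b"
proof -
  note A = assms(1) and B = assms(2) and C = assms(3)
  show ?thesis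
    using C[of a b c d] C[of b c d a] C[of c d a b] C[of d a b c]
      A[of b a c d] A[of c a d b] A[of c b d a] A[of d a b c] A[of d b a c] A[of d c a b]
      B[of a b d c] B[of a c d b] B[of a d c b] B[of b c d a] B[of b d c a] B[of c d b a]
      A[of b a d c] A[of c a b d] A[of c b a d] A[of d a c b] A[of d b c a] A[of d c b a]
    by linarith
qed

section \<open>Ricci identity and symmetries of the curvature tensor\<close>

context spacetime_chart
begin

lemma curv_antisym: "curv g x v w t = - curv g x w v t"
  by (simp add: curv_def)

lemma differentiable_gam: "x \<in> U \<Longrightarrow> (\<lambda>y. gam g y v t) differentiable (at x)"
  by (rule smooth_on_differentiable[OF smooth_gam])

lemma riemann_up_curv:
  assumes "x \<in> U"
  shows "riemann_up g x a b c d = curv g x (axis c 1) (axis d 1) (axis b 1) $ a"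
proof -
  have ga: "gam g y v (axis c 1) $ a = (\<Sum>b\<in>UNIV. christoffel g y a b c * v $ b)" for y v c a
    by (simp add: gam_def mult.assoc[symmetric] sum_axis)
  have ga2: "gam g y (axis b 1) v $ a = (\<Sum>c\<in>UNIV. christoffel g y a b c * v $ c)" for y v b a
    unfolding gam_def vec_lambda_beta by (subst sum.swap) (simp add: sum_axis)
  have gaa: "gam g y (axis b 1) (axis c 1) $ a = christoffel g y a b c" for y a b c
    unfolding ga by (simp add: sum_axis)
  have "pd c (\<lambda>y. christoffel g y a d b) x = fd (\<lambda>y. gam g y (axis d 1) (axis b 1)) x (axis c 1) $ a" for c d
    by (simp only: pd_def fd_nth[OF differentiable_gam[OF assms], symmetric] gaa)
  then show ?thesis
    by (simp add: riemann_up_def curv_def ga2 gaa sum_subtractf sum_axis)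
qed

lemma nabla1_cd:
  assumes "\<omega> differentiable (at x)"
  shows "nabla1 g \<omega> x c a = cd g \<omega> x (axis c 1) (axis a 1)"
proof -
  have "gam g x (axis c 1) (axis a 1) $ d = christoffel g x d c a" for d
    by (simp add: gam_def mult.assoc[symmetric] sum_axis)
  then have "\<omega> x \<bullet> gam g x (axis c 1) (axis a 1) = (\<Sum>d\<in>UNIV. christoffel g x d c a * \<omega> x $ d)"
    by (simp add: inner_vec_def mult.commute)
  then show ?thesis
    using fd_nth[OF assms, of a "axis c 1"] by (simp add: nabla1_def cd_def pd_def inner_axis)
qed

lemma smooth_cd:
  assumes "open V" "V \<subseteq> U" "smooth_on V \<omega>"
  shows "smooth_on V (\<lambda>y. cd g \<omega> y v t)"
  unfolding cd_def
  by (intro smooth_on_diff smooth_on_inner smooth_on_frechet_derivative smooth_on_const assms smooth_on_subset[OF smooth_gam])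

lemma cd_torsion: "x \<in> U \<Longrightarrow> cd g \<omega> x v w - cd g \<omega> x w v = fd \<omega> x v \<bullet> w - fd \<omega> x w \<bullet> v"
  by (simp add: cd_def gam_sym[of x v w])

lemma cd_add2: "cd g \<omega> x v (s + t) = cd g \<omega> x v s + cd g \<omega> x v t"
  and cd_scale2: "cd g \<omega> x v (r *\<^sub>R t) = r * cd g \<omega> x v t"
  by (simp_all add: cd_def gam_add2 gam_scale2 inner_add_right algebra_simps)

lemma cd_add1:
  assumes "\<omega> differentiable (at x)"
  shows "cd g \<omega> x (v + w) t = cd g \<omega> x v t + cd g \<omega> x w t"
    and "cd g \<omega> x (r *\<^sub>R v) t = r * cd g \<omega> x v t"
  using linear_add[OF linear_fd[OF assms]] linear_scale[OF linear_fd[OF assms]]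
  by (simp_all add: cd_def gam_add1 gam_scale1 inner_add_right inner_add_left algebra_simps)

text \<open>The second partial derivatives of \<omega> cancel by symmetry, and so do the products of
  first derivatives of \<omega> with \<open>gam\<close>; what remains acts on \<omega> algebraically
  and is \<open>curv\<close>. This is the only way in which curvature is computed from the frame
  below.\<close>

lemma ricci_identity:
  assumes V: "open V" "V \<subseteq> U" "x \<in> V" and \<omega>: "smooth_on V \<omega>"
  shows "cd2 g \<omega> x v w t - cd2 g \<omega> x w v t = - (\<omega> x \<bullet> curv g x v w t)"
proof -
  have x: "x \<in> U" using V by auto
  have d: "fd (\<lambda>y. cd g \<omega> y w t) x v =
      fd (\<lambda>y. fd \<omega> y w) x v \<bullet> t - (\<omega> x \<bullet> fd (\<lambda>y. gam g y w t) x v + fd \<omega> x v \<bullet> gam g x w t)" for v w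
  proof -
    have "((\<lambda>y. cd g \<omega> y w t) has_derivative (\<lambda>v. fd (\<lambda>y. fd \<omega> y w) x v \<bullet> t
        - (\<omega> x \<bullet> fd (\<lambda>y. gam g y w t) x v + fd \<omega> x v \<bullet> gam g x w t))) (at x)"
      unfolding cd_def
      by (intro has_derivative_diff has_derivative_inner_left has_derivative_inner
          smooth_on_has_derivative[OF smooth_on_frechet_derivative[OF \<omega>] V(3)]
          smooth_on_has_derivative[OF \<omega> V(3)] smooth_on_has_derivative[OF smooth_gam x])
    then show ?thesis by (rule fd_eqI)
  qed
  show ?thesis
    unfolding cd2_def d
    using symmetric_second_derivative_euclidean[OF V(1,3) \<omega>, of v w]
    by (simp add: cd_def curv_def inner_add_right inner_diff_right)
qed

lemma fd_gam_sym: 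
  assumes "x \<in> U" shows "fd (\<lambda>y. gam g y v t) x = fd (\<lambda>y. gam g y t v) x"
  by (rule fd_cong[OF open_U assms gam_sym differentiable_gam[OF assms]])

lemma bianchi:
  assumes "x \<in> U"
  shows "curv g x v w t + curv g x w t v + curv g x t v w = 0"
  using fd_gam_sym[OF assms, of w t] fd_gam_sym[OF assms, of v t] fd_gam_sym[OF assms, of v w]
    gam_sym[OF assms, of w t] gam_sym[OF assms, of v t] gam_sym[OF assms, of v w]
  by (simp add: curv_def)

lemma fd_gam_linear:
  assumes "x \<in> U"
  shows "fd (\<lambda>y. gam g y (v + w) t) x u = fd (\<lambda>y. gam g y v t) x u + fd (\<lambda>y. gam g y w t) x u"
    and "fd (\<lambda>y. gam g y (r *\<^sub>R v) t) x u = r *\<^sub>R fd (\<lambda>y. gam g y v t) x u"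
proof -
  note h = smooth_on_has_derivative[OF smooth_gam assms]
  show "fd (\<lambda>y. gam g y (v + w) t) x u = fd (\<lambda>y. gam g y v t) x u + fd (\<lambda>y. gam g y w t) x u"
    unfolding gam_add1 by (rule fd_eqI[OF has_derivative_add[OF h h]])
  show "fd (\<lambda>y. gam g y (r *\<^sub>R v) t) x u = r *\<^sub>R fd (\<lambda>y. gam g y v t) x u"
    unfolding gam_scale1 by (rule fd_eqI[OF has_derivative_scaleR_right[OF h]])
qed

lemma linear_curv1:
  assumes "x \<in> U" shows "linear (\<lambda>v. curv g x v w t)"
proof (rule linearI)
  note l = linear_fd[OF differentiable_gam[OF assms]]
  show "curv g x (v + v') w t = curv g x v w t + curv g x v' w t" for v v'
    unfolding curv_def fd_gam_linear[OF assms] by (simp add: linear_add[OF l] gam_add1 gam_add2)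
  show "curv g x (r *\<^sub>R v) w t = r *\<^sub>R curv g x v w t" for r v
    unfolding curv_def fd_gam_linear[OF assms]
    by (simp add: linear_scale[OF l] gam_scale1 gam_scale2 algebra_simps)
qed

lemma linear_curv2:
  assumes "x \<in> U" shows "linear (\<lambda>w. curv g x v w t)"
  using linear_compose_neg[OF linear_curv1[OF assms, of v t]] by (simp add: curv_antisym[of x v])

text \<open>The Bianchi identity expresses the third slot through the second one, where linearity is
  known.\<close>

lemma linear_curv3:
  assumes "x \<in> U" shows "linear (\<lambda>t. curv g x v w t)"
proof -
  have "curv g x v w t = curv g x v t w - curv g x w t v" for t
    using bianchi[OF assms, of v w t] curv_antisym[of x t v w] by (simp add: algebra_simps eq_neg_iff_add_eq_0)
  then show ?thesis
    using linear_compose_sub[OF linear_curv2[OF assms] linear_curv2[OF assms]] by presburger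
qed

text \<open>Mixed second derivatives of g(s,t) along \<open>v\<close> and \<open>w\<close> commute.
  Written out by metric compatibility, their difference is the curvature acting on \<open>s\<close>
  and on \<open>t\<close>.\<close>

lemma gmet_curv_antisym:
  assumes "x \<in> U"
  shows "gmet g x (curv g x v w s) t + gmet g x s (curv g x v w t) = 0"
proof -
  \<comment> \<open>Product rule for g(X,t) when the vector \<open>X\<close> varies with the point;
    needed because \<open>gam\<close> is differentiated inside the metric.\<close>
  have var: "((\<lambda>y. gmet g y (X y) t) has_derivative (\<lambda>v. fd (\<lambda>y. gmet g y (X x) t) x v + gmet g x (X' v) t)) (at x)"
    if "(X has_derivative X') (at x)" for X X' t
  proof -
    have "((\<lambda>y. gmet g y (X y) t) has_derivative (\<lambda>v. X x \<bullet> fd (\<lambda>y. g y *v t) x v + X' v \<bullet> (g x *v t))) (at x)"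
      unfolding gmet_def by (rule has_derivative_inner[OF that smooth_on_has_derivative[OF smooth_gv assms]])
    moreover have "fd (\<lambda>y. gmet g y (X x) t) x v = X x \<bullet> fd (\<lambda>y. g y *v t) x v" for v
      unfolding gmet_def
      by (rule fd_eqI[OF has_derivative_inner_right[OF smooth_on_has_derivative[OF smooth_gv assms]]])
    ultimately show ?thesis by (simp add: gmet_def)
  qed
  have second: "fd (\<lambda>y. fd (\<lambda>z. gmet g z s t) y v) x w =
     gmet g x (gam g x w (gam g x v s)) t + gmet g x (gam g x v s) (gam g x w t) + gmet g x (fd (\<lambda>y. gam g y v s) x w) t
     + (gmet g x (gam g x w (gam g x v t)) s + gmet g x (gam g x v t) (gam g x w s) + gmet g x (fd (\<lambda>y. gam g y v t) x w) s)"
    for v w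
  proof -
    have eq: "fd (\<lambda>z. gmet g z s t) y v = gmet g y (gam g y v s) t + gmet g y (gam g y v t) s" if "y \<in> U" for y
      using fd_gmet_gam[OF that] gmet_sym[OF that] by simp
    have h: "((\<lambda>y. gmet g y (gam g y v s) t + gmet g y (gam g y v t) s) has_derivative
       (\<lambda>w. (fd (\<lambda>y. gmet g y (gam g x v s) t) x w + gmet g x (fd (\<lambda>y. gam g y v s) x w) t)
          + (fd (\<lambda>y. gmet g y (gam g x v t) s) x w + gmet g x (fd (\<lambda>y. gam g y v t) x w) s))) (at x)"
      by (intro has_derivative_add var smooth_on_has_derivative[OF smooth_gam assms])
    have "fd (\<lambda>y. fd (\<lambda>z. gmet g z s t) y v) x = fd (\<lambda>y. gmet g y (gam g y v s) t + gmet g y (gam g y v t) s) x"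
      by (rule fd_cong[OF open_U assms eq]) (use h in \<open>auto simp: differentiable_def\<close>)
    then show ?thesis using fd_eqI[OF h, of w] by (simp add: fd_gmet_gam[OF assms])
  qed
  have G: "linear (\<lambda>s. gmet g x s t)" for t by (rule bilinear_gmet)
  show ?thesis
    using second[of v w] second[of w v] symmetric_second_derivative[OF open_U assms smooth_gmet, of s t v w]
      gmet_sym[OF assms, of s "curv g x v w t"]
      gmet_sym[OF assms, of "gam g x v s" "gam g x w t"] gmet_sym[OF assms, of "gam g x v t" "gam g x w s"]
    by (simp add: curv_def linear_add[OF G] linear_diff[OF G])
qed

lemma gmet_curv_pair:
  assumes "x \<in> U"
  shows "gmet g x s (curv g x v w t) = gmet g x v (curv g x s t w)"
proof -
  let ?F = "\<lambda>s t v w. gmet g x s (curv g x v w t)"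
  have G: "linear (gmet g x s)" for s by (rule bilinear_gmet)
  show ?thesis
  proof (rule pair_symmetry[of ?F])
    show "?F s t v w = - ?F t s v w" for s t v w
      using gmet_curv_antisym[OF assms, of v w s t] gmet_sym[OF assms, of "curv g x v w s" t] by simp
    show "?F s t v w = - ?F s t w v" for s t v w
      using linear_neg[OF G, of s "curv g x w v t"] curv_antisym[of x v w t] by simp
    show "?F s t v w + ?F s v w t + ?F s w t v = 0" for s t v w
      using arg_cong[OF bianchi[OF assms, of v w t], of "gmet g x s"] 
      by (simp add: linear_add[OF G] linear_0[OF G] add.commute add.left_commute)
  qed
qed

end

section \<open>Null two-forms and null frames\<close>

text \<open>The volume element as a multilinear form on vectors, so that it can be evaluated on a
  basis dual to the frame instead of on coordinate axes.\<close>

definition vol4 :: "(real^4 \<Rightarrow> real^4^4) \<Rightarrow> real^4 \<Rightarrow> real^4 \<Rightarrow> real^4 \<Rightarrow> real^4 \<Rightarrow> real^4 \<Rightarrow> real" where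
  "vol4 g x s t u w = sqrt \<bar>det (g x)\<bar> * det (vector [s, t, u, w] :: real^4^4)"

lemma vector_4 [simp]:
  "(vector [s, t, u, w] :: ('a::zero)^4) $ 1 = s" "(vector [s, t, u, w] :: ('a::zero)^4) $ 2 = t"
  "(vector [s, t, u, w] :: ('a::zero)^4) $ 3 = u" "(vector [s, t, u, w] :: ('a::zero)^4) $ 4 = w"
  unfolding vector_def by simp_all

lemma det_vector4_linear:
  fixes s t u w :: "real^4"
  shows "det (vector [s + s', t, u, w] :: real^4^4) = det (vector [s, t, u, w] :: real^4^4) + det (vector [s', t, u, w] :: real^4^4)"
    "det (vector [s, t + t', u, w] :: real^4^4) = det (vector [s, t, u, w] :: real^4^4) + det (vector [s, t', u, w] :: real^4^4)"
    "det (vector [s, t, u + u', w] :: real^4^4) = det (vector [s, t, u, w] :: real^4^4) + det (vector [s, t, u', w] :: real^4^4)"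
    "det (vector [s, t, u, w + w'] :: real^4^4) = det (vector [s, t, u, w] :: real^4^4) + det (vector [s, t, u, w'] :: real^4^4)"
    "det (vector [c *\<^sub>R s, t, u, w] :: real^4^4) = c * det (vector [s, t, u, w] :: real^4^4)"
    "det (vector [s, c *\<^sub>R t, u, w] :: real^4^4) = c * det (vector [s, t, u, w] :: real^4^4)"
    "det (vector [s, t, c *\<^sub>R u, w] :: real^4^4) = c * det (vector [s, t, u, w] :: real^4^4)"
    "det (vector [s, t, u, c *\<^sub>R w] :: real^4^4) = c * det (vector [s, t, u, w] :: real^4^4)"
proof -
  have row: "(vector [s, t, u, w] :: real^4^4) = (\<chi> i. if i = 1 then s else vector [0, t, u, w] $ i)"
    "(vector [s, t, u, w] :: real^4^4) = (\<chi> i. if i = 2 then t else vector [s, 0, u, w] $ i)"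
    "(vector [s, t, u, w] :: real^4^4) = (\<chi> i. if i = 3 then u else vector [s, t, 0, w] $ i)"
    "(vector [s, t, u, w] :: real^4^4) = (\<chi> i. if i = 4 then w else vector [s, t, u, 0] $ i)" for s t u w :: "real^4"
    by (simp_all add: vec_eq_iff forall_4)
  show "det (vector [s + s', t, u, w] :: real^4^4) = det (vector [s, t, u, w] :: real^4^4) + det (vector [s', t, u, w] :: real^4^4)"
    by (simp only: row(1)[of "s + s'" t u w] row(1)[of "s" t u w] row(1)[of "s'" t u w] det_row_add)
  show "det (vector [s, t + t', u, w] :: real^4^4) = det (vector [s, t, u, w] :: real^4^4) + det (vector [s, t', u, w] :: real^4^4)"
    by (simp only: row(2)[of s "t + t'" u w] row(2)[of s "t" u w] row(2)[of s "t'" u w] det_row_add)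
  show "det (vector [s, t, u + u', w] :: real^4^4) = det (vector [s, t, u, w] :: real^4^4) + det (vector [s, t, u', w] :: real^4^4)"
    by (simp only: row(3)[of s t "u + u'" w] row(3)[of s t "u" w] row(3)[of s t "u'" w] det_row_add)
  show "det (vector [s, t, u, w + w'] :: real^4^4) = det (vector [s, t, u, w] :: real^4^4) + det (vector [s, t, u, w'] :: real^4^4)"
    by (simp only: row(4)[of s t u "w + w'"] row(4)[of s t u "w"] row(4)[of s t u "w'"] det_row_add)
  show "det (vector [c *\<^sub>R s, t, u, w] :: real^4^4) = c * det (vector [s, t, u, w] :: real^4^4)"
    by (simp only: scalar_mult_eq_scaleR[symmetric] row(1)[of "c *s s" t u w] row(1)[of "s" t u w] det_row_mul)
  show "det (vector [s, c *\<^sub>R t, u, w] :: real^4^4) = c * det (vector [s, t, u, w] :: real^4^4)"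
    by (simp only: scalar_mult_eq_scaleR[symmetric] row(2)[of s "c *s t" u w] row(2)[of s "t" u w] det_row_mul)
  show "det (vector [s, t, c *\<^sub>R u, w] :: real^4^4) = c * det (vector [s, t, u, w] :: real^4^4)"
    by (simp only: scalar_mult_eq_scaleR[symmetric] row(3)[of s t "c *s u" w] row(3)[of s t "u" w] det_row_mul)
  show "det (vector [s, t, u, c *\<^sub>R w] :: real^4^4) = c * det (vector [s, t, u, w] :: real^4^4)"
    by (simp only: scalar_mult_eq_scaleR[symmetric] row(4)[of s t u "c *s w"] row(4)[of s t u "w"] det_row_mul)
qed

lemma vol4_linear:
  "vol4 g x (s + s') t u w = vol4 g x s t u w + vol4 g x s' t u w"
  "vol4 g x s (t + t') u w = vol4 g x s t u w + vol4 g x s t' u w"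
  "vol4 g x s t (u + u') w = vol4 g x s t u w + vol4 g x s t u' w"
  "vol4 g x s t u (w + w') = vol4 g x s t u w + vol4 g x s t u w'"
  "vol4 g x (c *\<^sub>R s) t u w = c * vol4 g x s t u w"
  "vol4 g x s (c *\<^sub>R t) u w = c * vol4 g x s t u w"
  "vol4 g x s t (c *\<^sub>R u) w = c * vol4 g x s t u w"
  "vol4 g x s t u (c *\<^sub>R w) = c * vol4 g x s t u w"
  unfolding vol4_def det_vector4_linear by (simp_all add: algebra_simps)

lemma vol4_same:
  "vol4 g x s s u w = 0" "vol4 g x s t s w = 0" "vol4 g x s t u s = 0"
  "vol4 g x s t t w = 0" "vol4 g x s t u t = 0" "vol4 g x s t u u = 0"
proof -
  have d: "det (vector [s, t, u, w] :: real^4^4) = 0"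
    if "i \<noteq> j" "(vector [s, t, u, w] :: real^4^4) $ i = vector [s, t, u, w] $ j" for i j and s t u w :: "real^4"
    using that by (intro det_identical_rows[of i j]) (auto simp: row_def vec_eq_iff)
  show "vol4 g x s s u w = 0" "vol4 g x s t s w = 0" "vol4 g x s t u s = 0"
    "vol4 g x s t t w = 0" "vol4 g x s t u t = 0" "vol4 g x s t u u = 0"
    using d[of 1 2 s s u w] d[of 1 3 s t s w] d[of 1 4 s t u s] d[of 2 3 s t t w] d[of 2 4 s t u t] d[of 3 4 s t u u]
    by (simp_all add: vol4_def)
qed

lemma vol4_swap:
  "vol4 g x t s u w = - vol4 g x s t u w"
  "vol4 g x s u t w = - vol4 g x s t u w"
  "vol4 g x s t w u = - vol4 g x s t u w"
  using vol4_same(1)[of g x "s + t" u w, unfolded vol4_linear] vol4_same(4)[of g x s "t + u" w, unfolded vol4_linear]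
    vol4_same(6)[of g x s t "u + w", unfolded vol4_linear]
  by (simp_all add: vol4_same eq_neg_iff_add_eq_0 add.commute)

lemma vol_vol4: "vol g x a b c d = vol4 g x (axis a 1) (axis b 1) (axis c 1) (axis d 1)"
  by (simp add: vol_def vol4_def)

lemma vol4_sum:
  "vol4 g x (\<Sum>i\<in>I. f i) t u w = (\<Sum>i\<in>I. vol4 g x (f i) t u w)"
  "vol4 g x s (\<Sum>i\<in>I. f i) u w = (\<Sum>i\<in>I. vol4 g x s (f i) u w)"
  "vol4 g x s t (\<Sum>i\<in>I. f i) w = (\<Sum>i\<in>I. vol4 g x s t (f i) w)"
  "vol4 g x s t u (\<Sum>i\<in>I. f i) = (\<Sum>i\<in>I. vol4 g x s t u (f i))"
proof -
  have "linear (\<lambda>s. vol4 g x s t u w)" "linear (\<lambda>t. vol4 g x s t u w)"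
    "linear (\<lambda>u. vol4 g x s t u w)" "linear (\<lambda>w. vol4 g x s t u w)" for s t u w
    by (rule linearI; simp add: vol4_linear)+
  then show
    "vol4 g x (\<Sum>i\<in>I. f i) t u w = (\<Sum>i\<in>I. vol4 g x (f i) t u w)"
    "vol4 g x s (\<Sum>i\<in>I. f i) u w = (\<Sum>i\<in>I. vol4 g x s (f i) u w)"
    "vol4 g x s t (\<Sum>i\<in>I. f i) w = (\<Sum>i\<in>I. vol4 g x s t (f i) w)"
    "vol4 g x s t u (\<Sum>i\<in>I. f i) = (\<Sum>i\<in>I. vol4 g x s t u (f i))"
    using linear_sum by blast+
qed

lemma vol4_expand12:
  "vol4 g x s t u w = (\<Sum>a\<in>UNIV. \<Sum>b\<in>UNIV. s $ a * t $ b * vol4 g x (axis a 1) (axis b 1) u w)"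
proof -
  have 1: "vol4 g x s t u w = (\<Sum>a\<in>UNIV. s $ a * vol4 g x (axis a 1) t u w)" for s t
    by (subst axis_expansion[of s]) (simp add: vol4_sum vol4_linear)
  have 2: "vol4 g x s t u w = (\<Sum>b\<in>UNIV. t $ b * vol4 g x s (axis b 1) u w)" for s t
    by (subst axis_expansion[of t]) (simp add: vol4_sum vol4_linear)
  show ?thesis by (subst 1, subst 2) (simp add: sum_distrib_left mult.assoc)
qed

lemma vol4_expand34:
  "vol4 g x s t u w = (\<Sum>c\<in>UNIV. \<Sum>d\<in>UNIV. vol4 g x s t (axis c 1) (axis d 1) * (u $ c * w $ d))"
proof -
  have 1: "vol4 g x s t u w = (\<Sum>a\<in>UNIV. u $ a * vol4 g x s t (axis a 1) w)" for u w
    by (subst axis_expansion[of u]) (simp add: vol4_sum vol4_linear)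
  have 2: "vol4 g x s t u w = (\<Sum>b\<in>UNIV. w $ b * vol4 g x s t u (axis b 1))" for u w
    by (subst axis_expansion[of w]) (simp add: vol4_sum vol4_linear)
  show ?thesis by (subst 1, subst 2) (simp add: sum_distrib_left mult.assoc mult.commute mult.left_commute)
qed

lemma bilinear_form_expand:
  fixes M :: "real^'n^'n"
  shows "s \<bullet> (M *v t) = (\<Sum>a\<in>UNIV. \<Sum>b\<in>UNIV. s $ a * t $ b * M $ a $ b)"
  by (simp add: inner_vec_def matrix_vector_mult_def sum_distrib_left mult.assoc mult.commute mult.left_commute)

text \<open>If the two-form with raised indices is a combination of tensor products of vectors
  \<open>u i\<close>, its dual is obtained by inserting these vectors into the volume form. All
  Hodge duals below are computed by choosing convenient vectors.\<close>

lemma hodge2_bilinear: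
  assumes "\<And>c d. (\<Sum>e\<in>UNIV. \<Sum>f\<in>UNIV. ginv g x c e * ginv g x d f * F $ e $ f) = (\<Sum>i\<in>I. \<Sum>j\<in>I. \<phi> i j * (u i $ c * u j $ d))"
  shows "s \<bullet> (hodge2 g x F *v t) = (\<Sum>i\<in>I. \<Sum>j\<in>I. \<phi> i j * vol4 g x s t (u i) (u j)) / 2"
proof -
  have "hodge2 g x F $ a $ b = (\<Sum>i\<in>I. \<Sum>j\<in>I. \<phi> i j * vol4 g x (axis a 1) (axis b 1) (u i) (u j)) / 2" for a b
  proof -
    have "hodge2 g x F $ a $ b =
        (\<Sum>c\<in>UNIV. \<Sum>d\<in>UNIV. vol g x a b c d * (\<Sum>e\<in>UNIV. \<Sum>f\<in>UNIV. ginv g x c e * ginv g x d f * F $ e $ f)) / 2"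
      by (simp add: hodge2_def sum_distrib_left mult.assoc)
    also have "\<dots> = (\<Sum>c\<in>UNIV. \<Sum>d\<in>UNIV. \<Sum>i\<in>I. \<Sum>j\<in>I. \<phi> i j * (vol g x a b c d * (u i $ c * u j $ d))) / 2"
      unfolding assms by (simp add: sum_distrib_left mult.assoc mult.commute mult.left_commute)
    also have "\<dots> = (\<Sum>i\<in>I. \<Sum>j\<in>I. \<Sum>c\<in>UNIV. \<Sum>d\<in>UNIV. \<phi> i j * (vol g x a b c d * (u i $ c * u j $ d))) / 2"
      by (subst (2) sum.swap, subst sum.swap, subst (3) sum.swap, subst (2) sum.swap) (rule refl)
    finally show ?thesis
      by (simp add: vol4_expand34[of g x _ _ "u i" for i] vol_vol4 sum_distrib_left)
  qed
  then have "s \<bullet> (hodge2 g x F *v t)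
      = (\<Sum>a\<in>UNIV. \<Sum>b\<in>UNIV. \<Sum>i\<in>I. \<Sum>j\<in>I. \<phi> i j * (s $ a * t $ b * vol4 g x (axis a 1) (axis b 1) (u i) (u j))) / 2"
    by (simp add: bilinear_form_expand sum_distrib_left sum_divide_distrib mult.assoc mult.commute mult.left_commute)
  also have "\<dots> = (\<Sum>i\<in>I. \<Sum>j\<in>I. \<Sum>a\<in>UNIV. \<Sum>b\<in>UNIV. \<phi> i j * (s $ a * t $ b * vol4 g x (axis a 1) (axis b 1) (u i) (u j))) / 2"
    by (subst (2) sum.swap, subst sum.swap, subst (3) sum.swap, subst (2) sum.swap) (rule refl)
  finally show ?thesis
    by (simp add: vol4_expand12[of g x s t] sum_distrib_left)
qed

lemma wedge_bilinear:
  fixes \<alpha> \<beta> :: "real^4"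
  shows "s \<bullet> (wedge \<alpha> \<beta> *v t) = (\<alpha> \<bullet> s) * (\<beta> \<bullet> t) - (\<alpha> \<bullet> t) * (\<beta> \<bullet> s)"
  by (simp add: inner_vec_def matrix_vector_mult_def wedge_def sum_4 algebra_simps)

lemma bilinear_form_eqI:
  fixes M N :: "real^'n^'n"
  assumes "invertible P" "\<And>i j. column i P \<bullet> (M *v column j P) = column i P \<bullet> (N *v column j P)"
  shows "M = N"
proof -
  have *: "(transpose P ** M ** P) $ i $ j = column i P \<bullet> (M *v column j P)" for i j and M :: "real^'n^'n"
    unfolding bilinear_form_expand
    by (simp add: matrix_matrix_mult_def transpose_def column_def sum_distrib_left sum_distrib_right
        mult.assoc mult.commute mult.left_commute)
      (subst sum.swap, simp add: mult.assoc mult.commute mult.left_commute)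
  have eq: "transpose P ** M ** P = transpose P ** N ** P"
    using assms(2) by (simp add: vec_eq_iff *)
  obtain Q where Q: "P ** Q = mat 1" "Q ** P = mat 1" using assms(1) by (auto simp: invertible_def)
  have T: "transpose Q ** transpose P = mat 1"
    using Q by (metis matrix_transpose_mul transpose_mat)
  have "K = transpose Q ** (transpose P ** K ** P) ** Q" for K :: "real^'n^'n"
  proof -
    have "transpose Q ** (transpose P ** K ** P) ** Q = (transpose Q ** transpose P) ** K ** (P ** Q)"
      by (simp add: matrix_mul_assoc)
    then show ?thesis using Q T by simp
  qed
  then show ?thesis using eq by metis
qed

text \<open>Instantiated with a fixed basis, these are rewrite rules that bring every reordering of
  the four basis vectors to the standard order.\<close>

lemma vol4_perms:
  shows "vol4 g x s t w u = - vol4 g x s t u w"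
    and "vol4 g x s u t w = - vol4 g x s t u w"
    and "vol4 g x s u w t = vol4 g x s t u w"
    and "vol4 g x s w t u = vol4 g x s t u w"
    and "vol4 g x s w u t = - vol4 g x s t u w"
    and "vol4 g x t s u w = - vol4 g x s t u w"
    and "vol4 g x t s w u = vol4 g x s t u w"
    and "vol4 g x t u s w = vol4 g x s t u w"
    and "vol4 g x t u w s = - vol4 g x s t u w"
    and "vol4 g x t w s u = - vol4 g x s t u w"
    and "vol4 g x t w u s = vol4 g x s t u w"
    and "vol4 g x u s t w = vol4 g x s t u w"
    and "vol4 g x u s w t = - vol4 g x s t u w"
    and "vol4 g x u t s w = - vol4 g x s t u w"
    and "vol4 g x u t w s = vol4 g x s t u w"
    and "vol4 g x u w s t = vol4 g x s t u w"
    and "vol4 g x u w t s = - vol4 g x s t u w"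
    and "vol4 g x w s t u = - vol4 g x s t u w"
    and "vol4 g x w s u t = vol4 g x s t u w"
    and "vol4 g x w t s u = vol4 g x s t u w"
    and "vol4 g x w t u s = - vol4 g x s t u w"
    and "vol4 g x w u s t = - vol4 g x s t u w"
    and "vol4 g x w u t s = vol4 g x s t u w"
proof -
  show "vol4 g x s t w u = - vol4 g x s t u w"
    by (simp only: vol4_swap(3)[of g x s t w u] minus_minus)
  show "vol4 g x s u t w = - vol4 g x s t u w"
    by (simp only: vol4_swap(2)[of g x s u t w] minus_minus)
  show "vol4 g x s u w t = vol4 g x s t u w"
    by (simp only: vol4_swap(3)[of g x s u w t] vol4_swap(2)[of g x s u t w] minus_minus)
  show "vol4 g x s w t u = vol4 g x s t u w"
    by (simp only: vol4_swap(2)[of g x s w t u] vol4_swap(3)[of g x s t w u] minus_minus)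
  show "vol4 g x s w u t = - vol4 g x s t u w"
    by (simp only: vol4_swap(2)[of g x s w u t] vol4_swap(3)[of g x s u w t] vol4_swap(2)[of g x s u t w] minus_minus)
  show "vol4 g x t s u w = - vol4 g x s t u w"
    by (simp only: vol4_swap(1)[of g x t s u w] minus_minus)
  show "vol4 g x t s w u = vol4 g x s t u w"
    by (simp only: vol4_swap(1)[of g x t s w u] vol4_swap(3)[of g x s t w u] minus_minus)
  show "vol4 g x t u s w = vol4 g x s t u w"
    by (simp only: vol4_swap(2)[of g x t u s w] vol4_swap(1)[of g x t s u w] minus_minus)
  show "vol4 g x t u w s = - vol4 g x s t u w"
    by (simp only: vol4_swap(3)[of g x t u w s] vol4_swap(2)[of g x t u s w] vol4_swap(1)[of g x t s u w] minus_minus)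
  show "vol4 g x t w s u = - vol4 g x s t u w"
    by (simp only: vol4_swap(2)[of g x t w s u] vol4_swap(1)[of g x t s w u] vol4_swap(3)[of g x s t w u] minus_minus)
  show "vol4 g x t w u s = vol4 g x s t u w"
    by (simp only: vol4_swap(2)[of g x t w u s] vol4_swap(3)[of g x t u w s] vol4_swap(2)[of g x t u s w] vol4_swap(1)[of g x t s u w] minus_minus)
  show "vol4 g x u s t w = vol4 g x s t u w"
    by (simp only: vol4_swap(1)[of g x u s t w] vol4_swap(2)[of g x s u t w] minus_minus)
  show "vol4 g x u s w t = - vol4 g x s t u w"
    by (simp only: vol4_swap(1)[of g x u s w t] vol4_swap(3)[of g x s u w t] vol4_swap(2)[of g x s u t w] minus_minus)
  show "vol4 g x u t s w = - vol4 g x s t u w"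
    by (simp only: vol4_swap(1)[of g x u t s w] vol4_swap(2)[of g x t u s w] vol4_swap(1)[of g x t s u w] minus_minus)
  show "vol4 g x u t w s = vol4 g x s t u w"
    by (simp only: vol4_swap(1)[of g x u t w s] vol4_swap(3)[of g x t u w s] vol4_swap(2)[of g x t u s w] vol4_swap(1)[of g x t s u w] minus_minus)
  show "vol4 g x u w s t = vol4 g x s t u w"
    by (simp only: vol4_swap(2)[of g x u w s t] vol4_swap(1)[of g x u s w t] vol4_swap(3)[of g x s u w t] vol4_swap(2)[of g x s u t w] minus_minus)
  show "vol4 g x u w t s = - vol4 g x s t u w"
    by (simp only: vol4_swap(2)[of g x u w t s] vol4_swap(1)[of g x u t w s] vol4_swap(3)[of g x t u w s] vol4_swap(2)[of g x t u s w] vol4_swap(1)[of g x t s u w] minus_minus)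
  show "vol4 g x w s t u = - vol4 g x s t u w"
    by (simp only: vol4_swap(1)[of g x w s t u] vol4_swap(2)[of g x s w t u] vol4_swap(3)[of g x s t w u] minus_minus)
  show "vol4 g x w s u t = vol4 g x s t u w"
    by (simp only: vol4_swap(1)[of g x w s u t] vol4_swap(2)[of g x s w u t] vol4_swap(3)[of g x s u w t] vol4_swap(2)[of g x s u t w] minus_minus)
  show "vol4 g x w t s u = vol4 g x s t u w"
    by (simp only: vol4_swap(1)[of g x w t s u] vol4_swap(2)[of g x t w s u] vol4_swap(1)[of g x t s w u] vol4_swap(3)[of g x s t w u] minus_minus)
  show "vol4 g x w t u s = - vol4 g x s t u w"
    by (simp only: vol4_swap(1)[of g x w t u s] vol4_swap(2)[of g x t w u s] vol4_swap(3)[of g x t u w s] vol4_swap(2)[of g x t u s w] vol4_swap(1)[of g x t s u w] minus_minus)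
  show "vol4 g x w u s t = - vol4 g x s t u w"
    by (simp only: vol4_swap(1)[of g x w u s t] vol4_swap(2)[of g x u w s t] vol4_swap(1)[of g x u s w t] vol4_swap(3)[of g x s u w t] vol4_swap(2)[of g x s u t w] minus_minus)
  show "vol4 g x w u t s = vol4 g x s t u w"
    by (simp only: vol4_swap(1)[of g x w u t s] vol4_swap(2)[of g x u w t s] vol4_swap(1)[of g x u t w s] vol4_swap(3)[of g x t u w s] vol4_swap(2)[of g x t u s w] vol4_swap(1)[of g x t s u w] minus_minus)
qed

lemma sum_swap4:
  "(\<Sum>a\<in>A. \<Sum>b\<in>B. \<Sum>c\<in>C. \<Sum>d\<in>D. f a b c d) = (\<Sum>c\<in>C. \<Sum>d\<in>D. \<Sum>a\<in>A. \<Sum>b\<in>B. f a b c d)"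
  by (subst (2) sum.swap, subst sum.swap, subst (3) sum.swap, subst (2) sum.swap) (rule refl)

text \<open>\<open>C\<close> is the cross product of the orthonormal vectors \<open>E\<close> and
  \<open>B\<close> in three dimensions. The first six identities are the completeness relation of
  the orthonormal triple, the others are C x E = B and C x B = -E in components.\<close>

lemma orthonormal_pair_completion:
  fixes E2 E3 E4 B2 B3 B4 :: real
  assumes "E2^2 + E3^2 + E4^2 = 1" "B2^2 + B3^2 + B4^2 = 1" "E2 * B2 + E3 * B3 + E4 * B4 = 0"
  defines "C2 \<equiv> E3 * B4 - E4 * B3" and "C3 \<equiv> E4 * B2 - E2 * B4" and "C4 \<equiv> E2 * B3 - E3 * B2"
  shows "C2 * C2 + E2 * E2 + B2 * B2 = 1" "C3 * C3 + E3 * E3 + B3 * B3 = 1" "C4 * C4 + E4 * E4 + B4 * B4 = 1"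
    "C2 * C3 + E2 * E3 + B2 * B3 = 0" "C2 * C4 + E2 * E4 + B2 * B4 = 0" "C3 * C4 + E3 * E4 + B3 * B4 = 0"
    "C3 * E4 - C4 * E3 = B2" "C4 * E2 - C2 * E4 = B3" "C2 * E3 - C3 * E2 = B4"
    "C3 * B4 - C4 * B3 = - E2" "C4 * B2 - C2 * B4 = - E3" "C2 * B3 - C3 * B2 = - E4"
  unfolding C2_def C3_def C4_def using assms(1-3) by algebra+

lemma minus_matrix_vector_mult: "(- M) *v t = - (M *v t)" for M :: "real^'n^'m"
  by (simp add: matrix_vector_mult_def vec_eq_iff sum_negf)

section \<open>Null two-forms at a point\<close>

context spacetime_chart
begin

text \<open>The columns of the matrix that diagonalises the metric. Their orientation is left open
  and recorded by the sign \<sigma>; it squares to 1 because det g times (det P)^2 equals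
  -1.\<close>

lemma orthonormal_basis:
  assumes "x \<in> U"
  obtains P \<sigma> where "invertible P" "\<forall>i j. column i P \<bullet> (g x *v column j P) = minkowski $ i $ j"
    "\<forall>a b. ginv g x a b = (\<Sum>i\<in>UNIV. minkowski $ i $ i * (column i P $ a * column i P $ b))"
    "vol4 g x (column 1 P) (column 2 P) (column 3 P) (column 4 P) = \<sigma>" "\<sigma> * \<sigma> = 1" "det (g x) < 0"
proof -
  obtain P where P: "invertible P" "transpose P ** g x ** P = minkowski"
    using lorentz[OF assms] by (auto simp: lorentzian_def)
  have 1: "column i P \<bullet> (g x *v column j P) = minkowski $ i $ j" for i j
    unfolding bilinear_form_expand P(2)[symmetric]
    by (simp add: matrix_matrix_mult_def transpose_def column_def sum_distrib_left sum_distrib_right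
        mult.assoc mult.commute mult.left_commute)
      (subst sum.swap, simp add: mult.assoc mult.commute mult.left_commute)
  have mm: "minkowski ** minkowski = mat 1"
    by (simp add: minkowski_def matrix_matrix_mult_def mat_def vec_eq_iff forall_4 sum_4)
  have dm: "det minkowski = -1"
  proof -
    have "det minkowski = (\<Prod>i\<in>UNIV. minkowski $ i $ i)"
      by (rule det_diagonal) (simp add: minkowski_def)
    also have "\<dots> = -1" unfolding UNIV_4 by (simp add: minkowski_def)
    finally show ?thesis .
  qed
  have "(P ** minkowski ** transpose P) ** g x = mat 1"
  proof -
    obtain Q where Q: "P ** Q = mat 1" "Q ** P = mat 1" using P(1) by (auto simp: invertible_def)
    have "(P ** minkowski ** transpose P) ** g x = P ** minkowski ** (transpose P ** g x ** P) ** Q"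
      using Q by (simp add: matrix_mul_assoc[symmetric])
    also have "\<dots> = mat 1" unfolding P(2) using Q mm by (simp add: matrix_mul_assoc[symmetric])
    finally show ?thesis .
  qed
  then have "P ** minkowski ** transpose P = (P ** minkowski ** transpose P) ** (g x ** matrix_inv (g x))"
    and "matrix_inv (g x) = ((P ** minkowski ** transpose P) ** g x) ** matrix_inv (g x)"
    using matrix_inv[OF lorentzian_invertible[OF lorentz[OF assms]]] by simp_all
  then have inv: "matrix_inv (g x) = P ** minkowski ** transpose P" by (simp add: matrix_mul_assoc)
  have 2: "ginv g x a b = (\<Sum>i\<in>UNIV. minkowski $ i $ i * (column i P $ a * column i P $ b))" for a b
    unfolding ginv_def inv
    by (simp add: matrix_matrix_mult_def transpose_def column_def minkowski_def sum_4)
  have "det P * det (g x) * det P = -1"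
    using arg_cong[OF P(2), of det] dm by (simp add: det_mul)
  then have d: "det (g x) * (det P)\<^sup>2 = -1" by (simp add: power2_eq_square mult.assoc mult.commute mult.left_commute)
  then have neg: "det (g x) < 0"
    by (metis mult_nonneg_nonneg not_less zero_le_power2 neg_0_le_iff_le not_one_le_zero)
  have "vector [column 1 P, column 2 P, column 3 P, column 4 P] = transpose P"
    by (simp add: vec_eq_iff forall_4 column_def transpose_def)
  then have v: "vol4 g x (column 1 P) (column 2 P) (column 3 P) (column 4 P) = sqrt \<bar>det (g x)\<bar> * det P"
    by (simp add: vol4_def)
  have "(sqrt \<bar>det (g x)\<bar> * det P) * (sqrt \<bar>det (g x)\<bar> * det P) = (sqrt \<bar>det (g x)\<bar>)\<^sup>2 * (det P)\<^sup>2"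
    by (simp add: power2_eq_square)
  also have "\<dots> = - (det (g x) * (det P)\<^sup>2)" using neg by simp
  finally have "(sqrt \<bar>det (g x)\<bar> * det P) * (sqrt \<bar>det (g x)\<bar> * det P) = 1" using d by simp
  then show ?thesis using that[of P, OF P(1) _ _ v _ neg] 1 2 by blast
qed

lemma raise_two_form:
  assumes "\<And>a b. ginv g x a b = (\<Sum>i\<in>UNIV. minkowski $ i $ i * (column i P $ a * column i P $ b))"
  shows "(\<Sum>e\<in>UNIV. \<Sum>f\<in>UNIV. ginv g x c e * ginv g x d f * F $ e $ f)
    = (\<Sum>i\<in>UNIV. \<Sum>j\<in>UNIV. (minkowski $ i $ i * minkowski $ j $ j * (column i P \<bullet> (F *v column j P))) * (column i P $ c * column j P $ d))"
proof -
  have "(\<Sum>e\<in>UNIV. \<Sum>f\<in>UNIV. ginv g x c e * ginv g x d f * F $ e $ f)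
      = (\<Sum>e\<in>UNIV. \<Sum>f\<in>UNIV. \<Sum>i\<in>UNIV. \<Sum>j\<in>UNIV. (minkowski $ i $ i * minkowski $ j $ j * (column i P $ e * column j P $ f * F $ e $ f)) * (column i P $ c * column j P $ d))"
    unfolding assms
    by (simp only: sum_product, simp only: sum_distrib_right, intro sum.cong refl)
      (simp add: mult.assoc mult.commute mult.left_commute)
  also have "\<dots> = (\<Sum>i\<in>UNIV. \<Sum>j\<in>UNIV. \<Sum>e\<in>UNIV. \<Sum>f\<in>UNIV. (minkowski $ i $ i * minkowski $ j $ j * (column i P $ e * column j P $ f * F $ e $ f)) * (column i P $ c * column j P $ d))"
    by (rule sum_swap4)
  finally show ?thesis
    unfolding bilinear_form_expand sum_distrib_left sum_distrib_right .
qed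

definition form_prod :: "real^4 \<Rightarrow> real^4^4 \<Rightarrow> real^4^4 \<Rightarrow> real" where
  "form_prod x F G = (\<Sum>a\<in>UNIV. \<Sum>b\<in>UNIV. \<Sum>c\<in>UNIV. \<Sum>d\<in>UNIV. ginv g x a c * ginv g x b d * F $ a $ b * G $ c $ d)"

lemma form_prod_basis:
  assumes "\<And>a b. ginv g x a b = (\<Sum>i\<in>UNIV. minkowski $ i $ i * (column i P $ a * column i P $ b))"
  shows "form_prod x F G = (\<Sum>i\<in>UNIV. \<Sum>j\<in>UNIV. minkowski $ i $ i * minkowski $ j $ j *
    (column i P \<bullet> (F *v column j P)) * (column i P \<bullet> (G *v column j P)))"
proof -
  have "form_prod x F G = (\<Sum>a\<in>UNIV. \<Sum>b\<in>UNIV. F $ a $ b * (\<Sum>c\<in>UNIV. \<Sum>d\<in>UNIV. ginv g x a c * ginv g x b d * G $ c $ d))"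
    unfolding form_prod_def by (simp add: sum_distrib_left mult.assoc mult.commute mult.left_commute)
  also have "\<dots> = (\<Sum>a\<in>UNIV. \<Sum>b\<in>UNIV. \<Sum>i\<in>UNIV. \<Sum>j\<in>UNIV.
      minkowski $ i $ i * minkowski $ j $ j * (column i P \<bullet> (G *v column j P)) * (column i P $ a * column j P $ b * F $ a $ b))"
    unfolding raise_two_form[OF assms] by (simp add: sum_distrib_left mult.assoc mult.commute mult.left_commute)
  also have "\<dots> = (\<Sum>i\<in>UNIV. \<Sum>j\<in>UNIV. \<Sum>a\<in>UNIV. \<Sum>b\<in>UNIV.
      minkowski $ i $ i * minkowski $ j $ j * (column i P \<bullet> (G *v column j P)) * (column i P $ a * column j P $ b * F $ a $ b))"
    by (rule sum_swap4)
  also have "\<dots> = (\<Sum>i\<in>UNIV. \<Sum>j\<in>UNIV.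
      minkowski $ i $ i * minkowski $ j $ j * (column i P \<bullet> (G *v column j P)) * (column i P \<bullet> (F *v column j P)))"
    unfolding bilinear_form_expand[of _ F] by (simp only: sum_distrib_left)
  finally show ?thesis by (simp add: mult.assoc mult.commute mult.left_commute)
qed

text \<open>The electric and magnetic parts of a null field have equal length and are orthogonal, as
  for a plane electromagnetic wave. \<open>l\<close> points along the wave, \<open>a\<close> along
  the electric part and \<open>b\<close> against the magnetic part.\<close>

lemma null_form_frame:
  assumes x: "x \<in> U" and antisym: "\<And>a b. F $ a $ b = - F $ b $ a" and "F \<noteq> 0" and G: "G = hodge2 g x F"
    and null: "form_prod x F F = form_prod x G G" "form_prod x F G = 0"
  obtains l n a b where "g x = (\<chi> i j. - (l $ i * n $ j) - n $ i * l $ j + a $ i * a $ j + b $ i * b $ j)"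
    "F = wedge l a" "G = - wedge l b"
proof -
  obtain P \<sigma> where P: "invertible P" and P2: "\<forall>i j. column i P \<bullet> (g x *v column j P) = minkowski $ i $ j"
    and gi': "\<forall>a b. ginv g x a b = (\<Sum>i\<in>UNIV. minkowski $ i $ i * (column i P $ a * column i P $ b))"
    and v: "vol4 g x (column 1 P) (column 2 P) (column 3 P) (column 4 P) = \<sigma>" and \<sigma>: "\<sigma> * \<sigma> = 1"
    and "det (g x) < 0"
    by (rule orthonormal_basis[OF x])
  note gi = gi'[rule_format]
  define f where "f i j = column i P \<bullet> (F *v column j P)" for i j
  define h where "h i j = column i P \<bullet> (G *v column j P)" for i j
  have fs: "f i j = - f j i" for i j
  proof -
    have "f i j = (\<Sum>a\<in>UNIV. \<Sum>b\<in>UNIV. - (column i P $ a * column j P $ b * F $ b $ a))"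
      unfolding f_def bilinear_form_expand by (intro sum.cong refl) (subst antisym, simp)
    also have "\<dots> = - f j i"
      unfolding f_def bilinear_form_expand by (subst sum.swap) (simp add: sum_negf mult.commute mult.left_commute)
    finally show ?thesis .
  qed
  have f0: "f i i = 0" for i using fs[of i i] by simp
  have eta: "minkowski $ 1 $ 1 = -1" "minkowski $ 2 $ 2 = 1" "minkowski $ 3 $ 3 = 1" "minkowski $ 4 $ 4 = 1"
    by (simp_all add: minkowski_def)
  have hf: "h k l = (\<Sum>i\<in>UNIV. \<Sum>j\<in>UNIV. (minkowski $ i $ i * minkowski $ j $ j * f i j) * vol4 g x (column k P) (column l P) (column i P) (column j P)) / 2" for k l
    unfolding h_def G f_def by (rule hodge2_bilinear[OF raise_two_form[OF gi]])
  note perms = vol4_perms[of g x, where s = "column 1 P" and t = "column 2 P" and u = "column 3 P" and w = "column 4 P"]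
  have fl: "f 2 1 = - f 1 2" "f 3 1 = - f 1 3" "f 4 1 = - f 1 4" "f 3 2 = - f 2 3" "f 4 2 = - f 2 4" "f 4 3 = - f 3 4"
    by (rule fs)+
  have h1: "h 1 2 = \<sigma> * f 3 4" "h 1 3 = - \<sigma> * f 2 4" "h 1 4 = \<sigma> * f 2 3"
    "h 3 4 = - \<sigma> * f 1 2" "h 2 4 = \<sigma> * f 1 3" "h 2 3 = - \<sigma> * f 1 4"
    "h 2 1 = - \<sigma> * f 3 4" "h 3 1 = \<sigma> * f 2 4" "h 4 1 = - \<sigma> * f 2 3"
    "h 4 3 = \<sigma> * f 1 2" "h 4 2 = - \<sigma> * f 1 3" "h 3 2 = \<sigma> * f 1 4"
    "h 1 1 = 0" "h 2 2 = 0" "h 3 3 = 0" "h 4 4 = 0"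
    unfolding hf sum_4 by (simp_all only: vol4_same perms v eta f0 fl) (simp_all add: field_simps)
  \<comment> \<open>Electric part of \<open>F\<close> relative to the first basis vector, and
    magnetic part as the electric part of the dual. By duality they determine all components of
    \<open>F\<close>, up to the orientation sign \<sigma>.\<close>
  define E2 E3 E4 B2 B3 B4 where "E2 = f 1 2" "E3 = f 1 3" "E4 = f 1 4" "B2 = h 1 2" "B3 = h 1 3" "B4 = h 1 4"
  note EB = this
  have f1: "f 3 4 = \<sigma> * B2" "f 2 4 = - \<sigma> * B3" "f 2 3 = \<sigma> * B4"
    unfolding EB h1 using \<sigma> by (simp_all add: mult.assoc[symmetric])
  have n1: "E2^2 + E3^2 + E4^2 = B2^2 + B3^2 + B4^2"
  proof -
    have "form_prod x F F = 2 * (B2^2 + B3^2 + B4^2 - (E2^2 + E3^2 + E4^2))"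
      unfolding form_prod_basis[OF gi] f_def[symmetric] sum_4 
      by (simp only: eta f0 fl f1 EB(1-3)[symmetric]) (use \<sigma> in algebra)
    moreover have "form_prod x G G = 2 * (E2^2 + E3^2 + E4^2 - (B2^2 + B3^2 + B4^2))"
      unfolding form_prod_basis[OF gi] h_def[symmetric] sum_4 
      by (simp only: eta h1 f1 EB(1-3)[symmetric]) (use \<sigma> in algebra)
    ultimately show ?thesis using null(1) by simp
  qed
  have n2: "E2 * B2 + E3 * B3 + E4 * B4 = 0"
  proof -
    have "form_prod x F G = - 4 * (E2 * B2 + E3 * B3 + E4 * B4)"
      unfolding form_prod_basis[OF gi] f_def[symmetric] h_def[symmetric] sum_4 
      by (simp only: eta h1 f0 fl f1 EB(1-3)[symmetric]) (use \<sigma> in algebra)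
    then show ?thesis using null(2) by simp
  qed
  define \<epsilon> where "\<epsilon> = sqrt (E2^2 + E3^2 + E4^2)"
  have "E2^2 + E3^2 + E4^2 \<noteq> 0"
  proof
    assume 0: "E2^2 + E3^2 + E4^2 = 0"
    then have "E2 = 0" "E3 = 0" "E4 = 0" "B2 = 0" "B3 = 0" "B4 = 0"
      using n1 by (simp_all add: add_nonneg_eq_0_iff)
    then have "f i j = 0" for i j
      using f1 fl f0 EB exhaust_4[of i] exhaust_4[of j] by auto
    then have "F = 0" by (intro bilinear_form_eqI[OF P]) (simp add: f_def)
    then show False using \<open>F \<noteq> 0\<close> by simp
  qed
  then have pos: "E2^2 + E3^2 + E4^2 > 0" by (simp add: less_le)
  then have \<epsilon>: "\<epsilon> > 0" "\<epsilon>^2 = E2^2 + E3^2 + E4^2" by (auto simp: \<epsilon>_def)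
  define e2 e3 e4 b2 b3 b4 where "e2 = E2 / \<epsilon>" "e3 = E3 / \<epsilon>" "e4 = E4 / \<epsilon>" "b2 = B2 / \<epsilon>" "b3 = B3 / \<epsilon>" "b4 = B4 / \<epsilon>"
  note eb = this
  have EBe: "E2 = \<epsilon> * e2" "E3 = \<epsilon> * e3" "E4 = \<epsilon> * e4" "B2 = \<epsilon> * b2" "B3 = \<epsilon> * b3" "B4 = \<epsilon> * b4"
    using \<epsilon> by (simp_all add: eb)
  have on: "e2^2 + e3^2 + e4^2 = 1" "b2^2 + b3^2 + b4^2 = 1" "e2 * b2 + e3 * b3 + e4 * b4 = 0"
  proof -
    have q: "E2^2 + E3^2 + E4^2 = \<epsilon>^2 * (e2^2 + e3^2 + e4^2)" "B2^2 + B3^2 + B4^2 = \<epsilon>^2 * (b2^2 + b3^2 + b4^2)"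
      "E2 * B2 + E3 * B3 + E4 * B4 = \<epsilon>^2 * (e2 * b2 + e3 * b3 + e4 * b4)"
      unfolding EBe by algebra+
    have "\<epsilon>^2 * (e2^2 + e3^2 + e4^2) = \<epsilon>^2 * 1" "\<epsilon>^2 * (b2^2 + b3^2 + b4^2) = \<epsilon>^2 * 1"
      "\<epsilon>^2 * (e2 * b2 + e3 * b3 + e4 * b4) = 0"
      using \<epsilon>(2) n1 n2 q by linarith+
    then show "e2^2 + e3^2 + e4^2 = 1" "b2^2 + b3^2 + b4^2 = 1" "e2 * b2 + e3 * b3 + e4 * b4 = 0"
      using \<epsilon>(1) by auto
  qed
  define c2 c3 c4 where "c2 = e3 * b4 - e4 * b3" "c3 = e4 * b2 - e2 * b4" "c4 = e2 * b3 - e3 * b2"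
  note c = this
  note id = orthonormal_pair_completion[OF on, folded c]
  obtain Q where Q: "P ** Q = mat 1" "Q ** P = mat 1" using P by (auto simp: invertible_def)
  define \<theta> where "\<theta> k = transpose Q *v k" for k :: "real^4"
  have \<theta>: "\<theta> k \<bullet> column j P = k $ j" for k j
  proof -
    have "\<theta> k \<bullet> column j P = k \<bullet> (Q *v (P *v axis j 1))"
      by (simp add: \<theta>_def transpose_matrix_vector dot_lmul_matrix matrix_vector_mult_basis)
    also have "\<dots> = k $ j" by (simp add: matrix_vector_mul_assoc Q inner_axis)
    finally show ?thesis .
  qed
  \<comment> \<open>With \<theta> the coframe of \<open>P\<close> and \<open>c\<close> the cross
    product of the unit vectors e and b, l is \<epsilon> times (time + \<sigma> c) and n is (time -
    \<sigma> c)/(2 \<epsilon>). The factor \<epsilon>, the field strength, makes F equal to l wedge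
    a exactly, and the factor 1/2 makes l n + n l the time part minus the part along c.\<close>
  define l n a b where "l = \<theta> (vector [\<epsilon>, \<epsilon> * \<sigma> * c2, \<epsilon> * \<sigma> * c3, \<epsilon> * \<sigma> * c4])"
    "n = \<theta> (vector [1 / (2 * \<epsilon>), - \<sigma> * c2 / (2 * \<epsilon>), - \<sigma> * c3 / (2 * \<epsilon>), - \<sigma> * c4 / (2 * \<epsilon>)])"
    "a = \<theta> (vector [0, e2, e3, e4])" "b = \<theta> (vector [0, - b2, - b3, - b4])"
  note lnab = this
  have val: "l \<bullet> column 1 P = \<epsilon>" "l \<bullet> column 2 P = \<epsilon> * \<sigma> * c2" "l \<bullet> column 3 P = \<epsilon> * \<sigma> * c3" "l \<bullet> column 4 P = \<epsilon> * \<sigma> * c4"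
    "n \<bullet> column 1 P = 1 / (2 * \<epsilon>)" "n \<bullet> column 2 P = - \<sigma> * c2 / (2 * \<epsilon>)" "n \<bullet> column 3 P = - \<sigma> * c3 / (2 * \<epsilon>)" "n \<bullet> column 4 P = - \<sigma> * c4 / (2 * \<epsilon>)"
    "a \<bullet> column 1 P = 0" "a \<bullet> column 2 P = e2" "a \<bullet> column 3 P = e3" "a \<bullet> column 4 P = e4"
    "b \<bullet> column 1 P = 0" "b \<bullet> column 2 P = - b2" "b \<bullet> column 3 P = - b3" "b \<bullet> column 4 P = - b4"
    by (simp_all add: lnab \<theta>)
  define N where "N = (\<chi> i j. - (l $ i * n $ j) - n $ i * l $ j + a $ i * a $ j + b $ i * b $ j)"
  have N: "s \<bullet> (N *v t) = - ((l \<bullet> s) * (n \<bullet> t)) - (n \<bullet> s) * (l \<bullet> t) + (a \<bullet> s) * (a \<bullet> t) + (b \<bullet> s) * (b \<bullet> t)" for s t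
    by (simp add: inner_vec_def matrix_vector_mult_def N_def sum_4 algebra_simps)
  have ss: "\<epsilon> * \<sigma> * p * (\<sigma> * q / (2 * \<epsilon>)) = p * q / 2" "\<sigma> * q / (2 * \<epsilon>) * (\<epsilon> * \<sigma> * p) = p * q / 2" for p q
    using \<epsilon>(1) \<sigma> by (simp_all add: field_simps)
  have s2: "\<sigma> * (\<sigma> * z) = z" for z using \<sigma> by (simp add: mult.assoc[symmetric])
  have "g x = N"
  proof (rule bilinear_form_eqI[OF P])
    fix i j
    have "\<forall>i j. minkowski $ i $ j = column i P \<bullet> (N *v column j P)"
      unfolding N forall_4 val using id(1-6) \<epsilon>(1)
      by (simp add: minkowski_def ss) (simp add: field_simps s2)
    then show "column i P \<bullet> (g x *v column j P) = column i P \<bullet> (N *v column j P)"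
      using P2 by simp
  qed
  moreover have "F = wedge l a"
  proof (rule bilinear_form_eqI[OF P])
    fix i j
    have "\<forall>i j. f i j = column i P \<bullet> (wedge l a *v column j P)"
      unfolding wedge_bilinear forall_4 val fl f0 f1 EB(1-3)[symmetric] EBe id(7-9)[symmetric]
      by (simp add: algebra_simps)
    then show "column i P \<bullet> (F *v column j P) = column i P \<bullet> (wedge l a *v column j P)"
      by (simp add: f_def)
  qed
  moreover have "G = - wedge l b"
  proof (rule bilinear_form_eqI[OF P])
    fix i j
    have "- \<sigma> * (\<epsilon> * e2) = \<epsilon> * \<sigma> * (c3 * b4 - c4 * b3)" "\<sigma> * (\<epsilon> * e3) = - (\<epsilon> * \<sigma> * (c4 * b2 - c2 * b4))"
      "- \<sigma> * (\<epsilon> * e4) = \<epsilon> * \<sigma> * (c2 * b3 - c3 * b2)"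
      unfolding id(10-12) by simp_all
    then have "\<forall>i j. h i j = - (column i P \<bullet> (wedge l b *v column j P))"
      unfolding wedge_bilinear forall_4 val h1 EB(1-3)[symmetric] f1 EBe
      by (simp add: algebra_simps s2)
    then show "column i P \<bullet> (G *v column j P) = column i P \<bullet> (- wedge l b *v column j P)"
      by (simp add: h_def minus_matrix_vector_mult)
  qed
  ultimately show ?thesis using that unfolding N_def by blast
qed

end

section \<open>Null coframes, dual bases and a smooth choice of the frame\<close>

definition frame_matrix :: "real^4 \<Rightarrow> real^4 \<Rightarrow> real^4 \<Rightarrow> real^4 \<Rightarrow> real^4^4" where
  "frame_matrix l n a b = (\<chi> i j. - (l $ i * n $ j) - n $ i * l $ j + a $ i * a $ j + b $ i * b $ j)"

text \<open>The vectors dual to the coframe by pairing, not by the metric: the metric raises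
  \<open>l\<close> to \<open>- Dn\<close>, \<open>n\<close> to \<open>- Dl\<close>, \<open>a\<close>
  to \<open>Da\<close> and \<open>b\<close> to \<open>Db\<close>.\<close>

definition dual_basis :: "real^4 \<Rightarrow> real^4 \<Rightarrow> real^4 \<Rightarrow> real^4 \<Rightarrow> real^4 \<Rightarrow> real^4 \<Rightarrow> real^4 \<Rightarrow> real^4 \<Rightarrow> bool" where
  "dual_basis l n a b Dl Dn Da Db \<longleftrightarrow>
    l \<bullet> Dl = 1 \<and> n \<bullet> Dl = 0 \<and> a \<bullet> Dl = 0 \<and> b \<bullet> Dl = 0 \<and>
    l \<bullet> Dn = 0 \<and> n \<bullet> Dn = 1 \<and> a \<bullet> Dn = 0 \<and> b \<bullet> Dn = 0 \<and>
    l \<bullet> Da = 0 \<and> n \<bullet> Da = 0 \<and> a \<bullet> Da = 1 \<and> b \<bullet> Da = 0 \<and>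
    l \<bullet> Db = 0 \<and> n \<bullet> Db = 0 \<and> a \<bullet> Db = 0 \<and> b \<bullet> Db = 1 \<and>
    (\<forall>t. t = (l \<bullet> t) *\<^sub>R Dl + (n \<bullet> t) *\<^sub>R Dn + (a \<bullet> t) *\<^sub>R Da + (b \<bullet> t) *\<^sub>R Db)"

lemma dual_basisD:
  assumes "dual_basis l n a b Dl Dn Da Db"
  shows "l \<bullet> Dl = 1" "n \<bullet> Dl = 0" "a \<bullet> Dl = 0" "b \<bullet> Dl = 0"
    "l \<bullet> Dn = 0" "n \<bullet> Dn = 1" "a \<bullet> Dn = 0" "b \<bullet> Dn = 0"
    "l \<bullet> Da = 0" "n \<bullet> Da = 0" "a \<bullet> Da = 1" "b \<bullet> Da = 0"
    "l \<bullet> Db = 0" "n \<bullet> Db = 0" "a \<bullet> Db = 0" "b \<bullet> Db = 1"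
  by (insert assms, unfold dual_basis_def, (elim conjE, assumption)+)

lemma dual_basis_expand:
  assumes "dual_basis l n a b Dl Dn Da Db"
  shows "(l \<bullet> t) *\<^sub>R Dl + (n \<bullet> t) *\<^sub>R Dn + (a \<bullet> t) *\<^sub>R Da + (b \<bullet> t) *\<^sub>R Db = t"
  by (insert assms, unfold dual_basis_def, elim conjE, rule sym, erule spec)

lemma frame_matrix_bilinear:
  "s \<bullet> (frame_matrix l n a b *v t) = - ((l \<bullet> s) * (n \<bullet> t)) - (n \<bullet> s) * (l \<bullet> t) + (a \<bullet> s) * (a \<bullet> t) + (b \<bullet> s) * (b \<bullet> t)"
  by (simp add: inner_vec_def matrix_vector_mult_def frame_matrix_def sum_4 algebra_simps)

lemma frame_matrix_apply:
  "frame_matrix l n a b *v t = - (n \<bullet> t) *\<^sub>R l - (l \<bullet> t) *\<^sub>R n + (a \<bullet> t) *\<^sub>R a + (b \<bullet> t) *\<^sub>R b"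
  by (simp add: vec_eq_iff inner_vec_def matrix_vector_mult_def frame_matrix_def sum_4 algebra_simps)

text \<open>A vector annihilated by the four forms is annihilated by the metric matrix built from
  them, hence is zero; so the matrix with these rows is invertible and its inverse supplies the
  basis.\<close>

lemma ex_dual_basis:
  assumes "invertible (frame_matrix l n a b)"
  shows "\<exists>Dl Dn Da Db. dual_basis l n a b Dl Dn Da Db"
proof -
  define M :: "real^4^4" where "M = vector [l, n, a, b]"
  have M: "(M *v t) $ 1 = l \<bullet> t" "(M *v t) $ 2 = n \<bullet> t" "(M *v t) $ 3 = a \<bullet> t" "(M *v t) $ 4 = b \<bullet> t" for t
    by (simp_all add: M_def matrix_vector_mul_component)
  have inj0: "t = 0" if "M *v t = 0" for t
  proof -
    have "l \<bullet> t = 0" "n \<bullet> t = 0" "a \<bullet> t = 0" "b \<bullet> t = 0" using M[of t] that by simp_all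
    then have "frame_matrix l n a b *v t = 0" by (simp add: frame_matrix_apply)
    then have "(matrix_inv (frame_matrix l n a b) ** frame_matrix l n a b) *v t = 0"
      by (simp add: matrix_vector_mul_assoc[symmetric])
    then show ?thesis using matrix_inv(2)[OF assms] by simp
  qed
  then have "invertible M"
    using invertible_left_inverse matrix_left_invertible_ker by blast
  then have "\<exists>D. M *v D = axis i 1" for i
    using matrix_inv(1) by (metis matrix_vector_mul_assoc matrix_vector_mul_lid)
  then obtain D where D: "\<And>i. M *v D i = axis i 1" by metis
  have v: "l \<bullet> D i = axis i 1 $ 1" "n \<bullet> D i = axis i 1 $ 2" "a \<bullet> D i = axis i 1 $ 3" "b \<bullet> D i = axis i 1 $ 4" for i
    unfolding M[symmetric] D by simp_all
  have "t = (l \<bullet> t) *\<^sub>R D 1 + (n \<bullet> t) *\<^sub>R D 2 + (a \<bullet> t) *\<^sub>R D 3 + (b \<bullet> t) *\<^sub>R D 4" for t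
  proof -
    have "M *v (t - ((l \<bullet> t) *\<^sub>R D 1 + (n \<bullet> t) *\<^sub>R D 2 + (a \<bullet> t) *\<^sub>R D 3 + (b \<bullet> t) *\<^sub>R D 4)) = 0"
      by (simp add: vec_eq_iff forall_4 M v inner_diff_right inner_add_right axis_def)
    from inj0[OF this] show ?thesis by simp
  qed
  then have "dual_basis l n a b (D 1) (D 2) (D 3) (D 4)"
    unfolding dual_basis_def by (simp add: v axis_def)
  then show ?thesis by blast
qed

lemma matrix_inv_frame:
  assumes inv: "invertible (frame_matrix l n a b)" and d: "dual_basis l n a b Dl Dn Da Db"
  shows "matrix_inv (frame_matrix l n a b) $ i $ j = - (Dl $ i * Dn $ j) - Dn $ i * Dl $ j + Da $ i * Da $ j + Db $ i * Db $ j"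
proof -
  let ?G = "frame_matrix l n a b" and ?K = "frame_matrix Dl Dn Da Db"
  have "(?K ** ?G) *v t = t" for t
  proof -
    have "?K *v (?G *v t) = (l \<bullet> t) *\<^sub>R Dl + (n \<bullet> t) *\<^sub>R Dn + (a \<bullet> t) *\<^sub>R Da + (b \<bullet> t) *\<^sub>R Db"
      unfolding frame_matrix_apply using d
      by (simp add: dual_basis_def inner_add_right inner_diff_right inner_commute)
    also have "\<dots> = t" using d unfolding dual_basis_def by metis
    finally show ?thesis by (simp add: matrix_vector_mul_assoc)
  qed
  then have KG: "?K ** ?G = mat 1" by (simp add: matrix_eq)
  have "matrix_inv ?G = (?K ** ?G) ** matrix_inv ?G" using KG by simp
  also have "\<dots> = ?K" using matrix_inv(1)[OF inv] by (simp add: matrix_mul_assoc[symmetric])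
  finally show ?thesis by (simp add: frame_matrix_def)
qed

context spacetime_chart
begin

lemma ginv_frame:
  assumes "x \<in> U" "g x = frame_matrix l n a b" "dual_basis l n a b Dl Dn Da Db"
  shows "ginv g x i j = - (Dl $ i * Dn $ j) - Dn $ i * Dl $ j + Da $ i * Da $ j + Db $ i * Db $ j"
  using matrix_inv_frame[OF _ assms(3)] lorentzian_invertible[OF lorentz[OF assms(1)]] assms(2)
  by (simp add: ginv_def)

lemma ex_dual_at:
  assumes "x \<in> U" "g x = frame_matrix l n a b"
  obtains Dl Dn Da Db where "dual_basis l n a b Dl Dn Da Db"
  using ex_dual_basis[of l n a b] lorentzian_invertible[OF lorentz[OF assms(1)]] assms(2) by auto

lemma smooth_hodge:
  assumes A: "smooth_on U A"
  shows "smooth_on U (\<lambda>x. hodge_field g A x $ i $ j)"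
proof -
  have neg: "det (g x) < 0" if "x \<in> U" for x
    using orthonormal_basis[OF that] by blast
  have "smooth_on U (\<lambda>x. sqrt (- det (g x)))"
    by (intro smooth_on_sqrt smooth_on_minus smooth_on_det smooth_g_comp open_U) (simp add: neg)
  then have s: "smooth_on U (\<lambda>x. sqrt \<bar>det (g x)\<bar>)"
    by (subst smooth_on_cong[OF open_U, of _ "\<lambda>x. sqrt (- det (g x))"]) (auto simp: neg abs_of_neg)
  show ?thesis
    unfolding hodge_field_def hodge2_def vol_def vec_lambda_beta
    by (intro smooth_on_divide_const smooth_on_sum smooth_on_mult smooth_on_const smooth_ginv smooth_on_nth A s open_U)
qed

text \<open>Since \<open>l\<close> is null, \<open>a\<close> is unit and the two are orthogonal,
  contracting l wedge a with itself leaves only l tensor l. This expresses \<open>l\<close>, up to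
  sign, smoothly through the two-form.\<close>

lemma frame_square:
  assumes x: "x \<in> U" and fr: "g x = frame_matrix l n a b"
  shows "(\<Sum>k\<in>UNIV. \<Sum>m\<in>UNIV. ginv g x k m * (wedge l a $ i $ k * wedge l a $ j $ m)) = l $ i * l $ j"
proof -
  obtain Dl Dn Da Db where d: "dual_basis l n a b Dl Dn Da Db" using ex_dual_at[OF x fr] .
  let ?w = "wedge l a"
  have w: "(?w *v D) $ i = l $ i * (a \<bullet> D) - a $ i * (l \<bullet> D)" for D i
    by (simp add: matrix_vector_mult_def wedge_def inner_vec_def sum_4 algebra_simps)
  have "(\<Sum>k\<in>UNIV. \<Sum>m\<in>UNIV. ginv g x k m * (?w $ i $ k * ?w $ j $ m))
     = - ((?w *v Dl) $ i * (?w *v Dn) $ j) - (?w *v Dn) $ i * (?w *v Dl) $ j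
       + (?w *v Da) $ i * (?w *v Da) $ j + (?w *v Db) $ i * (?w *v Db) $ j"
    unfolding ginv_frame[OF x fr d] matrix_vector_mult_def vec_lambda_beta sum_product
    unfolding sum_negf[symmetric] sum.distrib[symmetric] sum_subtractf[symmetric]
    by (intro sum.cong refl) (simp add: algebra_simps)
  also have "\<dots> = l $ i * l $ j"
    unfolding w using d by (simp add: dual_basis_def)
  finally show ?thesis .
qed

text \<open>Real and imaginary part of the null condition for the self-dual form: both classical
  invariants of the field vanish.\<close>

lemma null_on_form_prod:
  assumes x: "x \<in> U" and "null_on U g A"
  shows "A x \<noteq> 0" "form_prod x (A x) (A x) = form_prod x (hodge_field g A x) (hodge_field g A x)"
    "form_prod x (A x) (hodge_field g A x) = 0"
proof -
  let ?F = "A x" and ?G = "hodge_field g A x"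
  show "A x \<noteq> 0" using assms by (simp add: null_on_def)
  obtain P \<sigma> where gi: "\<forall>a b. ginv g x a b = (\<Sum>i\<in>UNIV. minkowski $ i $ i * (column i P $ a * column i P $ b))"
    by (rule orthonormal_basis[OF x])
  have sym: "form_prod x ?G ?F = form_prod x ?F ?G"
    unfolding form_prod_basis[OF gi[rule_format]] by (simp add: mult.assoc mult.commute mult.left_commute)
  have prod_term: "complex_of_real h * ((complex_of_real F - \<i> * complex_of_real G) / complex_of_real (sqrt 2)) *
      ((complex_of_real F' - \<i> * complex_of_real G') / complex_of_real (sqrt 2))
      = Complex ((h * F * F' - h * G * G') / 2) (- (h * F * G' + h * G * F') / 2)" for h F G F' G'
  proof -
    have "complex_of_real (sqrt 2) * complex_of_real (sqrt 2) = 2"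
      by (simp flip: of_real_mult)
    moreover have "complex_of_real h * ((complex_of_real F - \<i> * complex_of_real G) / complex_of_real (sqrt 2)) *
      ((complex_of_real F' - \<i> * complex_of_real G') / complex_of_real (sqrt 2))
      = complex_of_real h * (complex_of_real F - \<i> * complex_of_real G) * (complex_of_real F' - \<i> * complex_of_real G') / (complex_of_real (sqrt 2) * complex_of_real (sqrt 2))"
      by simp
    ultimately show ?thesis
      by (simp add: complex_eq_iff algebra_simps)
  qed
  have 0: "(\<Sum>a\<in>UNIV. \<Sum>b\<in>UNIV. \<Sum>c\<in>UNIV. \<Sum>d\<in>UNIV. Complex ((ginv g x a c * ginv g x b d * ?F $ a $ b * ?F $ c $ d - ginv g x a c * ginv g x b d * ?G $ a $ b * ?G $ c $ d) / 2)
      (- (ginv g x a c * ginv g x b d * ?F $ a $ b * ?G $ c $ d + ginv g x a c * ginv g x b d * ?G $ a $ b * ?F $ c $ d) / 2)) = 0"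
    using assms unfolding null_on_def self_dual_form_def vec_lambda_beta prod_term by blast
  have "(form_prod x ?F ?F - form_prod x ?G ?G) / 2 = 0"
    using arg_cong[OF 0, of Re]
    unfolding Re_sum complex.sel sum_divide_distrib[symmetric] sum_subtractf form_prod_def by simp
  then show "form_prod x ?F ?F = form_prod x ?G ?G" by simp
  have "- (form_prod x ?F ?G + form_prod x ?G ?F) / 2 = 0"
    using arg_cong[OF 0, of Im]
    unfolding Im_sum complex.sel sum_divide_distrib[symmetric] sum_negf sum.distrib form_prod_def by simp
  then show "form_prod x ?F ?G = 0" using sym by simp
qed

text \<open>Among the frames for given \<open>F\<close> and \<open>G\<close>, null rotations reach
  one with the \<open>k\<close>-th components of \<open>a\<close> and \<open>b\<close> equal to
  zero. Then row \<open>k\<close> of \<open>F\<close>, \<open>G\<close> and \<open>g\<close>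
  determines \<open>a\<close>, \<open>b\<close> and \<open>n\<close> by division by the
  \<open>k\<close>-th component of \<open>l\<close>, which is the square root of \<open>T k\<close>.
  Smoothness can be read off from these formulas.\<close>

lemma adapted_frame:
  assumes x: "x \<in> U" and fr: "g x = frame_matrix l' n' a' b'" and k: "l' $ k > 0"
    and F: "F = wedge l' a'" and G: "G = - wedge l' b'"
    and l: "l = (\<chi> j. T j / sqrt (T k))" and T: "\<And>j. T j = l' $ k * l' $ j"
    and a: "a = (\<chi> j. F $ k $ j / sqrt (T k))" and b: "b = (\<chi> j. - (G $ k $ j) / sqrt (T k))"
    and n: "n = (\<chi> j. (- (g x $ k $ j) + g x $ k $ k / (2 * sqrt (T k)) * l $ j) / sqrt (T k))"
  shows "g x = frame_matrix l n a b" "F = wedge l a" "G = - wedge l b" "l $ k \<noteq> 0"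
proof -
  have s: "sqrt (T k) = l' $ k" using k by (simp add: T)
  have ll: "l = l'" using k unfolding l s by (simp add: T vec_eq_iff)
  \<comment> \<open>Parameters of the null rotation; \<open>m\<close> below is \<open>n'\<close>
    with the compensating terms that keep the metric unchanged.\<close>
  define \<alpha> \<beta> where "\<alpha> = a' $ k / l' $ k" "\<beta> = b' $ k / l' $ k"
  have aa: "a $ j = a' $ j - \<alpha> * l' $ j" and bb: "b $ j = b' $ j - \<beta> * l' $ j" for j
    using k unfolding a b s F G \<alpha>_\<beta>_def by (simp_all add: wedge_def field_simps)
  have ak: "a $ k = 0" "b $ k = 0" using k unfolding aa bb by (simp_all add: \<alpha>_\<beta>_def)
  define m where "m j = n' $ j - \<alpha> * a $ j - \<beta> * b $ j - (\<alpha>^2 + \<beta>^2) / 2 * l' $ j" for j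
  have gij: "g x $ i $ j = - (l' $ i * m j) - m i * l' $ j + a $ i * a $ j + b $ i * b $ j" for i j
    unfolding fr frame_matrix_def m_def aa bb by (simp add: algebra_simps power2_eq_square)
  have nm: "n $ j = m j" for j
    using k unfolding n s ll vec_lambda_beta gij[of k] ak by (simp add: field_simps)
  show "g x = frame_matrix l n a b"
    unfolding frame_matrix_def vec_eq_iff vec_lambda_beta gij nm ll by simp
  show "F = wedge l a" unfolding F ll by (simp add: vec_eq_iff wedge_def aa algebra_simps)
  show "G = - wedge l b" unfolding G ll by (simp add: vec_eq_iff wedge_def bb algebra_simps)
  show "l $ k \<noteq> 0" using k ll by simp
qed

text \<open>Pointwise frames exist by \<open>null_form_frame\<close>, but nothing relates them at
  neighbouring points. The tensor \<open>T\<close>, smooth and equal to l tensor l, selects the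
  component \<open>k\<close> and the neighbourhood on which \<open>adapted_frame\<close> gives one
  smooth frame.\<close>

lemma local_null_frame:
  assumes A: "two_form_on U A" and null: "null_on U g A" and p: "p \<in> U"
  obtains V l n a b k where "open V" "p \<in> V" "V \<subseteq> U"
    "smooth_on V l" "smooth_on V n" "smooth_on V a" "smooth_on V b"
    "\<forall>x\<in>V. g x = frame_matrix (l x) (n x) (a x) (b x) \<and> A x = wedge (l x) (a x) \<and>
       hodge_field g A x = - wedge (l x) (b x) \<and> l x $ k \<noteq> 0"
proof -
  have sA: "smooth_on U A" and anti: "\<And>x i j. x \<in> U \<Longrightarrow> A x $ i $ j = - A x $ j $ i"
    using A unfolding two_form_on_def by blast+
  have ex: "\<exists>l n a b. g x = frame_matrix l n a b \<and> A x = wedge l a \<and> hodge_field g A x = - wedge l b" if xU: "x \<in> U" for x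
  proof -
    note np = null_on_form_prod[OF xU null]
    obtain l n a b where "g x = (\<chi> i j. - (l $ i * n $ j) - n $ i * l $ j + a $ i * a $ j + b $ i * b $ j)"
      "A x = wedge l a" "hodge_field g A x = - wedge l b"
      by (rule null_form_frame[OF xU anti[OF xU] np(1) hodge_field_def np(2,3)])
    then show ?thesis unfolding frame_matrix_def by blast
  qed
  define T where "T x i j = (\<Sum>k\<in>UNIV. \<Sum>m\<in>UNIV. ginv g x k m * (A x $ i $ k * A x $ j $ m))" for x i j
  have sT: "smooth_on U (\<lambda>x. T x i j)" for i j
    unfolding T_def by (intro smooth_on_sum smooth_on_mult smooth_ginv smooth_on_nth sA open_U)
  have Tl: "T x i j = l $ i * l $ j" if "x \<in> U" "g x = frame_matrix l n a b" "A x = wedge l a" for x l n a b i j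
    using frame_square[OF that(1,2)] that(3) by (simp add: T_def)
  obtain k where k: "T p k k > 0"
  proof -
    obtain l n a b where f: "g p = frame_matrix l n a b" "A p = wedge l a" using ex[OF p] by blast
    have "l \<noteq> 0"
    proof
      assume "l = 0"
      then have "A p = 0" using f(2) by (simp add: wedge_def vec_eq_iff)
      then show False using null_on_form_prod[OF p null] by simp
    qed
    then obtain k where "l $ k \<noteq> 0" by (auto simp: vec_eq_iff)
    then have "T p k k > 0" using Tl[OF p f] by (simp add: zero_less_mult_iff) linarith
    then show ?thesis using that by blast
  qed
  define V where "V = U \<inter> (\<lambda>x. T x k k) -` {0<..}"
  have V: "open V" "p \<in> V" "V \<subseteq> U"
    using k p continuous_open_preimage[OF smooth_on_continuous[OF sT[of k k]] open_U, of "{0<..}"]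
    by (auto simp: V_def)
  have Tpos: "T x k k > 0" if "x \<in> V" for x using that by (simp add: V_def)
  define l where "l x = (\<chi> j. T x k j / sqrt (T x k k))" for x
  define a where "a x = (\<chi> j. A x $ k $ j / sqrt (T x k k))" for x
  define b where "b x = (\<chi> j. - (hodge_field g A x $ k $ j) / sqrt (T x k k))" for x
  define n where "n x = (\<chi> j. (- (g x $ k $ j) + g x $ k $ k / (2 * sqrt (T x k k)) * l x $ j) / sqrt (T x k k))" for x
  have sub: "smooth_on V f" if "smooth_on U f" for f :: "real^4 \<Rightarrow> real"
    using smooth_on_subset[OF that V(3)] .
  have sq: "smooth_on V (\<lambda>x. sqrt (T x k k))"
    by (rule smooth_on_sqrt[OF V(1) sub[OF sT] Tpos])
  have sq0: "sqrt (T x k k) \<noteq> 0" if "x \<in> V" for x using Tpos[OF that] by simp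
  have sAc: "smooth_on U (\<lambda>x. A x $ i $ j)" for i j by (intro smooth_on_nth open_U sA)
  have sl: "smooth_on V l" unfolding l_def
    by (intro smooth_on_vec_lambda V(1) smooth_on_divide[OF V(1) sub[OF sT] sq sq0])
  have sa: "smooth_on V a" unfolding a_def
    by (intro smooth_on_vec_lambda V(1) smooth_on_divide[OF V(1) sub[OF sAc] sq sq0])
  have sb: "smooth_on V b" unfolding b_def
    by (intro smooth_on_vec_lambda V(1) smooth_on_divide[OF V(1) smooth_on_minus[OF V(1) sub[OF smooth_hodge[OF sA]]] sq sq0])
  have sq2: "smooth_on V (\<lambda>x. 2 * sqrt (T x k k))" by (intro smooth_on_mult smooth_on_const V(1) sq)
  have sq20: "2 * sqrt (T x k k) \<noteq> 0" if "x \<in> V" for x using sq0[OF that] by simp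
  have sn: "smooth_on V n" unfolding n_def
    by (intro smooth_on_vec_lambda V(1) smooth_on_divide[OF V(1) _ sq sq0] smooth_on_add smooth_on_mult
        smooth_on_minus[OF V(1) sub[OF smooth_g_comp]] smooth_on_divide[OF V(1) sub[OF smooth_g_comp] sq2 sq20]
        smooth_on_nth sl)
  have fr: "g x = frame_matrix (l x) (n x) (a x) (b x) \<and> A x = wedge (l x) (a x) \<and>
       hodge_field g A x = - wedge (l x) (b x) \<and> l x $ k \<noteq> 0" if x: "x \<in> V" for x
  proof -
    have xU: "x \<in> U" using x V by auto
    obtain l' n' a' b' where f: "g x = frame_matrix l' n' a' b'" "A x = wedge l' a'" "hodge_field g A x = - wedge l' b'"
      using ex[OF xU] by blast
    \<comment> \<open>Reversing the signs of all four forms preserves the metric and both two-forms,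
      so the \<open>k\<close>-th component of \<open>l'\<close> may be taken positive.\<close>
    have "\<exists>l' n' a' b'. g x = frame_matrix l' n' a' b' \<and> A x = wedge l' a' \<and> hodge_field g A x = - wedge l' b' \<and> l' $ k > 0"
    proof (cases "l' $ k > 0")
      case True
      then show ?thesis using f by blast
    next
      case False
      have "l' $ k \<noteq> 0" using Tpos[OF x] Tl[OF xU f(1,2)] by auto
      then have "(- l') $ k > 0" using False by simp
      moreover have "g x = frame_matrix (- l') (- n') (- a') (- b')" "A x = wedge (- l') (- a')"
        "hodge_field g A x = - wedge (- l') (- b')"
        using f by (simp_all add: frame_matrix_def wedge_def)
      ultimately show ?thesis by blast
    qed
    then obtain l' n' a' b' where f: "g x = frame_matrix l' n' a' b'" "A x = wedge l' a'" "hodge_field g A x = - wedge l' b'" "l' $ k > 0"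
      by blast
    show ?thesis
      using adapted_frame[OF xU f(1) f(4) f(2,3) l_def[of x] Tl[OF xU f(1,2)] a_def[of x] b_def[of x] n_def[of x]] by blast
  qed
  show ?thesis using that[OF V sl sn sa sb, of k] fr by blast
qed

end

section \<open>Conformal Killing-Yano structure equations\<close>

lemma linear_eq_on_axes:
  fixes f h :: "real^'n \<Rightarrow> real"
  assumes "linear f" "linear h" "\<And>i. f (axis i 1) = h (axis i 1)"
  shows "f v = h v"
proof -
  have "f v = (\<chi> i. f (axis i 1)) \<bullet> v" by (rule linear_functional_eq_inner[OF assms(1), symmetric])
  also have "\<dots> = h v" unfolding assms(3) by (rule linear_functional_eq_inner[OF assms(2)])
  finally show ?thesis .
qed

lemma pd_complex:
  assumes "f differentiable (at x)" "h differentiable (at x)"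
  shows "pd c (\<lambda>y. (complex_of_real (f y) - \<i> * complex_of_real (h y)) / k) x
    = (complex_of_real (pd c f x) - \<i> * complex_of_real (pd c h x)) / k"
proof -
  have f: "(f has_derivative fd f x) (at x)" and h: "(h has_derivative fd h x) (at x)"
    using assms by (simp_all flip: frechet_derivative_works)
  have "((\<lambda>y. (complex_of_real (f y) - \<i> * complex_of_real (h y)) / k) has_derivative
    (\<lambda>w. (complex_of_real (fd f x w) - \<i> * complex_of_real (fd h x w)) / k)) (at x)"
    by (rule bounded_linear.has_derivative[OF bounded_linear_divide])
      (intro has_derivative_diff has_derivative_mult_right bounded_linear.has_derivative[OF bounded_linear_of_real] f h)
  from fd_eqI[OF this] show ?thesis by (simp add: pd_def)
qed

lemma nabla2_self_dual:
  assumes "\<And>i j. (\<lambda>y. A y $ i $ j) differentiable (at x)" "\<And>i j. (\<lambda>y. hodge_field g A y $ i $ j) differentiable (at x)"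
  shows "nabla2 g (self_dual_form g A) x c i j =
    (complex_of_real (nabla2 g A x c i j) - \<i> * complex_of_real (nabla2 g (hodge_field g A) x c i j)) / complex_of_real (sqrt 2)"
proof -
  let ?k = "complex_of_real (sqrt 2)"
  have s: "(\<Sum>d\<in>UNIV. \<gamma> d *\<^sub>R ((complex_of_real (F d) - \<i> * complex_of_real (G d)) / ?k)) =
      (complex_of_real (\<Sum>d\<in>UNIV. \<gamma> d * F d) - \<i> * complex_of_real (\<Sum>d\<in>UNIV. \<gamma> d * G d)) / ?k"
    for \<gamma> F G :: "4 \<Rightarrow> real"
    by (simp add: sum_4 scaleR_conv_of_real add_divide_distrib diff_divide_distrib algebra_simps)
  show ?thesis
    unfolding nabla2_def self_dual_form_def vec_lambda_beta pd_complex[OF assms] s real_scaleR_def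
    by (simp add: diff_divide_distrib add_divide_distrib algebra_simps)
qed

lemma codifferential_self_dual:
  assumes "\<And>i j. (\<lambda>y. A y $ i $ j) differentiable (at x)" "\<And>i j. (\<lambda>y. hodge_field g A y $ i $ j) differentiable (at x)"
  shows "codifferential g (self_dual_form g A) x $ e =
    (complex_of_real (codifferential g A x $ e) - \<i> * complex_of_real (codifferential g (hodge_field g A) x $ e)) / complex_of_real (sqrt 2)"
  unfolding codifferential_def vec_lambda_beta nabla2_self_dual[OF assms]
  by (simp add: sum_4 scaleR_conv_of_real add_divide_distrib diff_divide_distrib algebra_simps)

lemma nabla2_wedge:
  fixes \<omega> \<tau> :: "real^4 \<Rightarrow> real^4"
  assumes S: "open S" "x \<in> S" "\<And>y. y \<in> S \<Longrightarrow> F y = wedge (\<omega> y) (\<tau> y)"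
    and d: "\<omega> differentiable (at x)" "\<tau> differentiable (at x)"
  shows "nabla2 g F x c i j = nabla1 g \<omega> x c i * \<tau> x $ j + \<omega> x $ i * nabla1 g \<tau> x c j
      - nabla1 g \<omega> x c j * \<tau> x $ i - \<omega> x $ j * nabla1 g \<tau> x c i"
proof -
  have h: "((\<lambda>y. \<omega> y $ i) has_derivative (\<lambda>w. fd (\<lambda>y. \<omega> y $ i) x w)) (at x)"
    "((\<lambda>y. \<tau> y $ i) has_derivative (\<lambda>w. fd (\<lambda>y. \<tau> y $ i) x w)) (at x)" for i
    unfolding fd_nth[OF d(1)] fd_nth[OF d(2)]
    by (rule bounded_linear.has_derivative[OF bounded_linear_vec_nth], use d in \<open>simp flip: frechet_derivative_works\<close>)+
  have hd: "((\<lambda>y. \<omega> y $ i * \<tau> y $ j - \<omega> y $ j * \<tau> y $ i) has_derivative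
      (\<lambda>w. (\<omega> x $ i * fd (\<lambda>y. \<tau> y $ j) x w + fd (\<lambda>y. \<omega> y $ i) x w * \<tau> x $ j)
         - (\<omega> x $ j * fd (\<lambda>y. \<tau> y $ i) x w + fd (\<lambda>y. \<omega> y $ j) x w * \<tau> x $ i))) (at x)"
    by (rule has_derivative_diff[OF has_derivative_mult[OF h(1) h(2)] has_derivative_mult[OF h(1) h(2)]])
  have "fd (\<lambda>y. F y $ i $ j) x = fd (\<lambda>y. \<omega> y $ i * \<tau> y $ j - \<omega> y $ j * \<tau> y $ i) x"
    by (rule fd_cong[OF S(1,2)]) (use S(3) hd in \<open>auto simp: wedge_def differentiable_def\<close>)
  then have "pd c (\<lambda>y. F y $ i $ j) x = \<omega> x $ i * pd c (\<lambda>y. \<tau> y $ j) x + pd c (\<lambda>y. \<omega> y $ i) x * \<tau> x $ j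
     - (\<omega> x $ j * pd c (\<lambda>y. \<tau> y $ i) x + pd c (\<lambda>y. \<omega> y $ j) x * \<tau> x $ i)"
    using fd_eqI[OF hd] by (simp add: pd_def)
  then show ?thesis
    unfolding nabla2_def nabla1_def S(3)[OF S(2)] by (simp add: wedge_def sum_4 algebra_simps)
qed

section \<open>The conformal Killing-Yano equation in a null frame\<close>

context spacetime_chart
begin

text \<open>Real part of the complex equation. The codifferential of the self-dual form is (Z1 - i
  Z2)/sqrt 2, so its product with (G - i vol)/2 contributes Z1 against G minus Z2 against the volume
  element; the factor 2 cancels the denominator.\<close>

lemma cky_real:
  assumes cky: "conformal_killing_yano_on U g A" and x: "x \<in> U"
  shows "3 * nabla2 g A x b c d = (\<Sum>a\<in>UNIV. (\<Sum>e\<in>UNIV. ginv g x a e * codifferential g A x $ e) * Gmetric g x a b c d)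
    - (\<Sum>a\<in>UNIV. (\<Sum>e\<in>UNIV. ginv g x a e * codifferential g (hodge_field g A) x $ e) * vol g x a b c d)"
proof -
  have sA: "smooth_on U A" using cky by (simp add: conformal_killing_yano_on_def two_form_on_def)
  have d: "(\<lambda>y. A y $ i $ j) differentiable (at x)" "(\<lambda>y. hodge_field g A y $ i $ j) differentiable (at x)" for i j
    using smooth_on_differentiable[OF smooth_on_nth[OF open_U smooth_on_nth[OF open_U sA]] x]
      smooth_on_differentiable[OF smooth_hodge[OF sA] x] by auto
  let ?k = "complex_of_real (sqrt 2)"
  let ?Z1 = "codifferential g A x" and ?Z2 = "codifferential g (hodge_field g A) x"
  have "3 * nabla2 g (self_dual_form g A) x b c d =
        2 * (\<Sum>a\<in>UNIV. \<Sum>e\<in>UNIV. complex_of_real (ginv g x a e) *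
               codifferential g (self_dual_form g A) x $ e * self_dual_G g x a b c d)"
    using cky x by (simp add: conformal_killing_yano_on_def)
  then have "3 * (complex_of_real (nabla2 g A x b c d) - \<i> * complex_of_real (nabla2 g (hodge_field g A) x b c d)) / ?k =
     2 * (\<Sum>a\<in>UNIV. \<Sum>e\<in>UNIV. complex_of_real (ginv g x a e) *
        (complex_of_real (?Z1 $ e) - \<i> * complex_of_real (?Z2 $ e)) *
        ((complex_of_real (Gmetric g x a b c d) - \<i> * complex_of_real (vol g x a b c d)) / 2)) / ?k"
    unfolding nabla2_self_dual[OF d] codifferential_self_dual[OF d] self_dual_G_def
    by (simp add: sum_divide_distrib sum_distrib_left)
  then have "3 * (complex_of_real (nabla2 g A x b c d) - \<i> * complex_of_real (nabla2 g (hodge_field g A) x b c d)) =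
     2 * (\<Sum>a\<in>UNIV. \<Sum>e\<in>UNIV. complex_of_real (ginv g x a e) *
        (complex_of_real (?Z1 $ e) - \<i> * complex_of_real (?Z2 $ e)) *
        ((complex_of_real (Gmetric g x a b c d) - \<i> * complex_of_real (vol g x a b c d)) / 2))"
    by simp
  from arg_cong[OF this, of Re]
  have "3 * nabla2 g A x b c d = 2 * (\<Sum>a\<in>UNIV. \<Sum>e\<in>UNIV. (ginv g x a e * ?Z1 $ e * Gmetric g x a b c d - ginv g x a e * ?Z2 $ e * vol g x a b c d) / 2)"
    by (simp add: Re_sum algebra_simps diff_divide_distrib)
  also have "\<dots> = (\<Sum>a\<in>UNIV. \<Sum>e\<in>UNIV. ginv g x a e * ?Z1 $ e * Gmetric g x a b c d - ginv g x a e * ?Z2 $ e * vol g x a b c d)"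
    by (simp add: sum_divide_distrib[symmetric])
  finally show ?thesis by (simp add: sum_subtractf sum_distrib_right)
qed

lemma lower_raise:
  assumes "x \<in> U"
  shows "(\<Sum>a\<in>UNIV. (\<Sum>e\<in>UNIV. ginv g x a e * Z $ e) * g x $ a $ c) = Z $ c"
proof -
  have "(\<Sum>a\<in>UNIV. (\<Sum>e\<in>UNIV. ginv g x a e * Z $ e) * g x $ a $ c) = (g x *v (matrix_inv (g x) *v Z)) $ c"
    using g_sym[OF assms, of _ c] by (simp add: matrix_vector_mult_def ginv_def mult.commute)
  then show ?thesis
    using matrix_inv(1)[OF lorentzian_invertible[OF lorentz[OF assms]]] by (simp add: matrix_vector_mul_assoc)
qed

lemma gmet_axis: "gmet g x (axis b 1) (axis d 1) = g x $ b $ d"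
  by (simp add: gmet_def inner_axis inner_commute[of "axis b 1"] matrix_vector_mult_basis column_def)

end

locale null_frame = spacetime_chart +
  fixes V :: "(real^4) set" and l n a b :: "real^4 \<Rightarrow> real^4"
  assumes V: "open V" "V \<subseteq> U"
    and smooth_frame: "smooth_on V l" "smooth_on V n" "smooth_on V a" "smooth_on V b"
    and frame: "x \<in> V \<Longrightarrow> g x = frame_matrix (l x) (n x) (a x) (b x)"
begin

lemma gmet_frame:
  "x \<in> V \<Longrightarrow> gmet g x s t = - ((l x \<bullet> s) * (n x \<bullet> t)) - (n x \<bullet> s) * (l x \<bullet> t) + (a x \<bullet> s) * (a x \<bullet> t) + (b x \<bullet> s) * (b x \<bullet> t)"
  by (simp add: gmet_def frame frame_matrix_bilinear)

lemma ex_dual: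
  assumes "x \<in> V"
  obtains Dl Dn Da Db where "dual_basis (l x) (n x) (a x) (b x) Dl Dn Da Db"
  using ex_dual_at[OF _ frame[OF assms]] assms V by blast

lemma differentiable_frame:
  assumes "x \<in> V"
  shows "l differentiable (at x)" "n differentiable (at x)" "a differentiable (at x)" "b differentiable (at x)"
  using smooth_on_differentiable[OF _ assms] smooth_frame by auto

lemma has_derivative_frame:
  assumes "x \<in> V"
  shows "(l has_derivative fd l x) (at x)" "(n has_derivative fd n x) (at x)"
    "(a has_derivative fd a x) (at x)" "(b has_derivative fd b x) (at x)"
  using smooth_on_has_derivative[OF _ assms] smooth_frame by auto

text \<open>The covariant derivative of the metric vanishes, written for the metric as a quadratic
  expression in the coframe. Evaluated on pairs of dual vectors it gives the skewness of the
  connection forms in \<open>frame_skew\<close>, leaving six of them.\<close>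

lemma frame_compat:
  assumes "x \<in> V"
  shows "- (cd g l x v s * (n x \<bullet> t)) - (l x \<bullet> s) * cd g n x v t - cd g n x v s * (l x \<bullet> t) - (n x \<bullet> s) * cd g l x v t
    + cd g a x v s * (a x \<bullet> t) + (a x \<bullet> s) * cd g a x v t + cd g b x v s * (b x \<bullet> t) + (b x \<bullet> s) * cd g b x v t = 0"
proof -
  have xU: "x \<in> U" using assms V by auto
  note h = has_derivative_frame[OF assms, THEN has_derivative_inner_left]
  note ln = has_derivative_mult[OF h(1)[of s] h(2)[of t]] and nl = has_derivative_mult[OF h(2)[of s] h(1)[of t]]
    and aa = has_derivative_mult[OF h(3)[of s] h(3)[of t]] and bb = has_derivative_mult[OF h(4)[of s] h(4)[of t]]
  have hd: "((\<lambda>y. - ((l y \<bullet> s) * (n y \<bullet> t)) - (n y \<bullet> s) * (l y \<bullet> t) + (a y \<bullet> s) * (a y \<bullet> t) + (b y \<bullet> s) * (b y \<bullet> t)) has_derivative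
    (\<lambda>v. - ((l x \<bullet> s) * (fd n x v \<bullet> t) + (fd l x v \<bullet> s) * (n x \<bullet> t)) - ((n x \<bullet> s) * (fd l x v \<bullet> t) + (fd n x v \<bullet> s) * (l x \<bullet> t))
     + ((a x \<bullet> s) * (fd a x v \<bullet> t) + (fd a x v \<bullet> s) * (a x \<bullet> t)) + ((b x \<bullet> s) * (fd b x v \<bullet> t) + (fd b x v \<bullet> s) * (b x \<bullet> t)))) (at x)"
    by (rule has_derivative_add[OF has_derivative_add[OF has_derivative_diff[OF has_derivative_minus[OF ln] nl] aa] bb])
  have "fd (\<lambda>y. gmet g y s t) x = fd (\<lambda>y. - ((l y \<bullet> s) * (n y \<bullet> t)) - (n y \<bullet> s) * (l y \<bullet> t) + (a y \<bullet> s) * (a y \<bullet> t) + (b y \<bullet> s) * (b y \<bullet> t)) x"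
    by (rule fd_cong[OF V(1) assms gmet_frame]) (use hd in \<open>auto simp: differentiable_def\<close>)
  then show ?thesis
    using fd_gmet_gam[OF xU, of s t v] fd_eqI[OF hd, of v]
    unfolding gmet_frame[OF assms] by (simp add: cd_def algebra_simps)
qed

lemma cd_expand:
  assumes d: "dual_basis (l x) (n x) (a x) (b x) Dl Dn Da Db"
  shows "cd g \<omega> x v t = (l x \<bullet> t) * cd g \<omega> x v Dl + (n x \<bullet> t) * cd g \<omega> x v Dn + (a x \<bullet> t) * cd g \<omega> x v Da + (b x \<bullet> t) * cd g \<omega> x v Db"
proof -
  have "cd g \<omega> x v t = cd g \<omega> x v ((l x \<bullet> t) *\<^sub>R Dl + (n x \<bullet> t) *\<^sub>R Dn + (a x \<bullet> t) *\<^sub>R Da + (b x \<bullet> t) *\<^sub>R Db)"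
    by (simp only: dual_basis_expand[OF d])
  then show ?thesis by (simp only: cd_add2 cd_scale2)
qed

lemma frame_skew:
  assumes x: "x \<in> V" and d: "dual_basis (l x) (n x) (a x) (b x) Dl Dn Da Db"
  shows "cd g l x v Dn = 0" "cd g n x v Dl = 0" "cd g n x v Dn = - cd g l x v Dl" "cd g a x v Da = 0" "cd g b x v Db = 0"
    "cd g b x v Da = - cd g a x v Db" "cd g l x v Da = cd g a x v Dn" "cd g l x v Db = cd g b x v Dn"
    "cd g n x v Da = cd g a x v Dl" "cd g n x v Db = cd g b x v Dl"
proof -
  show "cd g l x v Dn = 0"
    using frame_compat[OF x, of v Dn Dn] by (simp add: dual_basisD[OF d])
  show "cd g n x v Dl = 0"
    using frame_compat[OF x, of v Dl Dl] by (simp add: dual_basisD[OF d])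
  show "cd g n x v Dn = - cd g l x v Dl"
    using frame_compat[OF x, of v Dl Dn] by (simp add: dual_basisD[OF d])
  show "cd g a x v Da = 0"
    using frame_compat[OF x, of v Da Da] by (simp add: dual_basisD[OF d])
  show "cd g b x v Db = 0"
    using frame_compat[OF x, of v Db Db] by (simp add: dual_basisD[OF d])
  show "cd g b x v Da = - cd g a x v Db"
    using frame_compat[OF x, of v Da Db] by (simp add: dual_basisD[OF d])
  show "cd g l x v Da = cd g a x v Dn"
    using frame_compat[OF x, of v Da Dn] by (simp add: dual_basisD[OF d])
  show "cd g l x v Db = cd g b x v Dn"
    using frame_compat[OF x, of v Db Dn] by (simp add: dual_basisD[OF d])
  show "cd g n x v Da = cd g a x v Dl"
    using frame_compat[OF x, of v Da Dl] by (simp add: dual_basisD[OF d])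
  show "cd g n x v Db = cd g b x v Dl"
    using frame_compat[OF x, of v Db Dl] by (simp add: dual_basisD[OF d])
qed

end

lemma linear_functional_sum:
  fixes f :: "real^'n \<Rightarrow> real"
  assumes "linear f"
  shows "f v = (\<Sum>i\<in>UNIV. v $ i * f (axis i 1))"
  using linear_functional_eq_inner[OF assms, of v] by (simp add: inner_vec_def mult.commute)

context null_frame
begin

lemma VU: "x \<in> V \<Longrightarrow> x \<in> U"
  using V by auto

lemma raise_dual:
  assumes x: "x \<in> V" and d: "dual_basis (l x) (n x) (a x) (b x) Dl Dn Da Db"
  shows "(\<chi> i. \<Sum>e\<in>UNIV. ginv g x i e * Z $ e) = - (Z \<bullet> Dn) *\<^sub>R Dl - (Z \<bullet> Dl) *\<^sub>R Dn + (Z \<bullet> Da) *\<^sub>R Da + (Z \<bullet> Db) *\<^sub>R Db"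
  unfolding ginv_frame[OF VU[OF x] frame[OF x] d]
  by (simp add: vec_eq_iff inner_vec_def sum_4 algebra_simps)

lemma hodge2_wedge:
  assumes raise: "\<And>c. (\<Sum>e\<in>UNIV. ginv g x c e * \<omega> $ e) = p $ c" "\<And>c. (\<Sum>e\<in>UNIV. ginv g x c e * \<tau> $ e) = q $ c"
  shows "s \<bullet> (hodge2 g x (wedge \<omega> \<tau>) *v t) = vol4 g x s t p q"
proof -
  define u where "u k = (if k = (0::nat) then p else q)" for k
  define \<phi> where "\<phi> i j = (if i = (0::nat) \<and> j = (1::nat) then 1 else if i = 1 \<and> j = 0 then -1 else 0 :: real)" for i j
  have "(\<Sum>e\<in>UNIV. \<Sum>f\<in>UNIV. ginv g x c e * ginv g x k f * wedge \<omega> \<tau> $ e $ f)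
      = (\<Sum>i\<in>{0,1}. \<Sum>j\<in>{0,1}. \<phi> i j * (u i $ c * u j $ k))" for c k
  proof -
    have "(\<Sum>e\<in>UNIV. \<Sum>f\<in>UNIV. ginv g x c e * ginv g x k f * wedge \<omega> \<tau> $ e $ f)
      = (\<Sum>e\<in>UNIV. ginv g x c e * \<omega> $ e) * (\<Sum>f\<in>UNIV. ginv g x k f * \<tau> $ f)
       - (\<Sum>e\<in>UNIV. ginv g x c e * \<tau> $ e) * (\<Sum>f\<in>UNIV. ginv g x k f * \<omega> $ f)"
      unfolding sum_product sum_subtractf[symmetric] by (intro sum.cong refl) (simp add: wedge_def algebra_simps)
    also have "\<dots> = (\<Sum>i\<in>{0,1}. \<Sum>j\<in>{0,1}. \<phi> i j * (u i $ c * u j $ k))"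
      unfolding raise by (simp add: \<phi>_def u_def)
    finally show ?thesis .
  qed
  from hodge2_bilinear[OF this, of s t] show ?thesis
    using vol4_swap(3)[of g x s t q p] by (simp add: \<phi>_def u_def)
qed

lemma raise_frame:
  assumes x: "x \<in> V" and d: "dual_basis (l x) (n x) (a x) (b x) Dl Dn Da Db"
  shows "(\<Sum>e\<in>UNIV. ginv g x c e * l x $ e) = (- Dn) $ c" "(\<Sum>e\<in>UNIV. ginv g x c e * a x $ e) = Da $ c"
    "(\<Sum>e\<in>UNIV. ginv g x c e * b x $ e) = Db $ c"
  using raise_dual[OF x d, of "l x"] raise_dual[OF x d, of "a x"] raise_dual[OF x d, of "b x"] dual_basisD[OF d]
  by (simp_all add: vec_eq_iff)

lemma vol4_minus: "vol4 g x s t (- u) w = - vol4 g x s t u w"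
  using vol4_linear(7)[of g x s t "-1" u w] by simp

text \<open>The sign in the dual of l wedge a decides the orientation of the frame; no separate
  choice is made.\<close>

lemma vol4_dual_basis:
  assumes x: "x \<in> V" and d: "dual_basis (l x) (n x) (a x) (b x) Dl Dn Da Db"
    and hodge: "hodge2 g x (wedge (l x) (a x)) = - wedge (l x) (b x)"
  shows "vol4 g x Dl Dn Da Db = 1"
proof -
  have "Dl \<bullet> (- wedge (l x) (b x) *v Db) = - vol4 g x Dl Db Dn Da"
    using hodge2_wedge[OF raise_frame(1,2)[OF x d], of Dl Db] unfolding hodge vol4_minus .
  then have "- 1 = - vol4 g x Dl Db Dn Da"
    by (simp add: minus_matrix_vector_mult wedge_bilinear dual_basisD[OF d])
  then show ?thesis
    using vol4_perms[of g x, where s = Dl and t = Dn and u = Da and w = Db] by simp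
qed

text \<open>The equation for index triples is extended to arbitrary vectors one slot at a time, so
  that it can be evaluated on dual vectors. The left side is three times the derivative of l wedge
  a.\<close>

lemma cky_trilinear:
  assumes cky: "conformal_killing_yano_on U g A" and A: "\<And>y. y \<in> V \<Longrightarrow> A y = wedge (l y) (a y)" and x: "x \<in> V"
    and Z: "Z1 = codifferential g A x" "Z2 = codifferential g (hodge_field g A) x"
  shows "3 * (cd g l x v s * (a x \<bullet> t) + (l x \<bullet> s) * cd g a x v t - cd g l x v t * (a x \<bullet> s) - (l x \<bullet> t) * cd g a x v s)
    = (Z1 \<bullet> s) * gmet g x v t - (Z1 \<bullet> t) * gmet g x v s - vol4 g x (\<chi> i. \<Sum>e\<in>UNIV. ginv g x i e * Z2 $ e) v s t"
    (is "?L v s t = ?R v s t")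
proof -
  note xU = VU[OF x] and df = differentiable_frame[OF x]
  define R2 where "R2 = (\<chi> i. \<Sum>e\<in>UNIV. ginv g x i e * Z2 $ e)"
  have ax: "?L (axis i 1) (axis j 1) (axis k 1) = ?R (axis i 1) (axis j 1) (axis k 1)" for i j k
  proof -
    have n: "nabla2 g A x i j k = cd g l x (axis i 1) (axis j 1) * a x $ k + l x $ j * cd g a x (axis i 1) (axis k 1)
        - cd g l x (axis i 1) (axis k 1) * a x $ j - l x $ k * cd g a x (axis i 1) (axis j 1)"
      using nabla2_wedge[OF V(1) x A df(1,3), of g i j k] nabla1_cd[OF df(1)] nabla1_cd[OF df(3)] by simp
    have G: "(\<Sum>c\<in>UNIV. (\<Sum>e\<in>UNIV. ginv g x c e * Z1 $ e) * Gmetric g x c i j k) = Z1 $ j * g x $ i $ k - Z1 $ k * g x $ i $ j"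
    proof -
      have "(\<Sum>c\<in>UNIV. (\<Sum>e\<in>UNIV. ginv g x c e * Z1 $ e) * Gmetric g x c i j k)
        = (\<Sum>c\<in>UNIV. (\<Sum>e\<in>UNIV. ginv g x c e * Z1 $ e) * g x $ c $ j) * g x $ i $ k
         - (\<Sum>c\<in>UNIV. (\<Sum>e\<in>UNIV. ginv g x c e * Z1 $ e) * g x $ c $ k) * g x $ i $ j"
        unfolding sum_distrib_right[of _ UNIV "g x $ i $ k"] sum_distrib_right[of _ UNIV "g x $ i $ j"] sum_subtractf[symmetric]
        by (intro sum.cong refl) (simp add: Gmetric_def right_diff_distrib mult.assoc)
      then show ?thesis unfolding lower_raise[OF xU] .
    qed
    have vl: "(\<Sum>c\<in>UNIV. (\<Sum>e\<in>UNIV. ginv g x c e * Z2 $ e) * vol g x c i j k) = vol4 g x R2 (axis i 1) (axis j 1) (axis k 1)"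
    proof -
      have lin: "linear (\<lambda>s. vol4 g x s (axis i 1) (axis j 1) (axis k 1))" by (rule linearI) (simp_all add: vol4_linear)
      show ?thesis by (subst linear_functional_sum[OF lin]) (simp add: R2_def vol_vol4)
    qed
    show ?thesis
      using cky_real[OF cky xU, of i j k] unfolding Z[symmetric] n G vl R2_def[symmetric]
      by (simp add: inner_axis gmet_axis)
  qed
  have g1: "gmet g x (s + s') t = gmet g x s t + gmet g x s' t" "gmet g x (r *\<^sub>R s) t = r * gmet g x s t"
    "gmet g x t (s + s') = gmet g x t s + gmet g x t s'" "gmet g x t (r *\<^sub>R s) = r * gmet g x t s" for s s' t r
    using linear_add[OF bilinear_gmet(1)] linear_add[OF bilinear_gmet(2)] linear_scale[OF bilinear_gmet(1)] linear_scale[OF bilinear_gmet(2)]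
    by auto
  note lin = cd_add2 cd_scale2 g1 vol4_linear inner_add_right cd_add1[OF df(1)] cd_add1[OF df(3)]
  have 1: "?L (axis i 1) (axis j 1) t = ?R (axis i 1) (axis j 1) t" for i j t
    by (rule linear_eq_on_axes[where f = "?L (axis i 1) (axis j 1)"]; (rule ax)?; rule linearI; simp add: lin algebra_simps)
  have 2: "?L (axis i 1) s t = ?R (axis i 1) s t" for i s t
    by (rule linear_eq_on_axes[where f = "\<lambda>s. ?L (axis i 1) s t"]; (rule 1)?; rule linearI; simp add: lin algebra_simps)
  show ?thesis
    by (rule linear_eq_on_axes[where f = "\<lambda>v. ?L v s t"]; (rule 2)?; rule linearI; simp add: lin algebra_simps)
qed

text \<open>Connection forms under the CKY equation with \<open>Z1 = z1 l\<close> and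
  \<open>Z2 = z2 l\<close>. The unknown forms \<alpha> and \<gamma> are the \<open>l\<close>-parts
  of the derivatives of \<open>a\<close> and \<open>b\<close>, which the equation does not see
  because the two-forms only involve \<open>a\<close> and \<open>b\<close> modulo
  \<open>l\<close>.\<close>

definition structure_at :: "real \<Rightarrow> real \<Rightarrow> real^4 \<Rightarrow> bool" where
  "structure_at z1 z2 x \<longleftrightarrow>
    (\<forall>v t. cd g l x v t = ((z1 * (a x \<bullet> v) - z2 * (b x \<bullet> v)) * (l x \<bullet> t) - (l x \<bullet> v) * (z1 * (a x \<bullet> t) - z2 * (b x \<bullet> t))) / 3) \<and>
    (\<exists>\<alpha>. \<forall>v t. cd g a x v t = (- z1 * (l x \<bullet> v) * (n x \<bullet> t) + (z1 * (b x \<bullet> v) + z2 * (a x \<bullet> v)) * (b x \<bullet> t)) / 3 + \<alpha> v * (l x \<bullet> t)) \<and>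
    (\<exists>\<gamma>. \<forall>v t. cd g b x v t = (z2 * (l x \<bullet> v) * (n x \<bullet> t) - (z1 * (b x \<bullet> v) + z2 * (a x \<bullet> v)) * (a x \<bullet> t)) / 3 + \<gamma> v * (l x \<bullet> t))"

text \<open>The equation has more components than there are connection forms. Some frame triples
  have a left side that vanishes by skewness and so constrain \<open>Z1\<close> and
  \<open>Z2\<close>; the others yield the connection forms one by one.\<close>

lemma cky_structure:
  assumes cky: "conformal_killing_yano_on U g A" and A: "\<And>y. y \<in> V \<Longrightarrow> A y = wedge (l y) (a y)"
    and hodge: "\<And>y. y \<in> V \<Longrightarrow> hodge_field g A y = - wedge (l y) (b y)" and x: "x \<in> V"
    and Z: "Z1 = codifferential g A x" "Z2 = codifferential g (hodge_field g A) x"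
    and wedge: "wedge Z1 Z2 = 0"
  shows "\<exists>z1 z2. Z1 = z1 *\<^sub>R l x \<and> Z2 = z2 *\<^sub>R l x \<and> structure_at z1 z2 x"
proof -
  obtain Dl Dn Da Db where d: "dual_basis (l x) (n x) (a x) (b x) Dl Dn Da Db" using ex_dual[OF x] .
  note D = dual_basisD[OF d] and sk = frame_skew[OF x d]
  note T = cky_trilinear[OF cky A x Z, unfolded raise_dual[OF x d]]
  have v1: "vol4 g x Dl Dn Da Db = 1"
    using vol4_dual_basis[OF x d] hodge[OF x] A[OF x] by (simp add: hodge_field_def)
  note perms = vol4_perms[of g x, where s = Dl and t = Dn and u = Da and w = Db, unfolded v1]
  have sub: "vol4 g x (s - t) u v w = vol4 g x s u v w - vol4 g x t u v w" "vol4 g x (- s) u v w = - vol4 g x s u v w" for s t u v w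
    using vol4_linear(1)[of g x s "-1 *\<^sub>R t" u v w] vol4_linear(5)[of g x "-1" _ u v w] by simp_all
  note vs = vol4_linear sub vol4_same perms v1
  note G = gmet_frame[OF x]
  have e1: "Z1 \<bullet> Dn = 0" using T[of Da Dn Da] by (simp add: sk D G vs)
  have e2: "Z2 \<bullet> Dn = 0" using T[of Db Dn Da] by (simp add: sk D G vs)
  \<comment> \<open>This and the next relation make the determinant of the (Da, Db) components of
    \<open>Z1\<close> and \<open>Z2\<close> minus a sum of two squares. The wedge condition
    annihilates that determinant, hence all four components.\<close>
  have e3: "Z1 \<bullet> Da = - (Z2 \<bullet> Db)" using T[of Dl Dn Da] by (simp add: sk D G vs e1 e2)
  have e4: "Z1 \<bullet> Db = Z2 \<bullet> Da" using T[of Dl Dn Db] by (simp add: sk D G vs e1 e2)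
  have "(Z1 \<bullet> Da) * (Z2 \<bullet> Db) - (Z1 \<bullet> Db) * (Z2 \<bullet> Da) = 0"
    using wedge_bilinear[of Da Z1 Z2 Db] wedge by simp
  then have "(Z2 \<bullet> Db)^2 + (Z2 \<bullet> Da)^2 = 0" unfolding e3 e4 power2_eq_square by linarith
  then have e5: "Z2 \<bullet> Db = 0" "Z2 \<bullet> Da = 0" by (simp_all add: sum_power2_eq_zero_iff)
  define z1 z2 where "z1 = Z1 \<bullet> Dl" "z2 = Z2 \<bullet> Dl"
  have Zt: "Z1 \<bullet> t = z1 * (l x \<bullet> t)" "Z2 \<bullet> t = z2 * (l x \<bullet> t)" for t
  proof -
    have "Z \<bullet> t = Z \<bullet> ((l x \<bullet> t) *\<^sub>R Dl + (n x \<bullet> t) *\<^sub>R Dn + (a x \<bullet> t) *\<^sub>R Da + (b x \<bullet> t) *\<^sub>R Db)" for Z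
      by (simp only: dual_basis_expand[OF d])
    from this[of Z1] this[of Z2] show "Z1 \<bullet> t = z1 * (l x \<bullet> t)" "Z2 \<bullet> t = z2 * (l x \<bullet> t)"
      by (simp_all add: inner_add_right z1_z2_def e1 e2 e3 e4 e5)
  qed
  have Z1: "Z1 = z1 *\<^sub>R l x" and Z2: "Z2 = z2 *\<^sub>R l x"
    by (rule iffD1[OF vector_eq_rdot], simp add: Zt)+
  have vexp: "vol4 g x Dn v s t = (l x \<bullet> v) * vol4 g x Dn Dl s t + (a x \<bullet> v) * vol4 g x Dn Da s t + (b x \<bullet> v) * vol4 g x Dn Db s t" for v s t
  proof -
    have "vol4 g x Dn v s t = vol4 g x Dn ((l x \<bullet> v) *\<^sub>R Dl + (n x \<bullet> v) *\<^sub>R Dn + (a x \<bullet> v) *\<^sub>R Da + (b x \<bullet> v) *\<^sub>R Db) s t"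
      by (simp only: dual_basis_expand[OF d])
    then show ?thesis by (simp add: vol4_linear vol4_same)
  qed
  have T': "3 * (cd g l x v s * (a x \<bullet> t) + (l x \<bullet> s) * cd g a x v t - cd g l x v t * (a x \<bullet> s) - (l x \<bullet> t) * cd g a x v s)
    = z1 * (l x \<bullet> s) * gmet g x v t - z1 * (l x \<bullet> t) * gmet g x v s
      + z2 * ((l x \<bullet> v) * vol4 g x Dn Dl s t + (a x \<bullet> v) * vol4 g x Dn Da s t + (b x \<bullet> v) * vol4 g x Dn Db s t)" for v s t
    using T[of v s t] unfolding Zt by (simp add: D vs vexp[symmetric])
  \<comment> \<open>Together with \<open>frame_skew\<close>, the four families \<open>q\<close>,
    \<open>r\<close>, \<open>p\<close>, \<open>f\<close> fix all connection forms except those of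
    \<open>a\<close> and \<open>b\<close> on \<open>Dl\<close>.\<close>
  have q: "3 * cd g a x v Dn = - z1 * (l x \<bullet> v)" for v
    using T'[of v Dl Dn] by (simp add: sk D G vs)
  have r: "3 * cd g b x v Dn = z2 * (l x \<bullet> v)" for v
    using T'[of v Da Db] by (simp add: sk D G vs)
  have p: "3 * cd g l x v Dl = z1 * (a x \<bullet> v) - z2 * (b x \<bullet> v)" for v
    using T'[of v Dl Da] by (simp add: sk D G vs)
  have f: "3 * cd g a x v Db = z1 * (b x \<bullet> v) + z2 * (a x \<bullet> v)" for v
    using T'[of v Dl Db] by (simp add: sk D G vs)
  have s1: "cd g l x v t = ((z1 * (a x \<bullet> v) - z2 * (b x \<bullet> v)) * (l x \<bullet> t) - (l x \<bullet> v) * (z1 * (a x \<bullet> t) - z2 * (b x \<bullet> t))) / 3" for v t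
  proof -
    have "3 * cd g l x v t = (l x \<bullet> t) * (3 * cd g l x v Dl) + (a x \<bullet> t) * (3 * cd g a x v Dn) + (b x \<bullet> t) * (3 * cd g b x v Dn)"
      using cd_expand[OF d, of l v t] by (simp add: sk)
    then show ?thesis unfolding p q r by (simp add: field_simps)
  qed
  have s2: "cd g a x v t = (- z1 * (l x \<bullet> v) * (n x \<bullet> t) + (z1 * (b x \<bullet> v) + z2 * (a x \<bullet> v)) * (b x \<bullet> t)) / 3 + cd g a x v Dl * (l x \<bullet> t)" for v t
  proof -
    have "3 * cd g a x v t = (n x \<bullet> t) * (3 * cd g a x v Dn) + (b x \<bullet> t) * (3 * cd g a x v Db) + 3 * (cd g a x v Dl * (l x \<bullet> t))"
      using cd_expand[OF d, of a v t] by (simp add: sk)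
    then show ?thesis unfolding q f by (simp add: field_simps)
  qed
  have s3: "cd g b x v t = (z2 * (l x \<bullet> v) * (n x \<bullet> t) - (z1 * (b x \<bullet> v) + z2 * (a x \<bullet> v)) * (a x \<bullet> t)) / 3 + cd g b x v Dl * (l x \<bullet> t)" for v t
  proof -
    have "3 * cd g b x v t = (n x \<bullet> t) * (3 * cd g b x v Dn) - (a x \<bullet> t) * (3 * cd g a x v Db) + 3 * (cd g b x v Dl * (l x \<bullet> t))"
      using cd_expand[OF d, of b v t] by (simp add: sk)
    then show ?thesis unfolding r f by (simp add: field_simps)
  qed
  have "structure_at z1 z2 x"
    unfolding structure_at_def
    by (rule conjI, intro allI, rule s1, rule conjI, rule exI[of _ "\<lambda>v. cd g a x v Dl"], intro allI, rule s2,
        rule exI[of _ "\<lambda>v. cd g b x v Dl"], intro allI, rule s3)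
  then show ?thesis using Z1 Z2 by blast
qed

text \<open>As the derivative of \<open>l\<close> is skew, the Killing equation for z l reduces to
  the vanishing symmetric product of dz and \<open>l\<close>. Two insertions of \<open>Dl\<close>
  give dz(Dl) = 0, and then one insertion gives dz = 0.\<close>

lemma killing_multiple_const:
  assumes x: "x \<in> V" and Z: "killing_on U g Z" "\<And>y. y \<in> V \<Longrightarrow> Z y = z y *\<^sub>R l y" and z: "smooth_on V z"
    and skew: "\<And>v t. cd g l x v t = - cd g l x t v"
  shows "fd z x v = 0"
proof -
  have hz: "(z has_derivative fd z x) (at x)" by (rule smooth_on_has_derivative[OF z x])
  have h: "((\<lambda>y. z y *\<^sub>R l y) has_derivative (\<lambda>v. z x *\<^sub>R fd l x v + fd z x v *\<^sub>R l x)) (at x)"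
    by (rule has_derivative_scaleR[OF hz has_derivative_frame(1)[OF x]])
  have hZ: "(Z has_derivative (\<lambda>v. z x *\<^sub>R fd l x v + fd z x v *\<^sub>R l x)) (at x)"
    by (rule has_derivative_transform_within_open[OF h V(1) x]) (simp add: Z(2))
  have dZ: "Z differentiable (at x)" using hZ by (auto simp: differentiable_def)
  have c: "cd g Z x v t = fd z x v * (l x \<bullet> t) + z x * cd g l x v t" for v t
    using fd_eqI[OF hZ] Z(2)[OF x] by (simp add: cd_def inner_add_left algebra_simps)
  have ax: "fd z x (axis i 1) * (l x \<bullet> axis j 1) = - (fd z x (axis j 1) * (l x \<bullet> axis i 1))" for i j
  proof -
    have "nabla1 g Z x i j + nabla1 g Z x j i = 0" using Z(1) VU[OF x] by (simp add: killing_on_def)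
    then have "fd z x (axis i 1) * (l x \<bullet> axis j 1) + fd z x (axis j 1) * (l x \<bullet> axis i 1) = 0"
      unfolding nabla1_cd[OF dZ] c using skew[of "axis i 1" "axis j 1"] by simp
    then show ?thesis by simp
  qed
  note lz = has_derivative_linear[OF hz]
  note lin = linear_add[OF lz] linear_scale[OF lz] inner_add_right
  have 1: "fd z x v * (l x \<bullet> axis j 1) = - (fd z x (axis j 1) * (l x \<bullet> v))" for v j
    by (rule linear_eq_on_axes[where f = "\<lambda>v. fd z x v * (l x \<bullet> axis j 1)"]; (rule ax)?; rule linearI; simp add: lin algebra_simps)
  have 2: "fd z x v * (l x \<bullet> t) = - (fd z x t * (l x \<bullet> v))" for v t
    by (rule linear_eq_on_axes[where f = "\<lambda>t. fd z x v * (l x \<bullet> t)"]; (rule 1)?; rule linearI; simp add: lin algebra_simps)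
  obtain Dl Dn Da Db where d: "dual_basis (l x) (n x) (a x) (b x) Dl Dn Da Db" using ex_dual[OF x] .
  have "fd z x Dl = 0" using 2[of Dl Dl] by (simp add: dual_basisD[OF d])
  then show ?thesis using 2[of v Dl] by (simp add: dual_basisD[OF d])
qed

end

section \<open>Ricci and scalar curvature from frame components\<close>

context null_frame
begin

definition ric :: "real^4 \<Rightarrow> real^4 \<Rightarrow> real^4 \<Rightarrow> real" where
  "ric x s w = (\<Sum>i\<in>UNIV. curv g x (axis i 1) w s $ i)"

lemma ricci_ric: "x \<in> U \<Longrightarrow> ricci g x i j = ric x (axis i 1) (axis j 1)"
  by (simp add: ricci_def ric_def riemann_up_curv)

lemma linear_ric1: "x \<in> U \<Longrightarrow> linear (\<lambda>s. ric x s w)"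
  unfolding ric_def
  using linear_add[OF linear_curv3] linear_scale[OF linear_curv3]
  by (intro linearI) (simp_all add: sum.distrib sum_distrib_left)

lemma linear_ric2: "x \<in> U \<Longrightarrow> linear (\<lambda>w. ric x s w)"
  unfolding ric_def
  using linear_add[OF linear_curv2] linear_scale[OF linear_curv2]
  by (intro linearI) (simp_all add: sum.distrib sum_distrib_left)

lemma ric_frame:
  assumes x: "x \<in> V" and d: "dual_basis (l x) (n x) (a x) (b x) Dl Dn Da Db"
  shows "ric x s w = l x \<bullet> curv g x Dl w s + n x \<bullet> curv g x Dn w s + a x \<bullet> curv g x Da w s + b x \<bullet> curv g x Db w s"
proof -
  note lin = linear_add[OF linear_curv1[OF VU[OF x]]] linear_scale[OF linear_curv1[OF VU[OF x]]]
  have "curv g x (axis i 1) w s $ i = l x $ i * curv g x Dl w s $ i + n x $ i * curv g x Dn w s $ i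
      + a x $ i * curv g x Da w s $ i + b x $ i * curv g x Db w s $ i" for i
  proof -
    have "curv g x (axis i 1) w s = curv g x (l x $ i *\<^sub>R Dl + n x $ i *\<^sub>R Dn + a x $ i *\<^sub>R Da + b x $ i *\<^sub>R Db) w s"
      using dual_basis_expand[OF d, of "axis i 1"] by (simp add: inner_axis)
    then show ?thesis by (simp add: lin)
  qed
  then show ?thesis by (simp add: ric_def inner_vec_def sum.distrib)
qed

lemma scalar_curvature_frame:
  assumes x: "x \<in> V" and d: "dual_basis (l x) (n x) (a x) (b x) Dl Dn Da Db"
  shows "scalar_curvature g x = - ric x Dl Dn - ric x Dn Dl + ric x Da Da + ric x Db Db"
proof -
  have e: "ric x s w = (\<Sum>i\<in>UNIV. \<Sum>j\<in>UNIV. s $ i * w $ j * ric x (axis i 1) (axis j 1))" for s w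
    by (subst linear_functional_sum[OF linear_ric1[OF VU[OF x]]], subst linear_functional_sum[OF linear_ric2[OF VU[OF x]]])
      (simp add: sum_distrib_left mult.assoc)
  show ?thesis
    unfolding scalar_curvature_def ricci_ric[OF VU[OF x]] ginv_frame[OF VU[OF x] frame[OF x] d]
      e[of Dl Dn] e[of Dn Dl] e[of Da Da] e[of Db Db] sum_negf[symmetric] sum.distrib[symmetric] sum_subtractf[symmetric]
    by (intro sum.cong refl) (simp add: algebra_simps)
qed

lemma lower_dual:
  assumes x: "x \<in> V" and d: "dual_basis (l x) (n x) (a x) (b x) Dl Dn Da Db"
  shows "l x \<bullet> w = - gmet g x Dn w" "n x \<bullet> w = - gmet g x Dl w" "a x \<bullet> w = gmet g x Da w" "b x \<bullet> w = gmet g x Db w"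
  by (simp_all add: gmet_frame[OF x] dual_basisD[OF d])

text \<open>The hypotheses are those components of a tensor of constant curvature -k that enter the
  trace; every other component occurring there reduces to them by the symmetries of the curvature.
  The factor is the 12 = 4 * 3 of constant curvature in dimension four.\<close>

lemma scalar_curvature_from_components:
  assumes x: "x \<in> V" and d: "dual_basis (l x) (n x) (a x) (b x) Dl Dn Da Db"
    and L: "\<And>v w t. l x \<bullet> curv g x v w t = k * ((l x \<bullet> w) * gmet g x v t - (l x \<bullet> v) * gmet g x w t)"
    and ab: "a x \<bullet> curv g x Da Db Db = - k"
  shows "scalar_curvature g x = - 12 * k"
proof -
  note xU = VU[OF x] and D = dual_basisD[OF d]
  define R where "R s t v w = gmet g x s (curv g x v w t)" for s t v w
  note G = gmet_frame[OF x]
  have G0: "linear (gmet g x s)" for s by (rule bilinear_gmet)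
  have c0: "curv g x v v t = 0" for v t by (simp add: curv_def)
  have R0: "R s t v v = 0" for s t v by (simp add: R_def c0 linear_0[OF G0])
  have Rp: "R s t v w = R v w s t" for s t v w unfolding R_def by (rule gmet_curv_pair[OF xU])
  have Ra: "R s t v w = - R t s v w" for s t v w
    using gmet_curv_antisym[OF xU, of v w s t] gmet_sym[OF xU, of "curv g x v w s" t] unfolding R_def by simp
  have Rb: "R s t v w = - R s t w v" for s t v w
    using Rp[of s t v w] Ra[of v w s t] Rp[of w v s t] by simp
  have Rn: "R Dn t v w = - k * ((l x \<bullet> w) * gmet g x v t - (l x \<bullet> v) * gmet g x w t)" for t v w
    using L[of v w t] lower_dual(1)[OF x d, of "curv g x v w t"] by (simp add: R_def)
  have Rab: "R Da Db Da Db = - k" using ab lower_dual(3)[OF x d] by (simp add: R_def)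
  have ric: "ric x s w = - R Dn s Dl w - R Dl s Dn w + R Da s Da w + R Db s Db w" for s w
    unfolding ric_frame[OF x d] lower_dual[OF x d] by (simp add: R_def)
  have "ric x Dl Dn = 3 * k"
  proof -
    have "R Da Dl Da Dn = - R Dn Da Da Dl" "R Db Dl Db Dn = - R Dn Db Db Dl"
      using Rp[of Da Dl Da Dn] Ra[of Dn Da Da Dl] Rp[of Db Dl Db Dn] Ra[of Dn Db Db Dl] by simp_all
    then show ?thesis unfolding ric by (simp add: R0 Rn G D)
  qed
  moreover have "ric x Dn Dl = 3 * k"
  proof -
    have "R Dl Dn Dn Dl = - R Dn Dl Dn Dl" "R Da Dn Da Dl = - R Dn Da Da Dl" "R Db Dn Db Dl = - R Dn Db Db Dl"
      using Ra[of Dl Dn Dn Dl] Ra[of Da Dn Da Dl] Ra[of Db Dn Db Dl] by simp_all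
    then show ?thesis unfolding ric by (simp add: R0 Rn G D)
  qed
  moreover have "ric x Da Da = - 3 * k"
  proof -
    have "R Dl Da Dn Da = R Dn Da Dl Da" "R Db Da Db Da = R Da Db Da Db"
      using Rp[of Dl Da Dn Da] Ra[of Db Da Db Da] Rb[of Da Db Db Da] by simp_all
    then show ?thesis unfolding ric by (simp add: R0 Rn Rab G D)
  qed
  moreover have "ric x Db Db = - 3 * k"
  proof -
    have "R Dl Db Dn Db = R Dn Db Dl Db" using Rp[of Dl Db Dn Db] by simp
    then show ?thesis unfolding ric by (simp add: R0 Rn Rab G D)
  qed
  ultimately show ?thesis unfolding scalar_curvature_frame[OF x d] by simp
qed

text \<open>The Ricci identity for \<open>l\<close> gives the components with a leg along
  \<open>l\<close>, and the one for \<open>a\<close> the remaining component in the (Da, Db) plane,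
  both with k = (z1^2 + z2^2)/9. The 1/9 is the square of the 1/3 in the structure equations, and
  -12/9 = -4/3. Derivatives of \<open>z1\<close> and \<open>z2\<close> are absent because these are
  constant to first order at \<open>x\<close>.\<close>

lemma structure_curvature:
  assumes st: "\<And>y. y \<in> V \<Longrightarrow> structure_at (z1 y) (z2 y) y" and x: "x \<in> V"
    and z: "smooth_on V z1" "smooth_on V z2" "\<And>v. fd z1 x v = 0" "\<And>v. fd z2 x v = 0"
  shows "scalar_curvature g x = - (4 / 3) * ((z1 x)^2 + (z2 x)^2)"
proof -
  obtain Dl Dn Da Db where d: "dual_basis (l x) (n x) (a x) (b x) Dl Dn Da Db" using ex_dual[OF x] .
  note D = dual_basisD[OF d] and sk = frame_skew[OF x d]
  define u1 u2 where "u1 = z1 x" "u2 = z2 x"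
  have "fd z1 x = (\<lambda>v. 0)" "fd z2 x = (\<lambda>v. 0)" using z(3,4) by blast+
  then have hz: "(z1 has_derivative (\<lambda>v. 0)) (at x)" "(z2 has_derivative (\<lambda>v. 0)) (at x)"
    using smooth_on_has_derivative[OF z(1) x] smooth_on_has_derivative[OF z(2) x] by (simp_all only:)
  note hf = has_derivative_frame[OF x]
  have hin: "((\<lambda>y. l y \<bullet> s) has_derivative (\<lambda>v. fd l x v \<bullet> s)) (at x)" "((\<lambda>y. n y \<bullet> s) has_derivative (\<lambda>v. fd n x v \<bullet> s)) (at x)"
    "((\<lambda>y. a y \<bullet> s) has_derivative (\<lambda>v. fd a x v \<bullet> s)) (at x)" "((\<lambda>y. b y \<bullet> s) has_derivative (\<lambda>v. fd b x v \<bullet> s)) (at x)" for s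
    using hf[THEN has_derivative_inner_left] by blast+
  obtain \<alpha> \<gamma> where s: "\<And>v t. cd g l x v t = ((u1 * (a x \<bullet> v) - u2 * (b x \<bullet> v)) * (l x \<bullet> t) - (l x \<bullet> v) * (u1 * (a x \<bullet> t) - u2 * (b x \<bullet> t))) / 3"
    "\<And>v t. cd g a x v t = (- u1 * (l x \<bullet> v) * (n x \<bullet> t) + (u1 * (b x \<bullet> v) + u2 * (a x \<bullet> v)) * (b x \<bullet> t)) / 3 + \<alpha> v * (l x \<bullet> t)"
    "\<And>v t. cd g b x v t = (u2 * (l x \<bullet> v) * (n x \<bullet> t) - (u1 * (b x \<bullet> v) + u2 * (a x \<bullet> v)) * (a x \<bullet> t)) / 3 + \<gamma> v * (l x \<bullet> t)"
    using st[OF x] unfolding structure_at_def u1_u2_def by metis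
  have tor: "fd l x v \<bullet> w - fd l x w \<bullet> v = cd g l x v w - cd g l x w v"
    "fd a x v \<bullet> w - fd a x w \<bullet> v = cd g a x v w - cd g a x w v"
    "fd b x v \<bullet> w - fd b x w \<bullet> v = cd g b x v w - cd g b x w v" for v w
    using cd_torsion[OF VU[OF x]] by simp_all
  have fdc: "fd l x v \<bullet> t = cd g l x v t + l x \<bullet> gam g x v t" "fd a x v \<bullet> t = cd g a x v t + a x \<bullet> gam g x v t"
    "fd b x v \<bullet> t = cd g b x v t + b x \<bullet> gam g x v t" "fd n x v \<bullet> t = cd g n x v t + n x \<bullet> gam g x v t" for v t
    by (simp_all add: cd_def)
  have c2l: "cd2 g l x v w t = ((u1 * (fd a x v \<bullet> w) - u2 * (fd b x v \<bullet> w)) * (l x \<bullet> t) + (u1 * (a x \<bullet> w) - u2 * (b x \<bullet> w)) * cd g l x v t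
     - (fd l x v \<bullet> w) * (u1 * (a x \<bullet> t) - u2 * (b x \<bullet> t)) - (l x \<bullet> w) * (u1 * cd g a x v t - u2 * cd g b x v t)) / 3" for v w t
  proof -
    note m1 = has_derivative_mult[OF hz(1) hin(3)] and m2 = has_derivative_mult[OF hz(2) hin(4)]
    note m = bounded_linear.has_derivative[OF bounded_linear_divide[of 3] has_derivative_diff[OF
        has_derivative_mult[OF has_derivative_diff[OF m1[of w] m2[of w]] hin(1)[of t]]
        has_derivative_mult[OF hin(1)[of w] has_derivative_diff[OF m1[of t] m2[of t]]]]]
    have "fd (\<lambda>y. cd g l y w t) x = fd (\<lambda>y. ((z1 y * (a y \<bullet> w) - z2 y * (b y \<bullet> w)) * (l y \<bullet> t) - (l y \<bullet> w) * (z1 y * (a y \<bullet> t) - z2 y * (b y \<bullet> t))) / 3) x"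
      by (rule fd_cong[OF V(1) x]) (use st m in \<open>auto simp: structure_at_def differentiable_def\<close>)
    then show ?thesis
      unfolding cd2_def fd_eqI[OF m] s(1)[of w] using fdc(1)[of v t] fdc(2)[of v t] fdc(3)[of v t]
      by (simp add: u1_u2_def field_simps)
  qed
  have L: "l x \<bullet> curv g x v w t = (u1^2 + u2^2) / 9 * ((l x \<bullet> w) * gmet g x v t - (l x \<bullet> v) * gmet g x w t)" for v w t
  proof -
    have "l x \<bullet> curv g x v w t = - (cd2 g l x v w t - cd2 g l x w v t)"
      using ricci_identity[OF V x smooth_frame(1), of v w t] by simp
    also have "\<dots> = - ((u1 * (fd a x v \<bullet> w - fd a x w \<bullet> v) - u2 * (fd b x v \<bullet> w - fd b x w \<bullet> v)) * (l x \<bullet> t)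
       + (u1 * (a x \<bullet> w) - u2 * (b x \<bullet> w)) * cd g l x v t - (u1 * (a x \<bullet> v) - u2 * (b x \<bullet> v)) * cd g l x w t
     - (fd l x v \<bullet> w - fd l x w \<bullet> v) * (u1 * (a x \<bullet> t) - u2 * (b x \<bullet> t))
     - (l x \<bullet> w) * (u1 * cd g a x v t - u2 * cd g b x v t) + (l x \<bullet> v) * (u1 * cd g a x w t - u2 * cd g b x w t)) / 3"
      unfolding c2l by (simp add: field_simps)
    also have "\<dots> = (u1^2 + u2^2) / 9 * ((l x \<bullet> w) * gmet g x v t - (l x \<bullet> v) * gmet g x w t)"
      unfolding tor s gmet_frame[OF x] by (simp add: field_simps power2_eq_square)
    finally show ?thesis .
  qed
  have ab: "a x \<bullet> curv g x Da Db Db = - ((u1^2 + u2^2) / 9)"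
  proof -
    define V' where "V' = V \<inter> (\<lambda>y. l y \<bullet> Dl) -` (- {0})"
    have cl: "continuous_on V (\<lambda>y. l y \<bullet> Dl)"
      by (intro smooth_on_continuous smooth_on_inner V smooth_frame smooth_on_const)
    have V': "open V'" "x \<in> V'" "V' \<subseteq> V"
      unfolding V'_def using continuous_open_preimage[OF cl V(1), of "- {0}"] x D by auto
    define F where "F w t y = (- z1 y * (l y \<bullet> w) * (n y \<bullet> t) + (z1 y * (b y \<bullet> w) + z2 y * (a y \<bullet> w)) * (b y \<bullet> t)) / 3" for w t y
    define H where "H w y = (cd g a y w Dl - F w Dl y) / (l y \<bullet> Dl)" for w y
    have eq: "cd g a y w t = F w t y + H w y * (l y \<bullet> t)" if "y \<in> V'" for y w t
    proof -
      have yV: "y \<in> V" using that V'(3) by blast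
      have "\<exists>\<alpha>. \<forall>v t. cd g a y v t = F v t y + \<alpha> v * (l y \<bullet> t)"
        using conjunct1[OF conjunct2[OF st[OF yV, unfolded structure_at_def]]] unfolding F_def .
      then obtain \<alpha>' where "\<forall>v t. cd g a y v t = F v t y + \<alpha>' v * (l y \<bullet> t)" by blast
      note \<alpha>' = this[rule_format]
      have "l y \<bullet> Dl \<noteq> 0" using that by (simp add: V'_def)
      then have "H w y = \<alpha>' w" unfolding H_def \<alpha>' by simp
      then show ?thesis using \<alpha>' by simp
    qed
    have hF: "(F w t has_derivative (\<lambda>v. (- u1 * (fd l x v \<bullet> w) * (n x \<bullet> t) - u1 * (l x \<bullet> w) * (fd n x v \<bullet> t)
        + (u1 * (fd b x v \<bullet> w) + u2 * (fd a x v \<bullet> w)) * (b x \<bullet> t) + (u1 * (b x \<bullet> w) + u2 * (a x \<bullet> w)) * (fd b x v \<bullet> t)) / 3)) (at x)" for w t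
    proof -
      note m = bounded_linear.has_derivative[OF bounded_linear_divide[of 3] has_derivative_add[OF
          has_derivative_mult[OF has_derivative_mult[OF has_derivative_minus[OF hz(1)] hin(1)[of w]] hin(2)[of t]]
          has_derivative_mult[OF has_derivative_add[OF has_derivative_mult[OF hz(1) hin(4)[of w]] has_derivative_mult[OF hz(2) hin(3)[of w]]] hin(4)[of t]]]]
      show ?thesis unfolding F_def[abs_def]
        by (rule has_derivative_eq_rhs[OF m]) (auto simp: u1_u2_def field_simps)
    qed
    have hcd: "((\<lambda>y. cd g a y w Dl) has_derivative fd (\<lambda>y. cd g a y w Dl) x) (at x)" for w
      by (rule smooth_on_has_derivative[OF smooth_cd[OF V smooth_frame(3)] x])
    have "H w differentiable (at x)" for w
      unfolding H_def using hcd[of w] hF[of w Dl] hin(1)[of Dl] D(1)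
      by (intro differentiable_divide differentiable_diff) (auto simp: differentiable_def)
    then have hH: "(H w has_derivative fd (H w) x) (at x)" for w
      by (simp flip: frechet_derivative_works)
    have c2a: "cd2 g a x v w t = (- u1 * (fd l x v \<bullet> w) * (n x \<bullet> t) - u1 * (l x \<bullet> w) * cd g n x v t
        + (u1 * (fd b x v \<bullet> w) + u2 * (fd a x v \<bullet> w)) * (b x \<bullet> t) + (u1 * (b x \<bullet> w) + u2 * (a x \<bullet> w)) * cd g b x v t) / 3
        + fd (H w) x v * (l x \<bullet> t) + H w x * cd g l x v t" for v w t
    proof -
      note m = has_derivative_add[OF hF[of w t] has_derivative_mult[OF hH[of w] hin(1)[of t]]]
      have "fd (\<lambda>y. cd g a y w t) x = fd (\<lambda>y. F w t y + H w y * (l y \<bullet> t)) x"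
        by (rule fd_cong[OF V'(1,2) eq]) (use m in \<open>auto simp: differentiable_def\<close>)
      then have e: "fd (\<lambda>y. cd g a y w t) x v = fd (\<lambda>y. F w t y + H w y * (l y \<bullet> t)) x v" by (rule fun_cong)
      have gF: "F w s x = (- u1 * (l x \<bullet> w) * (n x \<bullet> s) + (u1 * (b x \<bullet> w) + u2 * (a x \<bullet> w)) * (b x \<bullet> s)) / 3" for s
        by (simp add: F_def u1_u2_def)
      show ?thesis
        unfolding cd2_def e fd_eqI[OF m] eq[OF V'(2), of w "gam g x v t"] gF
        using fdc(1)[of v t] fdc(3)[of v t] fdc(4)[of v t]
        by (simp add: field_simps)
    qed
    have "a x \<bullet> curv g x Da Db Db = - (cd2 g a x Da Db Db - cd2 g a x Db Da Db)"
      using ricci_identity[OF V x smooth_frame(3), of Da Db Db] by simp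
    \<comment> \<open>All terms with \<open>H\<close> disappear: \<open>l\<close> vanishes on
      \<open>Db\<close>, and so does its derivative on the pairs formed from \<open>Da\<close> and
      \<open>Db\<close>.\<close>
    also have "\<dots> = - (u1 * (fd b x Da \<bullet> Db - fd b x Db \<bullet> Da) + u2 * (fd a x Da \<bullet> Db - fd a x Db \<bullet> Da)) / 3"
      unfolding c2a by (simp add: D sk s(1) field_simps)
    also have "\<dots> = - ((u1^2 + u2^2) / 9)"
      unfolding tor s by (simp add: D field_simps power2_eq_square)
    finally show ?thesis .
  qed
  show ?thesis
    using scalar_curvature_from_components[OF x d L ab] unfolding u1_u2_def by linarith
qed

end

section \<open>Curvature of pp-waves\<close>

lemma hodge2_linear: "hodge2 g x (c *\<^sub>R F + k *\<^sub>R G) = c *\<^sub>R hodge2 g x F + k *\<^sub>R hodge2 g x G"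
  by (simp add: vec_eq_iff hodge2_def algebra_simps sum.distrib sum_distrib_left add_divide_distrib sum_divide_distrib)

lemma bilinear_form_axis: "axis i 1 \<bullet> (M *v axis j 1) = M $ i $ j" for M :: "real^'n^'n"
  by (simp add: inner_axis' matrix_vector_mult_basis column_def)

context null_frame
begin

lemma riemann_gmet:
  assumes "x \<in> U"
  shows "riemann g x i j k m = gmet g x (axis i 1) (curv g x (axis k 1) (axis m 1) (axis j 1))"
  by (simp add: riemann_def riemann_up_curv[OF assms] gmet_def inner_axis' matrix_vector_mult_def)

text \<open>In Lorentzian signature the Hodge dual squares to -1 on two-forms; for the plane spanned
  by l wedge a and l wedge b this is checked directly on the oriented dual basis.\<close>

lemma hodge2_wedge_lb:
  assumes x: "x \<in> V" and hodge: "hodge2 g x (wedge (l x) (a x)) = - wedge (l x) (b x)"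
  shows "hodge2 g x (wedge (l x) (b x)) = wedge (l x) (a x)"
proof -
  obtain Dl Dn Da Db where d: "dual_basis (l x) (n x) (a x) (b x) Dl Dn Da Db" using ex_dual[OF x] .
  note v1 = vol4_dual_basis[OF x d hodge]
  note perms = vol4_perms[of g x, where s = Dl and t = Dn and u = Da and w = Db, unfolded v1]
  have "s \<bullet> (hodge2 g x (wedge (l x) (b x)) *v t) = s \<bullet> (wedge (l x) (a x) *v t)" for s t
  proof -
    let ?e = "\<lambda>t. (l x \<bullet> t) *\<^sub>R Dl + (n x \<bullet> t) *\<^sub>R Dn + (a x \<bullet> t) *\<^sub>R Da + (b x \<bullet> t) *\<^sub>R Db"
    have "s \<bullet> (hodge2 g x (wedge (l x) (b x)) *v t) = - vol4 g x s t Dn Db"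
      using hodge2_wedge[OF raise_frame(1,3)[OF x d], of s t] unfolding vol4_minus .
    also have "\<dots> = - vol4 g x (?e s) (?e t) Dn Db" by (simp only: dual_basis_expand[OF d])
    also have "\<dots> = s \<bullet> (wedge (l x) (a x) *v t)"
      by (simp add: vol4_linear vol4_same perms v1 wedge_bilinear algebra_simps)
    finally show ?thesis .
  qed
  then have "hodge2 g x (wedge (l x) (b x)) $ i $ j = wedge (l x) (a x) $ i $ j" for i j
    unfolding bilinear_form_axis[symmetric] by blast
  then show ?thesis by (simp add: vec_eq_iff)
qed

text \<open>With a parallel \<open>l\<close> and derivatives of \<open>a\<close>, \<open>b\<close>
  proportional to l tensor l, the Ricci identity involves only the first derivatives of the
  coefficients \<open>s\<close> and \<open>r\<close>. The common coefficient \<open>sb\<close> in ds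
  and dr expresses the symmetry of the transverse second derivatives of the profile.\<close>

lemma pp_curvature:
  assumes pp: "\<And>y v t. y \<in> V \<Longrightarrow> cd g l y v t = 0"
    "\<And>y v t. y \<in> V \<Longrightarrow> cd g a y v t = s y * (l y \<bullet> v) * (l y \<bullet> t)"
    "\<And>y v t. y \<in> V \<Longrightarrow> cd g b y v t = r y * (l y \<bullet> v) * (l y \<bullet> t)"
    "\<And>y v t. y \<in> V \<Longrightarrow> cd g n y v t = (l y \<bullet> v) * (s y * (a y \<bullet> t) + r y * (b y \<bullet> t))"
    and sm: "smooth_on V s" "smooth_on V r" and x: "x \<in> V"
    and ds: "\<And>w. fd s x w = sl * (l x \<bullet> w) + sa * (a x \<bullet> w) + sb * (b x \<bullet> w)"
    and dr: "\<And>w. fd r x w = rl * (l x \<bullet> w) + sb * (a x \<bullet> w) + rb * (b x \<bullet> w)"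
  shows "l x \<bullet> curv g x v w t = 0"
    "a x \<bullet> curv g x v w t = - (fd s x v * (l x \<bullet> w) - fd s x w * (l x \<bullet> v)) * (l x \<bullet> t)"
    "b x \<bullet> curv g x v w t = - (fd r x v * (l x \<bullet> w) - fd r x w * (l x \<bullet> v)) * (l x \<bullet> t)"
    "n x \<bullet> curv g x v w t = - (fd s x v * (l x \<bullet> w) - fd s x w * (l x \<bullet> v)) * (a x \<bullet> t)
       - (fd r x v * (l x \<bullet> w) - fd r x w * (l x \<bullet> v)) * (b x \<bullet> t)"
proof -
  note hf = has_derivative_frame[OF x]
  have hin: "((\<lambda>y. l y \<bullet> q) has_derivative (\<lambda>v. fd l x v \<bullet> q)) (at x)" "((\<lambda>y. n y \<bullet> q) has_derivative (\<lambda>v. fd n x v \<bullet> q)) (at x)"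
    "((\<lambda>y. a y \<bullet> q) has_derivative (\<lambda>v. fd a x v \<bullet> q)) (at x)" "((\<lambda>y. b y \<bullet> q) has_derivative (\<lambda>v. fd b x v \<bullet> q)) (at x)" for q
    using hf[THEN has_derivative_inner_left] by blast+
  have hs: "(s has_derivative fd s x) (at x)" and hr: "(r has_derivative fd r x) (at x)"
    using smooth_on_has_derivative[OF _ x] sm by auto
  have fdc: "fd l x v \<bullet> t = l x \<bullet> gam g x v t" "fd a x v \<bullet> t = s x * (l x \<bullet> v) * (l x \<bullet> t) + a x \<bullet> gam g x v t"
    "fd b x v \<bullet> t = r x * (l x \<bullet> v) * (l x \<bullet> t) + b x \<bullet> gam g x v t" for v t
    using pp(1,2,3)[OF x, of v t] by (simp_all add: cd_def)
  have gs: "gam g x v w = gam g x w v" for v w by (rule gam_sym[OF VU[OF x]])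
  have zero: "cd2 g l x v w t = 0" for v w t
  proof -
    have "fd (\<lambda>y. cd g l y w t) x = fd (\<lambda>y. 0) x"
      by (rule fd_cong[OF V(1) x]) (simp_all add: pp)
    then show ?thesis by (simp add: cd2_def pp x)
  qed
  show "l x \<bullet> curv g x v w t = 0" using ricci_identity[OF V x smooth_frame(1), of v w t] by (simp add: zero)
  have c2: "cd2 g \<omega> x v w t = fd \<sigma> x v * (l x \<bullet> w) * (l x \<bullet> t) + \<sigma> x * (l x \<bullet> gam g x v w) * (l x \<bullet> t)"
    if \<omega>: "\<And>y v t. y \<in> V \<Longrightarrow> cd g \<omega> y v t = \<sigma> y * (l y \<bullet> v) * (l y \<bullet> t)" and \<sigma>: "(\<sigma> has_derivative fd \<sigma> x) (at x)" for \<omega> \<sigma> v w t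
  proof -
    note m = has_derivative_mult[OF has_derivative_mult[OF \<sigma> hin(1)[of w]] hin(1)[of t]]
    have "fd (\<lambda>y. cd g \<omega> y w t) x = fd (\<lambda>y. \<sigma> y * (l y \<bullet> w) * (l y \<bullet> t)) x"
      by (rule fd_cong[OF V(1) x]) (use \<omega> m in \<open>auto simp: differentiable_def\<close>)
    then show ?thesis
      unfolding cd2_def \<omega>[OF x] using fd_eqI[OF m, of v] by (simp add: fdc algebra_simps)
  qed
  show "a x \<bullet> curv g x v w t = - (fd s x v * (l x \<bullet> w) - fd s x w * (l x \<bullet> v)) * (l x \<bullet> t)"
    using ricci_identity[OF V x smooth_frame(3), of v w t] c2[OF pp(2) hs, of v w t] c2[OF pp(2) hs, of w v t] gs[of v w]
    by (simp add: algebra_simps)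
  show "b x \<bullet> curv g x v w t = - (fd r x v * (l x \<bullet> w) - fd r x w * (l x \<bullet> v)) * (l x \<bullet> t)"
    using ricci_identity[OF V x smooth_frame(4), of v w t] c2[OF pp(3) hr, of v w t] c2[OF pp(3) hr, of w v t] gs[of v w]
    by (simp add: algebra_simps)
  \<comment> \<open>The terms quadratic in \<open>s\<close> and \<open>r\<close> are symmetric in
    \<open>v\<close> and \<open>w\<close>, so they cancel in the commutator.\<close>
  have c2n: "cd2 g n x v w t = (l x \<bullet> gam g x v w) * (s x * (a x \<bullet> t) + r x * (b x \<bullet> t))
      + (l x \<bullet> w) * (fd s x v * (a x \<bullet> t) + fd r x v * (b x \<bullet> t) + ((s x)^2 + (r x)^2) * (l x \<bullet> v) * (l x \<bullet> t))" for v w t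
  proof -
    note m = has_derivative_mult[OF hin(1)[of w] has_derivative_add[OF has_derivative_mult[OF hs hin(3)[of t]] has_derivative_mult[OF hr hin(4)[of t]]]]
    have "fd (\<lambda>y. cd g n y w t) x = fd (\<lambda>y. (l y \<bullet> w) * (s y * (a y \<bullet> t) + r y * (b y \<bullet> t))) x"
      by (rule fd_cong[OF V(1) x]) (use pp(4) m in \<open>auto simp: differentiable_def\<close>)
    then show ?thesis
      unfolding cd2_def pp(4)[OF x] using fd_eqI[OF m, of v] by (simp add: fdc algebra_simps power2_eq_square)
  qed
  show "n x \<bullet> curv g x v w t = - (fd s x v * (l x \<bullet> w) - fd s x w * (l x \<bullet> v)) * (a x \<bullet> t)
       - (fd r x v * (l x \<bullet> w) - fd r x w * (l x \<bullet> v)) * (b x \<bullet> t)"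
    using ricci_identity[OF V x smooth_frame(2), of v w t] c2n[of v w t] c2n[of w v t] gs[of v w]
    by (simp add: algebra_simps)
qed

text \<open>The matrix of transverse derivatives of (s, r) splits into trace and trace-free part:
  the trace is the Ricci tensor, and the trace-free part, with entries \<open>P\<close> and
  \<open>Q\<close>, is the Weyl tensor. The latter is a quadratic form in l wedge a and l wedge b,
  which duality rotates into each other, so its self-dual part is a complex square with factor -P +
  i Q.\<close>

lemma pp_ricci_weyl:
  assumes x: "x \<in> V"
    and curv: "\<And>v w t. l x \<bullet> curv g x v w t = 0"
    "\<And>v w t. a x \<bullet> curv g x v w t = - (S v * (l x \<bullet> w) - S w * (l x \<bullet> v)) * (l x \<bullet> t)"
    "\<And>v w t. b x \<bullet> curv g x v w t = - (R v * (l x \<bullet> w) - R w * (l x \<bullet> v)) * (l x \<bullet> t)"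
    "\<And>v w t. n x \<bullet> curv g x v w t = - (S v * (l x \<bullet> w) - S w * (l x \<bullet> v)) * (a x \<bullet> t) - (R v * (l x \<bullet> w) - R w * (l x \<bullet> v)) * (b x \<bullet> t)"
    and ds: "\<And>w. S w = sl * (l x \<bullet> w) + sa * (a x \<bullet> w) + sb * (b x \<bullet> w)"
    and dr: "\<And>w. R w = rl * (l x \<bullet> w) + sb * (a x \<bullet> w) + rb * (b x \<bullet> w)"
    and hodge: "hodge2 g x (wedge (l x) (a x)) = - wedge (l x) (b x)"
  defines "\<A> i j \<equiv> (complex_of_real (wedge (l x) (a x) $ i $ j) + \<i> * complex_of_real (wedge (l x) (b x) $ i $ j)) / complex_of_real (sqrt 2)"
  shows "ricci g x j m = - (sa + rb) * (l x $ j * l x $ m)"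
    "self_dual_weyl g x i j k m = Complex ((rb - sa) / 2) sb * \<A> i j * \<A> k m"
proof -
  obtain Dl Dn Da Db where d: "dual_basis (l x) (n x) (a x) (b x) Dl Dn Da Db" using ex_dual[OF x] .
  note D = dual_basisD[OF d]
  let ?F = "wedge (l x) (a x)" and ?G = "wedge (l x) (b x)"
  have ric: "ric x p q = - (sa + rb) * ((l x \<bullet> p) * (l x \<bullet> q))" for p q
    unfolding ric_frame[OF x d] curv ds dr by (simp add: D algebra_simps)
  have ricci: "ricci g x j m = - (sa + rb) * (l x $ j * l x $ m)" for j m
    unfolding ricci_ric[OF VU[OF x]] ric by (simp add: inner_axis)
  then show "ricci g x j m = - (sa + rb) * (l x $ j * l x $ m)" .
  have sc: "scalar_curvature g x = 0"
    unfolding scalar_curvature_frame[OF x d] ric by (simp add: D)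
  define P Q where "P = (sa - rb) / 2" "Q = sb"
  have gc: "g x $ i $ j = - (l x $ i * n x $ j) - n x $ i * l x $ j + a x $ i * a x $ j + b x $ i * b x $ j" for i j
    by (simp add: frame[OF x] frame_matrix_def)
  have weyl: "weyl g x i j k m = - (P * ?F $ k $ m + Q * ?G $ k $ m) * ?F $ i $ j - (Q * ?F $ k $ m - P * ?G $ k $ m) * ?G $ i $ j" for i j k m
    unfolding weyl_def sc riemann_gmet[OF VU[OF x]] gmet_frame[OF x] ricci gc curv ds dr P_Q_def
    by (simp add: inner_axis wedge_def field_simps)
  have "hodge2 g x (\<chi> e f. weyl g x e f k m) = (P * ?F $ k $ m + Q * ?G $ k $ m) *\<^sub>R ?G - (Q * ?F $ k $ m - P * ?G $ k $ m) *\<^sub>R ?F" for k m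
  proof -
    have "(\<chi> e f. weyl g x e f k m) = (- (P * ?F $ k $ m + Q * ?G $ k $ m)) *\<^sub>R ?F + (- (Q * ?F $ k $ m - P * ?G $ k $ m)) *\<^sub>R ?G"
      by (simp add: vec_eq_iff weyl algebra_simps)
    then show ?thesis by (simp only: hodge2_linear hodge hodge2_wedge_lb[OF x hodge]) (simp add: algebra_simps)
  qed
  then have hw: "hodge2 g x (\<chi> e f. weyl g x e f k m) $ i $ j
      = (P * ?F $ k $ m + Q * ?G $ k $ m) * ?G $ i $ j - (Q * ?F $ k $ m - P * ?G $ k $ m) * ?F $ i $ j" for i j k m
    by simp
  have s2: "complex_of_real (sqrt 2) * complex_of_real (sqrt 2) = 2" by (simp flip: of_real_mult)
  have "Complex ((rb - sa) / 2) sb * \<A> i j * \<A> k m = Complex ((rb - sa) / 2) sb *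
      (complex_of_real (?F $ i $ j) + \<i> * complex_of_real (?G $ i $ j)) * (complex_of_real (?F $ k $ m) + \<i> * complex_of_real (?G $ k $ m))
      / (complex_of_real (sqrt 2) * complex_of_real (sqrt 2))"
    by (simp add: \<A>_def)
  also have "\<dots> = self_dual_weyl g x i j k m"
    unfolding s2 self_dual_weyl_def hw unfolding weyl P_Q_def by (simp add: complex_eq_iff field_simps)
  finally show "self_dual_weyl g x i j k m = Complex ((rb - sa) / 2) sb * \<A> i j * \<A> k m" by simp
qed

end

context spacetime_chart
begin

lemma smooth_codifferential:
  fixes F :: "real^4 \<Rightarrow> real^4^4"
  assumes "\<And>i j. smooth_on U (\<lambda>x. F x $ i $ j)"
  shows "smooth_on U (\<lambda>x. codifferential g F x $ k)"
  unfolding codifferential_def nabla2_def vec_lambda_beta real_scaleR_def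
  by (intro smooth_on_minus smooth_on_sum smooth_on_mult smooth_on_diff smooth_pd smooth_ginv smooth_christoffel assms open_U)

end

section \<open>Adapted frames and coordinates\<close>

context null_frame
begin

text \<open>The multiples of \<open>l\<close> provided by \<open>cky_structure\<close> must be zero
  because \<open>l\<close> is not, so the structure equations hold with z1 = z2 = 0.\<close>

lemma cky_parallel_structure:
  assumes "conformal_killing_yano_on U g A" "\<And>y. y \<in> V \<Longrightarrow> A y = wedge (l y) (a y)"
    "\<And>y. y \<in> V \<Longrightarrow> hodge_field g A y = - wedge (l y) (b y)" and x: "x \<in> V"
    and "codifferential g A x = 0" "codifferential g (hodge_field g A) x = 0"
  obtains \<alpha> \<gamma> where "\<forall>v t. cd g l x v t = 0" "\<forall>v t. cd g a x v t = \<alpha> v * (l x \<bullet> t)" "\<forall>v t. cd g b x v t = \<gamma> v * (l x \<bullet> t)"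
proof -
  obtain Dl Dn Da Db where d: "dual_basis (l x) (n x) (a x) (b x) Dl Dn Da Db" using ex_dual[OF x] .
  then have "l x \<noteq> 0" using dual_basisD(1)[OF d] by auto
  moreover have "wedge 0 0 = (0 :: real^4^4)" by (simp add: wedge_def vec_eq_iff)
  ultimately have "structure_at 0 0 x"
    using cky_structure[OF assms(1-4) assms(5,6)[symmetric]] by auto
  then show ?thesis using that unfolding structure_at_def by auto
qed

end

text \<open>\<open>w\<close> is the coordinate v of the line element, \<open>X\<close> and
  \<open>Y\<close> are real transverse coordinates, and \<open>h\<close> is the profile H, still as
  a function on the space-time. The functions \<open>s\<close> and \<open>r\<close> will turn out to
  be its transverse derivatives up to sign.\<close>

locale pp_frame = null_frame +
  fixes A :: "real^4 \<Rightarrow> real^4^4" and u w X Y h s r :: "real^4 \<Rightarrow> real"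
  assumes A: "x \<in> V \<Longrightarrow> A x = wedge (l x) (a x)" "x \<in> V \<Longrightarrow> hodge_field g A x = - wedge (l x) (b x)"
    and smooth_pp: "smooth_on V u" "smooth_on V w" "smooth_on V X" "smooth_on V Y" "smooth_on V h" "smooth_on V s" "smooth_on V r"
    and du: "x \<in> V \<Longrightarrow> fd u x t = l x \<bullet> t" and dX: "x \<in> V \<Longrightarrow> fd X x t = a x \<bullet> t" and dY: "x \<in> V \<Longrightarrow> fd Y x t = b x \<bullet> t"
    and dw: "x \<in> V \<Longrightarrow> n x \<bullet> t = fd w x t + h x * (l x \<bullet> t)"
    and cdl: "x \<in> V \<Longrightarrow> cd g l x v t = 0"
    and cda: "x \<in> V \<Longrightarrow> cd g a x v t = s x * (l x \<bullet> v) * (l x \<bullet> t)"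
    and cdb: "x \<in> V \<Longrightarrow> cd g b x v t = r x * (l x \<bullet> v) * (l x \<bullet> t)"
    and cdn: "x \<in> V \<Longrightarrow> cd g n x v t = (l x \<bullet> v) * (s x * (a x \<bullet> t) + r x * (b x \<bullet> t))"

text \<open>The converse of the Poincare lemma. It turns exactness, once achieved, back into
  symmetry conditions on the connection.\<close>

lemma gradient_closed:
  fixes f :: "real^'n \<Rightarrow> real" and \<omega> :: "real^'n \<Rightarrow> real^'n"
  assumes "open S" "x \<in> S" "smooth_on S f" "\<omega> differentiable (at x)" "\<And>y t. y \<in> S \<Longrightarrow> fd f y t = \<omega> y \<bullet> t"
  shows "fd \<omega> x v \<bullet> t = fd \<omega> x t \<bullet> v"
proof -
  have "fd \<omega> x v \<bullet> t = fd (\<lambda>y. fd f y t) x v" for v t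
  proof -
    have "fd (\<lambda>y. fd f y t) x = fd (\<lambda>y. \<omega> y \<bullet> t) x"
      by (rule fd_cong[OF assms(1,2,5)])
        (use has_derivative_inner_left[of \<omega> "fd \<omega> x" "at x" t] assms(4) in \<open>auto simp: differentiable_def simp flip: frechet_derivative_works\<close>)
    then show ?thesis using fd_inner_left[OF assms(4)] by simp
  qed
  then show ?thesis using symmetric_second_derivative[OF assms(1-3), of t v] by simp
qed

section \<open>Construction of an exact transverse frame\<close>

context spacetime_chart
begin

text \<open>The Poincare lemma is applied to \<open>l\<close>, then along the leaves of
  \<open>u\<close> to \<open>a\<close> and \<open>b\<close>, and after a null rotation to
  \<open>n\<close>. Each application shrinks the neighbourhood.\<close>

lemma ex_pp_frame:
  assumes cky: "conformal_killing_yano_on U g A" and null: "null_on U g A"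
    and Z: "\<And>x. x \<in> U \<Longrightarrow> codifferential g A x = 0" "\<And>x. x \<in> U \<Longrightarrow> codifferential g (hodge_field g A) x = 0"
    and p: "p \<in> U"
  shows "\<exists>V l n a b u w X Y h s r. p \<in> V \<and> pp_frame U g V l n a b A u w X Y h s r"
proof -
  have tf: "two_form_on U A" using cky by (simp add: conformal_killing_yano_on_def)
  obtain V0 l n a b k where V0: "open V0" "p \<in> V0" "V0 \<subseteq> U"
    and sm: "smooth_on V0 l" "smooth_on V0 n" "smooth_on V0 a" "smooth_on V0 b"
    and F: "\<forall>x\<in>V0. g x = frame_matrix (l x) (n x) (a x) (b x) \<and> A x = wedge (l x) (a x) \<and>
       hodge_field g A x = - wedge (l x) (b x) \<and> l x $ k \<noteq> 0"
    using local_null_frame[OF tf null p] by blast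
  interpret F0: null_frame U g V0 l n a b
    by unfold_locales (use V0 sm F in auto)
  have A0: "A y = wedge (l y) (a y)" "hodge_field g A y = - wedge (l y) (b y)" if "y \<in> V0" for y using F that by auto
  note par = F0.cky_parallel_structure[OF cky A0]
  have dl: "fd l x v \<bullet> t = fd l x t \<bullet> v" if x: "x \<in> V0" for x v t
  proof -
    obtain \<alpha> \<gamma> where "\<forall>v t. cd g l x v t = 0" by (rule par[OF _ _ x Z(1)[OF F0.VU[OF x]] Z(2)[OF F0.VU[OF x]]]) auto
    then show ?thesis using cd_torsion[OF F0.VU[OF x], of l v t] by simp
  qed
  \<comment> \<open>The exterior derivative of \<open>a\<close> is \<alpha> wedge l, and that of
    \<open>b\<close> is \<gamma> wedge l; both vanish on pairs of vectors annihilated by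
    \<open>l\<close>.\<close>
  have da: "fd a x v \<bullet> t = fd a x t \<bullet> v" "fd b x v \<bullet> t = fd b x t \<bullet> v"
    if x: "x \<in> V0" and vt: "l x \<bullet> v = 0" "l x \<bullet> t = 0" for x v t
  proof -
    obtain \<alpha> \<gamma> where "\<forall>v t. cd g l x v t = 0" "\<forall>v t. cd g a x v t = \<alpha> v * (l x \<bullet> t)" "\<forall>v t. cd g b x v t = \<gamma> v * (l x \<bullet> t)"
      by (rule par[OF _ _ x Z(1)[OF F0.VU[OF x]] Z(2)[OF F0.VU[OF x]]]) auto
    then show "fd a x v \<bullet> t = fd a x t \<bullet> v" "fd b x v \<bullet> t = fd b x t \<bullet> v"
      using cd_torsion[OF F0.VU[OF x], of a v t] cd_torsion[OF F0.VU[OF x], of b v t] vt by simp_all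
  qed
  have lp: "l p \<noteq> 0" using F V0(2) by (metis zero_index)
  obtain V1 u where V1: "open V1" "p \<in> V1" "V1 \<subseteq> V0" and u: "smooth_on V1 u" "\<forall>x\<in>V1. \<forall>t. fd u x t = l x \<bullet> t"
    by (rule poincare[OF V0(1,2) sm(1) dl])
  have u1: "fd u x t = l x \<bullet> t" if "x \<in> V1" for x t using u(2) that by blast
  have a1: "fd a x v \<bullet> t = fd a x t \<bullet> v" if "x \<in> V1" "l x \<bullet> v = 0" "l x \<bullet> t = 0" for x v t
    using da(1)[of x v t] that V1(3) by blast
  obtain V2 X h1 where V2: "open V2" "p \<in> V2" "V2 \<subseteq> V1" and X: "smooth_on V2 X" "smooth_on V2 h1"
    "\<forall>x\<in>V2. \<forall>t. a x \<bullet> t = fd X x t + h1 x * (l x \<bullet> t)"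
    by (rule poincare_relative[where l = l and p = p, OF V1(1,2) u(1) smooth_on_subset[OF sm(3) V1(3)] u1 lp a1])
  have V20: "V2 \<subseteq> V0" using V1 V2 by blast
  have u2: "fd u x t = l x \<bullet> t" if "x \<in> V2" for x t using u1 that V2(3) by blast
  have b2: "fd b x v \<bullet> t = fd b x t \<bullet> v" if "x \<in> V2" "l x \<bullet> v = 0" "l x \<bullet> t = 0" for x v t
    using da(2)[of x v t] that V20 by blast
  obtain V3 Y h2 where V3: "open V3" "p \<in> V3" "V3 \<subseteq> V2" and Y: "smooth_on V3 Y" "smooth_on V3 h2"
    "\<forall>x\<in>V3. \<forall>t. b x \<bullet> t = fd Y x t + h2 x * (l x \<bullet> t)"
    by (rule poincare_relative[where l = l and p = p, OF V2(1,2) smooth_on_subset[OF u(1) V2(3)] smooth_on_subset[OF sm(4) V20] u2 lp b2])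
  have V30: "V3 \<subseteq> V0" using V1 V2 V3 by blast
  \<comment> \<open>Null rotation by the functions \<open>h1\<close> and \<open>h2\<close>. It
    removes the \<open>l\<close>-parts, so that \<open>a'\<close> and \<open>b'\<close> are the
    differentials of \<open>X\<close> and \<open>Y\<close>; \<open>n'\<close> is corrected so that
    the metric keeps its form.\<close>
  define a' where "a' x = a x - h1 x *\<^sub>R l x" for x
  define b' where "b' x = b x - h2 x *\<^sub>R l x" for x
  define n' where "n' x = n x - h1 x *\<^sub>R a' x - h2 x *\<^sub>R b' x - (((h1 x)^2 + (h2 x)^2) / 2) *\<^sub>R l x" for x
  have h12: "smooth_on V3 h1" "smooth_on V3 h2" using X(2) Y(2) V3 smooth_on_subset by blast+
  note sm3 = sm[THEN smooth_on_subset, OF V30]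
  have sa': "smooth_on V3 a'" unfolding a'_def by (intro smooth_on_diff smooth_on_scaleR V3(1) sm3 h12)
  have sb': "smooth_on V3 b'" unfolding b'_def by (intro smooth_on_diff smooth_on_scaleR V3(1) sm3 h12)
  have sn': "smooth_on V3 n'" unfolding n'_def power2_eq_square
    by (intro smooth_on_diff smooth_on_scaleR smooth_on_divide_const smooth_on_add smooth_on_mult V3(1) sm3 h12 sa' sb')
  have fr': "g x = frame_matrix (l x) (n' x) (a' x) (b' x)" "A x = wedge (l x) (a' x)" "hodge_field g A x = - wedge (l x) (b' x)"
    if "x \<in> V3" for x
  proof -
    have "g x = frame_matrix (l x) (n x) (a x) (b x)" "A x = wedge (l x) (a x)" "hodge_field g A x = - wedge (l x) (b x)"
      using F that V30 by auto
    moreover have "frame_matrix (l x) (n x) (a x) (b x) = frame_matrix (l x) (n' x) (a' x) (b' x)"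
      by (simp add: vec_eq_iff frame_matrix_def a'_def b'_def n'_def field_simps power2_eq_square)
    moreover have "wedge (l x) (a x) = wedge (l x) (a' x)" "wedge (l x) (b x) = wedge (l x) (b' x)"
      by (simp_all add: vec_eq_iff wedge_def a'_def b'_def algebra_simps)
    ultimately show "g x = frame_matrix (l x) (n' x) (a' x) (b' x)" "A x = wedge (l x) (a' x)" "hodge_field g A x = - wedge (l x) (b' x)"
      by simp_all
  qed
  have V3U: "V3 \<subseteq> U" using V30 V0 by blast
  interpret F1: null_frame U g V3 l n' a' b'
    by unfold_locales (use V3 V3U sm3 sa' sb' sn' fr' in auto)
  note par1 = F1.cky_parallel_structure[OF cky fr'(2,3)]
  \<comment> \<open>Once the derivative of \<open>a'\<close> is known to be a multiple of l tensor
    l, its \<open>(k, k)\<close> component yields the factor, smoothly because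
    \<open>l x $ k\<close> does not vanish.\<close>
  define s where "s x = cd g a' x (axis k 1) (axis k 1) / (l x $ k * l x $ k)" for x
  define r where "r x = cd g b' x (axis k 1) (axis k 1) / (l x $ k * l x $ k)" for x
  have lk: "l x $ k \<noteq> 0" if "x \<in> V3" for x using F that V30 by auto
  have ssr: "smooth_on V3 s" "smooth_on V3 r" unfolding s_def r_def
    using lk by (auto intro!: smooth_on_divide smooth_cd smooth_on_mult smooth_on_nth V3(1) V3U sa' sb' sm3)
  have dX: "fd X x t = a' x \<bullet> t" "fd Y x t = b' x \<bullet> t" if "x \<in> V3" for x t
    using X(3) Y(3) that V3(3) by (auto simp: a'_def b'_def inner_diff_left)
  have sX: "smooth_on V3 X" using X(1) V3 smooth_on_subset by blast
  have sym: "fd a' x v \<bullet> t = fd a' x t \<bullet> v" "fd b' x v \<bullet> t = fd b' x t \<bullet> v" if x: "x \<in> V3" for x v t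
    using gradient_closed[OF V3(1) x sX F1.differentiable_frame(3)[OF x] dX(1), of v t]
      gradient_closed[OF V3(1) x Y(1) F1.differentiable_frame(4)[OF x] dX(2), of v t] by auto
  have pp: "cd g l x v t = 0" "cd g a' x v t = s x * (l x \<bullet> v) * (l x \<bullet> t)" "cd g b' x v t = r x * (l x \<bullet> v) * (l x \<bullet> t)"
    "cd g n' x v t = (l x \<bullet> v) * (s x * (a' x \<bullet> t) + r x * (b' x \<bullet> t))" if x: "x \<in> V3" for x v t
  proof -
    note xU = F1.VU[OF x]
    obtain \<alpha> \<gamma> where c: "\<forall>v t. cd g l x v t = 0" "\<forall>v t. cd g a' x v t = \<alpha> v * (l x \<bullet> t)" "\<forall>v t. cd g b' x v t = \<gamma> v * (l x \<bullet> t)"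
      by (rule par1[OF _ _ x Z(1)[OF xU] Z(2)[OF xU]]) auto
    note c = c[rule_format]
    show "cd g l x v t = 0" by (rule c)
    let ?k = "axis k 1 :: real^4"
    have lkk: "l x \<bullet> ?k = l x $ k" by (simp add: inner_axis)
    have *: "\<beta> v * (l x \<bullet> t) = \<beta> ?k * (l x $ k) / (l x $ k * l x $ k) * (l x \<bullet> v) * (l x \<bullet> t)"
      if "\<And>v t. \<beta> v * (l x \<bullet> t) = \<beta> t * (l x \<bullet> v)" for \<beta> v t
      using that[of v ?k] lk[OF x] unfolding lkk by (simp add: field_simps)
    \<comment> \<open>Exactness of \<open>a'\<close> and \<open>b'\<close> makes \<alpha> tensor l
      and \<gamma> tensor l symmetric, which forces \<alpha> and \<gamma> to be multiples of
      \<open>l\<close>.\<close>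
    have "\<alpha> v * (l x \<bullet> t) = \<alpha> t * (l x \<bullet> v)" "\<gamma> v * (l x \<bullet> t) = \<gamma> t * (l x \<bullet> v)" for v t
      using cd_torsion[OF xU, of a' v t] cd_torsion[OF xU, of b' v t] sym[OF x, of v t] unfolding c by simp_all
    then show ca: "cd g a' x v t = s x * (l x \<bullet> v) * (l x \<bullet> t)" and cb: "cd g b' x v t = r x * (l x \<bullet> v) * (l x \<bullet> t)" for v t
      unfolding s_def r_def c lkk using *[of \<alpha> v t] *[of \<gamma> v t] by simp_all
    obtain Dl Dn Da Db where d: "dual_basis (l x) (n' x) (a' x) (b' x) Dl Dn Da Db" using F1.ex_dual[OF x] .
    show "cd g n' x v t = (l x \<bullet> v) * (s x * (a' x \<bullet> t) + r x * (b' x \<bullet> t))"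
      using F1.cd_expand[OF d, of n' v t] F1.frame_skew(2,3,9,10)[OF x d] c(1) ca cb
      by (simp add: dual_basisD[OF d] algebra_simps)
  qed
  have dn: "fd n' x v \<bullet> t = fd n' x t \<bullet> v" if x: "x \<in> V3" and vt: "l x \<bullet> v = 0" "l x \<bullet> t = 0" for x v t
    using cd_torsion[OF F1.VU[OF x], of n' v t] pp(4)[OF x] vt by simp
  have u3: "fd u x t = l x \<bullet> t" if "x \<in> V3" for x t using u2 that V3(3) by blast
  obtain V4 w h where V4: "open V4" "p \<in> V4" "V4 \<subseteq> V3" and w: "smooth_on V4 w" "smooth_on V4 h"
    "\<forall>x\<in>V4. \<forall>t. n' x \<bullet> t = fd w x t + h x * (l x \<bullet> t)"
    by (rule poincare_relative[where l = l and p = p, OF V3(1,2) smooth_on_subset[OF u(1) order_trans[OF V3(3) V2(3)]] sn' u3 lp dn])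
  have su: "smooth_on V4 u" using u(1) V4 V3 V2 smooth_on_subset by blast
  have u': "fd u x t = l x \<bullet> t" if "x \<in> V4" for x t using u(2) that V4 V3 V2 by blast
  have V4U: "V4 \<subseteq> U" using V4 V3U by blast
  note s4 = smooth_on_subset[OF _ V4(3)]
  have "pp_frame U g V4 l n' a' b' A u w X Y h s r"
  proof (unfold_locales)
    show "open V4" "V4 \<subseteq> U" by fact+
    show "smooth_on V4 l" "smooth_on V4 n'" "smooth_on V4 a'" "smooth_on V4 b'" by (rule s4, fact)+
    show "smooth_on V4 u" "smooth_on V4 w" "smooth_on V4 h" by fact+
    show "smooth_on V4 X" "smooth_on V4 Y" "smooth_on V4 s" "smooth_on V4 r" by (rule s4, fact)+
  next
    fix x v t assume x: "x \<in> V4"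
    then have x3: "x \<in> V3" using V4(3) by blast
    show "g x = frame_matrix (l x) (n' x) (a' x) (b' x)" "A x = wedge (l x) (a' x)" "hodge_field g A x = - wedge (l x) (b' x)"
      by (rule fr'[OF x3])+
    show "fd u x t = l x \<bullet> t" by (rule u'[OF x])
    show "fd X x t = a' x \<bullet> t" "fd Y x t = b' x \<bullet> t" by (rule dX[OF x3])+
    show "n' x \<bullet> t = fd w x t + h x * (l x \<bullet> t)" using w(3) x by blast
    show "cd g l x v t = 0" "cd g a' x v t = s x * (l x \<bullet> v) * (l x \<bullet> t)" "cd g b' x v t = r x * (l x \<bullet> v) * (l x \<bullet> t)"
      "cd g n' x v t = (l x \<bullet> v) * (s x * (a' x \<bullet> t) + r x * (b' x \<bullet> t))" by (rule pp[OF x3])+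
  qed
  then show ?thesis using V4(2) by blast
qed

end

section \<open>Wirtinger derivatives and the complex coordinate\<close>

lemma smooth_on_Complex:
  assumes "open S" "smooth_on S f" "smooth_on S k"
  shows "smooth_on S (\<lambda>x. Complex (f x) (k x))"
proof (rule smooth_on_componentwise[OF assms(1)])
  fix i :: complex assume "i \<in> Basis"
  then show "smooth_on S (\<lambda>x. Complex (f x) (k x) \<bullet> i)"
    using assms by (auto simp: Basis_complex_def inner_complex_def)
qed

text \<open>Wirtinger derivatives of a real function in terms of real ones. The two mixed second
  derivatives merge by symmetry, which doubles the imaginary part of the second formula and makes
  the third one real.\<close>

lemma d_xi_of_real:
  assumes "open S" "q \<in> S" "smooth_on S H"
  shows "d_xi (\<lambda>q. complex_of_real (H q)) q = (complex_of_real (fd H q (0, 1)) - \<i> * complex_of_real (fd H q (0, \<i>))) / 2"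
    (is ?a)
    and "d_xi (d_xi (\<lambda>q. complex_of_real (H q))) q = Complex
      ((fd (\<lambda>q. fd H q (0, 1)) q (0, 1) - fd (\<lambda>q. fd H q (0, \<i>)) q (0, \<i>)) / 4)
      (- fd (\<lambda>q. fd H q (0, 1)) q (0, \<i>) / 2)" (is ?b)
    and "d_xibar (d_xi (\<lambda>q. complex_of_real (H q))) q = complex_of_real
      ((fd (\<lambda>q. fd H q (0, 1)) q (0, 1) + fd (\<lambda>q. fd H q (0, \<i>)) q (0, \<i>)) / 4)" (is ?c)
proof -
  have of: "fd (\<lambda>q. complex_of_real (G q)) q w = complex_of_real (fd G q w)" if "smooth_on S G" "q \<in> S" for G q w
    by (rule fd_eqI[OF bounded_linear.has_derivative[OF bounded_linear_of_real smooth_on_has_derivative[OF that]]])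
  have 1: "d_xi (\<lambda>q. complex_of_real (H q)) q = (complex_of_real (fd H q (0, 1)) - \<i> * complex_of_real (fd H q (0, \<i>))) / 2"
    if "q \<in> S" for q
    unfolding d_xi_def of[OF assms(3) that] ..
  show ?a by (rule 1[OF assms(2)])
  let ?H1 = "\<lambda>q. fd H q (0, 1)" and ?H2 = "\<lambda>q. fd H q (0, \<i>)"
  note sm = smooth_on_frechet_derivative[OF assms(3)]
  note hd = smooth_on_has_derivative[OF sm assms(2)]
  have h: "((\<lambda>q. (complex_of_real (?H1 q) - \<i> * complex_of_real (?H2 q)) / 2) has_derivative
     (\<lambda>w. (complex_of_real (fd ?H1 q w) - \<i> * complex_of_real (fd ?H2 q w)) / 2)) (at q)"
    by (rule bounded_linear.has_derivative[OF bounded_linear_divide])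
      (intro has_derivative_diff has_derivative_mult_right bounded_linear.has_derivative[OF bounded_linear_of_real] hd)
  have "fd (d_xi (\<lambda>q. complex_of_real (H q))) q = fd (\<lambda>q. (complex_of_real (?H1 q) - \<i> * complex_of_real (?H2 q)) / 2) q"
    by (rule fd_cong[OF assms(1,2) 1]) (use h in \<open>auto simp: differentiable_def\<close>)
  then have d: "fd (d_xi (\<lambda>q. complex_of_real (H q))) q w = (complex_of_real (fd ?H1 q w) - \<i> * complex_of_real (fd ?H2 q w)) / 2" for w
    using fd_eqI[OF h] by simp
  have sy: "fd ?H2 q (0, 1) = fd ?H1 q (0, \<i>)"
    by (rule symmetric_second_derivative[OF assms])
  show ?b unfolding d_xi_def[of "d_xi _"] d sy by (simp add: complex_eq_iff field_simps)
  show ?c unfolding d_xibar_def d sy by (simp add: complex_eq_iff field_simps)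
qed

text \<open>Passage from (u, v, \<xi>) to (u, v, X, Y). The factor sqrt 2 matches 2 d\<xi> d\<xi>bar
  with dX^2 + dY^2.\<close>

definition real_coords :: "real \<times> real \<times> complex \<Rightarrow> real^4" where
  "real_coords q = (\<chi> i. if i = 1 then fst q else if i = 2 then fst (snd q)
     else if i = 3 then sqrt 2 * Re (snd (snd q)) else sqrt 2 * Im (snd (snd q)))"

lemma real_coords_simps [simp]:
  "real_coords q $ 1 = fst q" "real_coords q $ 2 = fst (snd q)"
  "real_coords q $ 3 = sqrt 2 * Re (snd (snd q))" "real_coords q $ 4 = sqrt 2 * Im (snd (snd q))"
  by (simp_all add: real_coords_def)

lemma smooth_real_coords: "smooth_on UNIV real_coords"
  unfolding real_coords_def
proof (rule smooth_on_vec_lambda[OF open_UNIV])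
  have "bounded_linear (\<lambda>q :: real \<times> real \<times> complex. fst q)" "bounded_linear (\<lambda>q :: real \<times> real \<times> complex. fst (snd q))"
    "bounded_linear (\<lambda>q :: real \<times> real \<times> complex. sqrt 2 * Re (snd (snd q)))" "bounded_linear (\<lambda>q :: real \<times> real \<times> complex. sqrt 2 * Im (snd (snd q)))"
    by (intro bounded_linear_intros bounded_linear_compose[OF bounded_linear_Re] bounded_linear_compose[OF bounded_linear_Im])+
  note this[THEN bounded_linear.smooth_on[OF _ open_UNIV smooth_on_ident]]
  then show "smooth_on UNIV (\<lambda>q :: real \<times> real \<times> complex. if i = 1 then fst q else if i = 2 then fst (snd q)
     else if i = 3 then sqrt 2 * Re (snd (snd q)) else sqrt 2 * Im (snd (snd q)))" for i :: 4
    by (cases "i = 1"; cases "i = 2"; cases "i = 3"; simp)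
qed

section \<open>The pp-wave chart and the profile function\<close>

context pp_frame
begin

text \<open>As n - h l = dw is closed and \<open>l\<close> is closed, dn = dh wedge l. Comparing
  with dn from the connection on the pair (v, Dl) gives dh on the kernel of \<open>l\<close>. In
  particular dh vanishes on \<open>Dn\<close>, so \<open>h\<close> does not depend on
  \<open>w\<close>.\<close>

lemma dh:
  assumes x: "x \<in> V" and v: "l x \<bullet> v = 0"
  shows "fd h x v = - s x * (a x \<bullet> v) - r x * (b x \<bullet> v)"
proof -
  obtain Dl Dn Da Db where d: "dual_basis (l x) (n x) (a x) (b x) Dl Dn Da Db" using ex_dual[OF x] .
  have hh: "(h has_derivative fd h x) (at x)" by (rule smooth_on_has_derivative[OF smooth_pp(5) x])
  have hd: "((\<lambda>y. n y - h y *\<^sub>R l y) has_derivative (\<lambda>v. fd n x v - (h x *\<^sub>R fd l x v + fd h x v *\<^sub>R l x))) (at x)"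
    by (rule has_derivative_diff[OF has_derivative_frame(2)[OF x] has_derivative_scaleR[OF hh has_derivative_frame(1)[OF x]]])
  have "fd (\<lambda>y. n y - h y *\<^sub>R l y) x v \<bullet> t = fd (\<lambda>y. n y - h y *\<^sub>R l y) x t \<bullet> v" for v t
  proof (rule gradient_closed[OF V(1) x smooth_pp(2)])
    show "(\<lambda>y. n y - h y *\<^sub>R l y) differentiable (at x)" using hd by (auto simp: differentiable_def)
    show "fd w y t = (n y - h y *\<^sub>R l y) \<bullet> t" if "y \<in> V" for y t
      using dw[OF that, of t] by (simp add: inner_diff_left)
  qed
  then have "(fd n x v - (h x *\<^sub>R fd l x v + fd h x v *\<^sub>R l x)) \<bullet> Dl = (fd n x Dl - (h x *\<^sub>R fd l x Dl + fd h x Dl *\<^sub>R l x)) \<bullet> v"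
    unfolding fd_eqI[OF hd] .
  moreover have "fd l x v \<bullet> Dl = fd l x Dl \<bullet> v" using cd_torsion[OF VU[OF x], of l v Dl] cdl[OF x] by simp
  moreover have "fd n x v \<bullet> Dl - fd n x Dl \<bullet> v = (l x \<bullet> v) * (s x * (a x \<bullet> Dl) + r x * (b x \<bullet> Dl)) - (l x \<bullet> Dl) * (s x * (a x \<bullet> v) + r x * (b x \<bullet> v))"
    using cd_torsion[OF VU[OF x], of n v Dl] cdn[OF x] by simp
  ultimately show ?thesis using v by (simp add: dual_basisD[OF d] inner_diff_left inner_add_left)
qed

definition chart :: "real^4 \<Rightarrow> real^4" where
  "chart x = (\<chi> i. if i = 1 then u x else if i = 2 then w x else if i = 3 then X x else Y x)"

definition xi :: "real^4 \<Rightarrow> complex" where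
  "xi x = Complex (X x / sqrt 2) (Y x / sqrt 2)"

lemma chart_simps [simp]: "chart x $ 1 = u x" "chart x $ 2 = w x" "chart x $ 3 = X x" "chart x $ 4 = Y x"
  by (simp_all add: chart_def)

lemma smooth_chart: "smooth_on V chart"
  unfolding chart_def
proof (rule smooth_on_vec_lambda[OF V(1)])
  show "smooth_on V (\<lambda>x. if i = 1 then u x else if i = 2 then w x else if i = 3 then X x else Y x)" for i :: 4
    using smooth_pp by (cases "i = 1"; cases "i = 2"; cases "i = 3"; simp)
qed

lemma smooth_xi: "smooth_on V xi"
  unfolding xi_def by (intro smooth_on_Complex smooth_on_divide_const V(1) smooth_pp)

lemma fd_xi:
  assumes "x \<in> V" shows "fd xi x v = Complex ((a x \<bullet> v) / sqrt 2) ((b x \<bullet> v) / sqrt 2)"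
proof -
  have c: "Complex p q = of_real p + \<i> * of_real q" for p q by (simp add: complex_eq_iff)
  have "(xi has_derivative (\<lambda>v. of_real (fd X x v / sqrt 2) + \<i> * of_real (fd Y x v / sqrt 2))) (at x)"
    unfolding xi_def[abs_def] c
    by (intro has_derivative_add has_derivative_mult_right bounded_linear.has_derivative[OF bounded_linear_of_real]
        bounded_linear.has_derivative[OF bounded_linear_divide] smooth_on_has_derivative[OF _ assms] smooth_pp)
  from fd_eqI[OF this] show ?thesis unfolding c by (simp add: dX[OF assms] dY[OF assms])
qed

lemma fd_chart:
  assumes "x \<in> V"
  shows "fd chart x v $ 1 = l x \<bullet> v" "fd chart x v $ 2 = n x \<bullet> v - h x * (l x \<bullet> v)" "fd chart x v $ 3 = a x \<bullet> v" "fd chart x v $ 4 = b x \<bullet> v"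
  using du[OF assms, of v] dw[OF assms, of v] dX[OF assms, of v] dY[OF assms, of v]
  by (simp_all flip: fd_nth[OF smooth_on_differentiable[OF smooth_chart assms]])

lemma fd_chart_inj:
  assumes x: "x \<in> V" and 0: "fd chart x v = 0" shows "v = 0"
proof -
  obtain Dl Dn Da Db where d: "dual_basis (l x) (n x) (a x) (b x) Dl Dn Da Db" using ex_dual[OF x] .
  have "l x \<bullet> v = 0" "n x \<bullet> v = 0" "a x \<bullet> v = 0" "b x \<bullet> v = 0"
    using fd_chart[OF x, of v] 0 by simp_all
  then show ?thesis using dual_basis_expand[OF d, of v] by simp
qed

text \<open>The chart is cut down to a coordinate box instead of a ball: resetting the second
  coordinate to its value at the centre stays in the box, and lines in that direction meet it in an
  interval.\<close>

lemma ex_box_chart: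
  assumes p: "p \<in> V"
  obtains V' \<psi> e where "e > 0" "open V'" "p \<in> V'" "V' \<subseteq> V"
    "\<forall>y. (\<forall>i. \<bar>y $ i - chart p $ i\<bar> < e) \<longrightarrow> \<psi> y \<in> V' \<and> chart (\<psi> y) = y"
    "\<forall>x\<in>V'. \<psi> (chart x) = x \<and> (\<forall>i. \<bar>chart x $ i - chart p $ i\<bar> < e)"
    "smooth_on {y. \<forall>i. \<bar>y $ i - chart p $ i\<bar> < e} \<psi>"
    "\<forall>y v. (\<forall>i. \<bar>y $ i - chart p $ i\<bar> < e) \<longrightarrow> fd chart (\<psi> y) (fd \<psi> y v) = v"
proof -
  obtain U' W \<psi> where r: "open U'" "U' \<subseteq> V" "p \<in> U'" "open W" "chart p \<in> W" "homeomorphism U' W chart \<psi>"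
    "smooth_on W \<psi>" "\<forall>y e. y \<in> W \<longrightarrow> fd chart (\<psi> y) (fd \<psi> y e) = e"
    using smooth_inverse_function[OF V(1) p smooth_chart fd_chart_inj[OF p]] by metis
  obtain e' where e': "e' > 0" "ball (chart p) e' \<subseteq> W" using r(4,5) open_contains_ball by blast
  \<comment> \<open>In four dimensions the norm is at most the sum of four component distances, each
    below e'/4.\<close>
  define e where "e = e' / 4"
  have e: "e > 0" using e' by (simp add: e_def)
  define B where "B = {y. \<forall>i. \<bar>y $ i - chart p $ i\<bar> < e}"
  have BW: "B \<subseteq> W"
  proof
    fix y assume "y \<in> B"
    then have "(\<Sum>i\<in>UNIV. \<bar>(y - chart p) $ i\<bar>) < e'"
      by (simp add: B_def forall_4 sum_4 e_def)
    then have "norm (y - chart p) < e'" using norm_le_l1_cart[of "y - chart p"] by linarith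
    then show "y \<in> W" using e'(2) by (auto simp: dist_norm norm_minus_commute)
  qed
  have "open B" unfolding B_def forall_4
    by (intro open_Collect_conj open_Collect_less continuous_intros)
  moreover have cc: "continuous_on U' chart" using r(6) by (simp add: homeomorphism_def)
  ultimately have op: "open (U' \<inter> chart -` B)" using r(1) by (intro continuous_open_preimage)
  have inv: "\<psi> y \<in> U' \<inter> chart -` B \<and> chart (\<psi> y) = y" if "y \<in> B" for y
  proof -
    have "y \<in> W" using that BW by blast
    then have "\<psi> y \<in> U'" "chart (\<psi> y) = y" using r(6) unfolding homeomorphism_def by blast+
    then show ?thesis using that by simp
  qed
  have inv2: "\<psi> (chart x) = x" if "x \<in> U'" for x using r(6) that by (simp add: homeomorphism_def)
  show ?thesis
  proof (rule that[OF e op, of \<psi>])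
    show "p \<in> U' \<inter> chart -` B" using r(3) e by (simp add: B_def)
    show "U' \<inter> chart -` B \<subseteq> V" using r(2) by blast
    show "\<forall>y. (\<forall>i. \<bar>y $ i - chart p $ i\<bar> < e) \<longrightarrow> \<psi> y \<in> U' \<inter> chart -` B \<and> chart (\<psi> y) = y"
      using inv by (simp add: B_def)
    show "\<forall>x\<in>U' \<inter> chart -` B. \<psi> (chart x) = x \<and> (\<forall>i. \<bar>chart x $ i - chart p $ i\<bar> < e)"
      using inv2 by (simp add: B_def)
    show "smooth_on {y. \<forall>i. \<bar>y $ i - chart p $ i\<bar> < e} \<psi>"
      using smooth_on_subset[OF r(7) BW] by (simp add: B_def)
    show "\<forall>y v. (\<forall>i. \<bar>y $ i - chart p $ i\<bar> < e) \<longrightarrow> fd chart (\<psi> y) (fd \<psi> y v) = v"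
      using r(8) BW by (auto simp: B_def)
  qed
qed

end

context pp_frame
begin

lemma fd_profile:
  assumes S: "open S" "open V'" "V' \<subseteq> V" "x \<in> V'" and q: "\<And>y. y \<in> V' \<Longrightarrow> (u y, xi y) \<in> S"
    and K: "smooth_on S K" and k: "\<And>y. y \<in> V' \<Longrightarrow> K (u y, xi y) = k y"
  shows "fd k x v = fd K (u x, xi x) (l x \<bullet> v, Complex ((a x \<bullet> v) / sqrt 2) ((b x \<bullet> v) / sqrt 2))"
proof -
  have x: "x \<in> V" using S by blast
  have h: "((\<lambda>y. (u y, xi y)) has_derivative (\<lambda>v. (fd u x v, fd xi x v))) (at x)"
    by (intro has_derivative_Pair smooth_on_has_derivative[OF smooth_pp(1) x] smooth_on_has_derivative[OF smooth_xi x])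
  have hK: "(K has_derivative fd K (u x, xi x)) (at (u x, xi x))"
    by (rule smooth_on_has_derivative[OF K q[OF S(4)]])
  have c: "((\<lambda>y. K (u y, xi y)) has_derivative (\<lambda>v. fd K (u x, xi x) (fd u x v, fd xi x v))) (at x)"
    using diff_chain_at[OF h hK] by (simp add: o_def)
  have "fd k x = fd (\<lambda>y. K (u y, xi y)) x"
    by (rule fd_cong[OF S(2,4)]) (use k c in \<open>auto simp: differentiable_def\<close>)
  then show ?thesis using fd_eqI[OF c] by (simp add: du[OF x] fd_xi[OF x])
qed

text \<open>\<open>dh\<close> identifies the first transverse derivatives of \<open>H\<close> with
  \<open>s\<close> and \<open>r\<close>; differentiating once more gives the coefficients
  \<open>sa\<close>, \<open>sb\<close>, \<open>rb\<close> required by \<open>pp_ricci_weyl\<close>,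
  in terms of second derivatives of \<open>H\<close>.\<close>

lemma profile_curvature:
  assumes S: "open S" "open V'" "V' \<subseteq> V" and q: "\<And>y. y \<in> V' \<Longrightarrow> (u y, xi y) \<in> S"
    and H: "smooth_on S H" and Hh: "\<And>y. y \<in> V' \<Longrightarrow> H (u y, xi y) = h y" and x: "x \<in> V'"
  defines "cH \<equiv> \<lambda>q. complex_of_real (H q)"
  defines "\<A> i j \<equiv> (complex_of_real (wedge (l x) (a x) $ i $ j) + \<i> * complex_of_real (wedge (l x) (b x) $ i $ j)) / complex_of_real (sqrt 2)"
  shows "complex_of_real (ricci g x i j) = 2 * d_xibar (d_xi cH) (u x, xi x) * complex_of_real (l x $ i * l x $ j)"
    "self_dual_weyl g x i j k m = d_xi (d_xi cH) (u x, xi x) * \<A> i j * \<A> k m"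
proof -
  have xV: "x \<in> V" using S x by blast
  define H1 H2 where "H1 q = fd H q (0, 1)" and "H2 q = fd H q (0, \<i>)" for q
  have sH: "smooth_on S H1" "smooth_on S H2"
    unfolding H1_def H2_def by (rule smooth_on_frechet_derivative[OF H])+
  have s2: "sqrt 2 * sqrt 2 = (2::real)" "sqrt 2 \<noteq> (0::real)" by simp_all
  \<comment> \<open>The vector sqrt 2 times \<open>Da\<close> moves \<xi> with velocity 1, and sqrt
    2 times \<open>Db\<close> with velocity i; hence the factor sqrt 2.\<close>
  have H12: "H1 (u y, xi y) = - sqrt 2 * s y" "H2 (u y, xi y) = - sqrt 2 * r y" if y: "y \<in> V'" for y
  proof -
    have yV: "y \<in> V" using y S by blast
    obtain Dl Dn Da Db where d: "dual_basis (l y) (n y) (a y) (b y) Dl Dn Da Db" using ex_dual[OF yV] .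
    note D = dual_basisD[OF d]
    have "fd h y (sqrt 2 *\<^sub>R Da) = H1 (u y, xi y)" "fd h y (sqrt 2 *\<^sub>R Db) = H2 (u y, xi y)"
      using fd_profile[OF S y q H Hh, of "sqrt 2 *\<^sub>R Da"] fd_profile[OF S y q H Hh, of "sqrt 2 *\<^sub>R Db"]
      by (simp_all add: D H1_def H2_def one_complex.code[symmetric] imaginary_unit.code[symmetric])
    then show "H1 (u y, xi y) = - sqrt 2 * s y" "H2 (u y, xi y) = - sqrt 2 * r y"
      using dh[OF yV, of "sqrt 2 *\<^sub>R Da"] dh[OF yV, of "sqrt 2 *\<^sub>R Db"] by (simp_all add: D mult.commute)
  qed
  let ?q = "(u x, xi x)"
  have qS: "?q \<in> S" by (rule q[OF x])
  have lin: "fd K ?q (p, Complex (p2 / sqrt 2) (p3 / sqrt 2)) = p * fd K ?q (1, 0) + (p2 / sqrt 2) * fd K ?q (0, 1) + (p3 / sqrt 2) * fd K ?q (0, \<i>)"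
    if "smooth_on S K" for K :: "real \<times> complex \<Rightarrow> real" and p p2 p3
  proof -
    have L: "linear (fd K ?q)" by (rule linear_fd[OF smooth_on_differentiable[OF that qS]])
    have "(p, Complex (p2 / sqrt 2) (p3 / sqrt 2)) = p *\<^sub>R (1, 0) + (p2 / sqrt 2) *\<^sub>R (0, 1) + (p3 / sqrt 2) *\<^sub>R (0, \<i>)"
      by (simp add: complex_eq_iff)
    then show ?thesis by (simp only: linear_add[OF L] linear_scale[OF L] real_scaleR_def)
  qed
  have hs: "fd (\<lambda>y. - sqrt 2 * f y) x v = - sqrt 2 * fd f x v" if "smooth_on V f" for f v
    by (rule fd_eqI[OF has_derivative_mult_right[OF smooth_on_has_derivative[OF that xV]]])
  have sr: "- sqrt 2 * fd s x v = fd H1 ?q (l x \<bullet> v, Complex ((a x \<bullet> v) / sqrt 2) ((b x \<bullet> v) / sqrt 2))"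
    "- sqrt 2 * fd r x v = fd H2 ?q (l x \<bullet> v, Complex ((a x \<bullet> v) / sqrt 2) ((b x \<bullet> v) / sqrt 2))" for v
    using fd_profile[OF S x q sH(1) H12(1), of v] fd_profile[OF S x q sH(2) H12(2), of v]
    unfolding hs[OF smooth_pp(6)] hs[OF smooth_pp(7)] by simp_all
  define sa sb rb where "sa = - fd H1 ?q (0, 1) / 2" "sb = - fd H1 ?q (0, \<i>) / 2" "rb = - fd H2 ?q (0, \<i>) / 2"
  have sy: "fd H2 ?q (0, 1) = fd H1 ?q (0, \<i>)"
    unfolding H1_def H2_def by (rule symmetric_second_derivative[OF S(1) qS H])
  have scale: "f = (- (1 / sqrt 2) * c1) * p1 + (- c2 / 2) * p2 + (- c3 / 2) * p3"
    if "- sqrt 2 * f = p1 * c1 + (p2 / sqrt 2) * c2 + (p3 / sqrt 2) * c3" for f c1 c2 c3 p1 p2 p3 :: real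
  proof -
    have "- sqrt 2 * f = - sqrt 2 * ((- (1 / sqrt 2) * c1) * p1 + (- c2 / 2) * p2 + (- c3 / 2) * p3)"
      unfolding that using s2 by (simp add: field_simps)
    then show ?thesis using s2(2) by simp
  qed
  have ds: "fd s x v = (- (1 / sqrt 2) * fd H1 ?q (1, 0)) * (l x \<bullet> v) + sa * (a x \<bullet> v) + sb * (b x \<bullet> v)" for v
    using scale[OF sr(1)[of v, unfolded lin[OF sH(1)]]] by (simp add: sa_sb_rb_def)
  have dr: "fd r x v = (- (1 / sqrt 2) * fd H2 ?q (1, 0)) * (l x \<bullet> v) + sb * (a x \<bullet> v) + rb * (b x \<bullet> v)" for v
    using scale[OF sr(2)[of v, unfolded lin[OF sH(2)]]] by (simp add: sa_sb_rb_def sy)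
  have hodge: "hodge2 g x (wedge (l x) (a x)) = - wedge (l x) (b x)"
    using A[OF xV] by (simp add: hodge_field_def)
  note cv = pp_curvature[OF cdl cda cdb cdn smooth_pp(6,7) xV ds dr]
  have ricci: "ricci g x i j = - (sa + rb) * (l x $ i * l x $ j)"
    by (rule pp_ricci_weyl(1)[where S = "fd s x" and R = "fd r x", OF xV cv ds dr hodge])
  have weyl: "self_dual_weyl g x i j k m = Complex ((rb - sa) / 2) sb * \<A> i j * \<A> k m"
    unfolding \<A>_def by (rule pp_ricci_weyl(2)[where S = "fd s x" and R = "fd r x", OF xV cv ds dr hodge])
  \<comment> \<open>The coefficients are -1/2 times real second derivatives of \<open>H\<close>,
    while Wirtinger second derivatives carry 1/4. The Ricci coefficient -(sa + rb) is therefore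
    twice the mixed Wirtinger derivative, whereas the Weyl coefficient needs no factor.\<close>
  have dd: "d_xi (d_xi cH) ?q = Complex ((rb - sa) / 2) sb" "d_xibar (d_xi cH) ?q = complex_of_real (- (sa + rb) / 2)"
    unfolding cH_def d_xi_of_real(2,3)[OF S(1) qS H] sa_sb_rb_def H1_def H2_def by (simp_all add: field_simps)
  show "complex_of_real (ricci g x i j) = 2 * d_xibar (d_xi cH) ?q * complex_of_real (l x $ i * l x $ j)"
    unfolding ricci dd(2) by simp
  show "self_dual_weyl g x i j k m = d_xi (d_xi cH) ?q * \<A> i j * \<A> k m"
    unfolding weyl dd(1) ..
qed

text \<open>What remains is to replace \<open>h\<close> by a genuine function \<open>H\<close> of
  (u, \<xi>) and to transfer the real box chart to the complex coordinates.\<close>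

lemma pp_wave:
  assumes p: "p \<in> V"
  shows "\<exists>V' u v \<xi> H. p \<in> V' \<and> V' \<subseteq> U \<and> pp_wave_coordinates_on V' g u v \<xi> H \<and>
     (\<forall>x\<in>V'. let l = differential u x; m = differential \<xi> x; cA = self_dual_form g A x;
                 cH = (\<lambda>q. complex_of_real (H q));
                 \<sigma> = 2 * d_xibar (d_xi cH) (u x, \<xi> x);
                 \<psi> = d_xi (d_xi cH) (u x, \<xi> x)
             in cA = wedge (complexify l) m \<and>
                (\<forall>a b. complex_of_real (ricci g x a b) = \<sigma> * complex_of_real (l $ a * l $ b)) \<and>
                (\<forall>a b c d. self_dual_weyl g x a b c d = \<psi> * cA $ a $ b * cA $ c $ d))"
proof -
  obtain V' \<psi> e where e: "e > 0" and V': "open V'" "p \<in> V'" "V' \<subseteq> V"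
    and inv: "\<forall>y. (\<forall>i. \<bar>y $ i - chart p $ i\<bar> < e) \<longrightarrow> \<psi> y \<in> V' \<and> chart (\<psi> y) = y"
      "\<forall>x\<in>V'. \<psi> (chart x) = x \<and> (\<forall>i. \<bar>chart x $ i - chart p $ i\<bar> < e)"
    and s\<psi>: "smooth_on {y. \<forall>i. \<bar>y $ i - chart p $ i\<bar> < e} \<psi>"
    and d\<psi>: "\<forall>y v. (\<forall>i. \<bar>y $ i - chart p $ i\<bar> < e) \<longrightarrow> fd chart (\<psi> y) (fd \<psi> y v) = v"
    by (rule ex_box_chart[OF p])
  define B where "B = {y. \<forall>i. \<bar>y $ i - chart p $ i\<bar> < e}"
  have oB: "open B" unfolding B_def forall_4
    by (intro open_Collect_conj open_Collect_less continuous_intros)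
  have s\<psi>: "smooth_on B \<psi>" using s\<psi> by (simp add: B_def)
  have \<psi>V: "\<psi> y \<in> V'" "chart (\<psi> y) = y" if "y \<in> B" for y using inv(1) that by (auto simp: B_def)
  have cB: "chart x \<in> B" "\<psi> (chart x) = x" if "x \<in> V'" for x using inv(2) that by (auto simp: B_def)
  define \<phi> where "\<phi> x = (u x, w x, xi x)" for x
  have rc\<phi>: "real_coords (\<phi> x) = chart x" for x
    by (simp add: vec_eq_iff forall_4 \<phi>_def xi_def)
  have \<phi>rc: "\<phi> x = q" if "chart x = real_coords q" for x q
  proof -
    have "u x = fst q" "w x = fst (snd q)" "X x = sqrt 2 * Re (snd (snd q))" "Y x = sqrt 2 * Im (snd (snd q))"
      using arg_cong[OF that, of "\<lambda>c. c $ 1"] arg_cong[OF that, of "\<lambda>c. c $ 2"]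
        arg_cong[OF that, of "\<lambda>c. c $ 3"] arg_cong[OF that, of "\<lambda>c. c $ 4"] by simp_all
    then show ?thesis by (simp add: \<phi>_def xi_def prod_eq_iff complex_eq_iff)
  qed
  \<comment> \<open>The image is a preimage of the box under the continuous map
    \<open>real_coords\<close>, hence open, and the inverse chart is \<psi> composed with
    \<open>real_coords\<close>, hence smooth.\<close>
  have img: "\<phi> ` V' = real_coords -` B"
  proof (intro equalityI subsetI)
    fix q assume "q \<in> real_coords -` B"
    then have "\<psi> (real_coords q) \<in> V'" "chart (\<psi> (real_coords q)) = real_coords q" using \<psi>V by auto
    then show "q \<in> \<phi> ` V'" using \<phi>rc by (metis imageI)
  qed (use rc\<phi> cB in auto)
  have crc: "continuous_on UNIV real_coords" by (rule smooth_on_continuous[OF smooth_real_coords])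
  have oimg: "open (\<phi> ` V')" unfolding img by (rule open_vimage[OF oB crc])
  have inj: "inj_on \<phi> V'" by (rule inj_onI) (metis cB(2) rc\<phi>)
  have "inv_into V' \<phi> q = \<psi> (real_coords q)" if "q \<in> \<phi> ` V'" for q
    using that cB(2) rc\<phi> by (auto simp: inv_into_f_f[OF inj])
  moreover have "smooth_on (\<phi> ` V') (\<lambda>q. \<psi> (real_coords q))"
    by (rule smooth_on_compose[OF oimg oB s\<psi> smooth_on_subset[OF smooth_real_coords]]) (auto simp: img)
  ultimately have sinv: "smooth_on (\<phi> ` V') (inv_into V' \<phi>)"
    by (subst smooth_on_cong[OF oimg]) auto
  have s\<phi>: "smooth_on V' \<phi>" unfolding \<phi>_def
    by (intro smooth_on_Pair V'(1) smooth_on_subset[OF _ V'(3)] smooth_pp smooth_xi)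
  have coords: "coordinates_on V' u w xi"
    unfolding coordinates_on_def Let_def using V'(1) s\<phi> inj oimg sinv by (simp add: \<phi>_def[abs_def])
  \<comment> \<open>Embeds the (u, \<xi>) domain as the slice on which the second coordinate has its
    value at \<open>p\<close>; \<open>H\<close> is \<open>h\<close> restricted to this
    slice.\<close>
  define ins where "ins q = (fst q, chart p $ 2, snd q)" for q :: "real \<times> complex"
  define S where "S = (\<lambda>q. real_coords (ins q)) -` B"
  have sins: "smooth_on UNIV ins" unfolding ins_def
    by (intro smooth_on_Pair open_UNIV smooth_on_const bounded_linear.smooth_on[OF bounded_linear_fst] bounded_linear.smooth_on[OF bounded_linear_snd] smooth_on_ident)
  have sri: "smooth_on UNIV (\<lambda>q. real_coords (ins q))"
    by (rule smooth_on_compose[OF open_UNIV open_UNIV smooth_real_coords sins]) auto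
  have oS: "open S" unfolding S_def by (rule open_vimage[OF oB smooth_on_continuous[OF sri]])
  have ri: "real_coords (ins (u x, xi x)) = chart x + (chart p $ 2 - w x) *\<^sub>R axis 2 1" for x
    by (simp add: vec_eq_iff forall_4 ins_def xi_def axis_def)
  have lineB: "chart x + (t - w x) *\<^sub>R axis 2 1 \<in> B" if "x \<in> V'" "\<bar>t - chart p $ 2\<bar> < e" for x t
    using cB(1)[OF that(1)] that(2) by (simp add: B_def forall_4 axis_def)
  have uS: "(u x, xi x) \<in> S" if "x \<in> V'" for x
    using lineB[OF that, of "chart p $ 2"] e by (simp add: S_def ri)
  have "(\<lambda>x. (u x, xi x)) ` V' = S"
  proof (intro equalityI subsetI)
    fix q assume "q \<in> S"
    then have "\<psi> (real_coords (ins q)) \<in> V'" "chart (\<psi> (real_coords (ins q))) = real_coords (ins q)"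
      using \<psi>V by (auto simp: S_def)
    moreover from this(2) have "\<phi> (\<psi> (real_coords (ins q))) = ins q" by (rule \<phi>rc)
    ultimately show "q \<in> (\<lambda>x. (u x, xi x)) ` V'"
      by (intro image_eqI[of _ _ "\<psi> (real_coords (ins q))"]) (auto simp: \<phi>_def ins_def prod_eq_iff)
  qed (use uS in auto)
  note imS = this
  define H where "H q = h (\<psi> (real_coords (ins q)))" for q
  have sH: "smooth_on S H"
    unfolding H_def
  proof (rule smooth_on_compose[OF oS V'(1) smooth_on_subset[OF smooth_pp(5) V'(3)]])
    show "smooth_on S (\<lambda>q. \<psi> (real_coords (ins q)))"
      by (rule smooth_on_compose[OF oS oB s\<psi> smooth_on_subset[OF sri]]) (auto simp: S_def)
    show "(\<lambda>q. \<psi> (real_coords (ins q))) ` S \<subseteq> V'" using \<psi>V(1) by (auto simp: S_def)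
  qed
  \<comment> \<open>Along the line through \<open>chart x\<close> on which only the second
    coordinate varies, \<open>l\<close>, \<open>a\<close> and \<open>b\<close> vanish on the
    velocity, so \<open>dh\<close> makes \<open>h\<close> stationary. The parameters form an
    interval containing both \<open>w x\<close> and the slice value.\<close>
  have Hh: "H (u x, xi x) = h x" if x: "x \<in> V'" for x
  proof -
    define T where "T = {t. \<bar>t - chart p $ 2\<bar> < e}"
    define c where "c t = chart x + (t - w x) *\<^sub>R (axis 2 1 :: real^4)" for t
    have cT: "c t \<in> B" if "t \<in> T" for t using lineB[OF x, of t] that by (simp add: c_def T_def)
    have "((\<lambda>t. h (\<psi> (c t))) has_derivative (\<lambda>t. 0)) (at t within T)" if t: "t \<in> T" for t
    proof -
      note y = cT[OF t]
      have \<psi>': "\<psi> (c t) \<in> V" using \<psi>V(1)[OF y] V'(3) by blast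
      let ?v = "fd \<psi> (c t) (axis 2 1)"
      have fc: "fd chart (\<psi> (c t)) ?v = axis 2 1" using d\<psi> y by (simp add: B_def)
      have "l (\<psi> (c t)) \<bullet> ?v = 0" "a (\<psi> (c t)) \<bullet> ?v = 0" "b (\<psi> (c t)) \<bullet> ?v = 0"
        using fd_chart(1,3,4)[OF \<psi>', of ?v] unfolding fc by (simp_all add: axis_def)
      then have z: "fd h (\<psi> (c t)) ?v = 0" using dh[OF \<psi>', of ?v] by simp
      have hc: "(c has_derivative (\<lambda>s. s *\<^sub>R axis 2 1)) (at t)"
        unfolding c_def[abs_def] by (auto intro!: derivative_eq_intros)
      have h\<psi>: "(\<psi> has_derivative fd \<psi> (c t)) (at (c t))" by (rule smooth_on_has_derivative[OF s\<psi> y])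
      have hh: "(h has_derivative fd h (\<psi> (c t))) (at (\<psi> (c t)))" by (rule smooth_on_has_derivative[OF smooth_pp(5) \<psi>'])
      have "((\<lambda>t. h (\<psi> (c t))) has_derivative (\<lambda>s. fd h (\<psi> (c t)) (fd \<psi> (c t) (s *\<^sub>R axis 2 1)))) (at t)"
        using diff_chain_at[OF diff_chain_at[OF hc h\<psi>], of h] hh by (simp add: o_def)
      then have "((\<lambda>t. h (\<psi> (c t))) has_derivative (\<lambda>s. 0)) (at t)"
        by (simp add: linear_scale[OF has_derivative_linear[OF h\<psi>]] linear_scale[OF has_derivative_linear[OF hh]] z)
      then show ?thesis by (rule has_derivative_at_withinI)
    qed
    moreover have "convex T"
    proof -
      have "T = ball (chart p $ 2) e" by (auto simp: T_def dist_real_def)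
      then show ?thesis by simp
    qed
    ultimately obtain K where K: "\<And>t. t \<in> T \<Longrightarrow> h (\<psi> (c t)) = K"
      using has_derivative_zero_constant[of T "\<lambda>t. h (\<psi> (c t))"] by blast
    have "chart p $ 2 \<in> T" "w x \<in> T" using e cB(1)[OF x] by (auto simp: T_def B_def forall_4)
    then have "h (\<psi> (c (chart p $ 2))) = h (\<psi> (c (w x)))" using K by simp
    then show ?thesis using cB(2)[OF x] by (simp add: H_def ri c_def)
  qed
  have diffs: "differential u x = l x" "differential w x = n x - h x *\<^sub>R l x"
    "differential xi x $ i = Complex (a x $ i / sqrt 2) (b x $ i / sqrt 2)"
    "differential (\<lambda>y. cnj (xi y)) x $ i = cnj (Complex (a x $ i / sqrt 2) (b x $ i / sqrt 2))" if x: "x \<in> V'" for x i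
  proof -
    have xV: "x \<in> V" using x V'(3) by blast
    have hc: "((\<lambda>y. cnj (xi y)) has_derivative (\<lambda>v. cnj (fd xi x v))) (at x)"
      by (rule bounded_linear.has_derivative[OF bounded_linear_cnj smooth_on_has_derivative[OF smooth_xi xV]])
    show "differential u x = l x"
      by (simp add: differential_def pd_def vec_eq_iff du[OF xV] inner_axis)
    have "fd w x (axis j 1) = n x $ j - h x * l x $ j" for j
      using dw[OF xV, of "axis j 1"] by (simp add: inner_axis)
    then show "differential w x = n x - h x *\<^sub>R l x"
      by (simp add: differential_def pd_def vec_eq_iff)
    show "differential xi x $ i = Complex (a x $ i / sqrt 2) (b x $ i / sqrt 2)"
      by (simp add: differential_def pd_def fd_xi[OF xV] inner_axis)
    show "differential (\<lambda>y. cnj (xi y)) x $ i = cnj (Complex (a x $ i / sqrt 2) (b x $ i / sqrt 2))"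
      unfolding differential_def pd_def vec_lambda_beta fd_eqI[OF hc] fd_xi[OF xV] by (simp add: inner_axis)
  qed
  have metric: "complex_of_real (g x $ i $ j) =
      complex_of_real (- (differential u x $ i * differential w x $ j + differential w x $ i * differential u x $ j)
         - 2 * H (u x, xi x) * (differential u x $ i * differential u x $ j))
      + (differential xi x $ i * differential (\<lambda>y. cnj (xi y)) x $ j + differential (\<lambda>y. cnj (xi y)) x $ i * differential xi x $ j)"
    if x: "x \<in> V'" for x i j
  proof -
    have xV: "x \<in> V" using x V'(3) by blast
    show ?thesis
      unfolding diffs[OF x] Hh[OF x] frame[OF xV] frame_matrix_def
      by (simp add: complex_eq_iff) (simp add: field_simps)
  qed
  have pc: "pp_wave_coordinates_on V' g u w xi H"
    unfolding pp_wave_coordinates_on_def Let_def imS using coords sH metric by blast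
  have cA: "self_dual_form g A x $ i $ j = (complex_of_real (wedge (l x) (a x) $ i $ j) + \<i> * complex_of_real (wedge (l x) (b x) $ i $ j)) / complex_of_real (sqrt 2)"
    if x: "x \<in> V'" for x i j
    using A[of x] x V'(3) by (auto simp: self_dual_form_def)
  have fields: "self_dual_form g A x = wedge (complexify (differential u x)) (differential xi x) \<and>
      (\<forall>i j. complex_of_real (ricci g x i j) = 2 * d_xibar (d_xi (\<lambda>q. complex_of_real (H q))) (u x, xi x) * complex_of_real (differential u x $ i * differential u x $ j)) \<and>
      (\<forall>i j k m. self_dual_weyl g x i j k m = d_xi (d_xi (\<lambda>q. complex_of_real (H q))) (u x, xi x) * self_dual_form g A x $ i $ j * self_dual_form g A x $ k $ m)"
    if x: "x \<in> V'" for x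
  proof (intro conjI allI)
    show "self_dual_form g A x = wedge (complexify (differential u x)) (differential xi x)"
      unfolding vec_eq_iff cA[OF x] wedge_def complexify_def vec_lambda_beta diffs[OF x]
      by (simp add: complex_eq_iff field_simps)
    show "complex_of_real (ricci g x i j) = 2 * d_xibar (d_xi (\<lambda>q. complex_of_real (H q))) (u x, xi x) * complex_of_real (differential u x $ i * differential u x $ j)" for i j
      unfolding diffs(1)[OF x] by (rule profile_curvature(1)[OF oS V'(1,3) uS sH Hh x])
    show "self_dual_weyl g x i j k m = d_xi (d_xi (\<lambda>q. complex_of_real (H q))) (u x, xi x) * self_dual_form g A x $ i $ j * self_dual_form g A x $ k $ m" for i j k m
      unfolding cA[OF x] by (rule profile_curvature(2)[OF oS V'(1,3) uS sH Hh x])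
  qed
  have V'U: "V' \<subseteq> U" using V'(3) V(2) by blast
  show ?thesis
    unfolding Let_def
    by (rule exI[of _ V'], rule exI[of _ u], rule exI[of _ w], rule exI[of _ xi], rule exI[of _ H],
        rule conjI[OF V'(2)], rule conjI[OF V'U], rule conjI[OF pc], rule ballI, erule fields)
qed

end

section \<open>The equivalence at a point and the final assembly\<close>

context spacetime_chart
begin

text \<open>Up to a nonzero factor the scalar curvature is the sum of squares of the coefficients of
  \<open>Z1\<close> and \<open>Z2\<close> along the nonvanishing form \<open>l\<close>. The
  hypotheses are used on a neighbourhood, but the equivalence concerns the single point
  \<open>p\<close>.\<close>

lemma scalar_curvature_zero_iff:
  assumes cky: "conformal_killing_yano_on U g A" and null: "null_on U g A"
    and Z: "Z1 = codifferential g A" "Z2 = codifferential g (hodge_field g A)"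
    and killing: "killing_on U g Z1" "killing_on U g Z2" and wedge: "\<forall>x\<in>U. wedge (Z1 x) (Z2 x) = 0"
    and p: "p \<in> U"
  shows "scalar_curvature g p = 0 \<longleftrightarrow> Z1 p = 0 \<and> Z2 p = 0"
proof -
  have tf: "two_form_on U A" using cky by (simp add: conformal_killing_yano_on_def)
  obtain V l n a b k where N: "open V" "p \<in> V" "V \<subseteq> U"
    and sm: "smooth_on V l" "smooth_on V n" "smooth_on V a" "smooth_on V b"
    and F: "\<forall>x\<in>V. g x = frame_matrix (l x) (n x) (a x) (b x) \<and> A x = wedge (l x) (a x) \<and>
       hodge_field g A x = - wedge (l x) (b x) \<and> l x $ k \<noteq> 0"
    by (rule local_null_frame[OF tf null p])
  interpret null_frame U g V l n a b
    by unfold_locales (use N sm F in auto)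
  have A: "A y = wedge (l y) (a y)" "hodge_field g A y = - wedge (l y) (b y)" and lk: "l y $ k \<noteq> 0" if "y \<in> V" for y
    using F that by auto
  \<comment> \<open>The coefficients from \<open>cky_structure\<close> exist only pointwise;
    dividing \<open>k\<close>-th components exhibits them as smooth functions, which is needed to
    differentiate them.\<close>
  define z1 z2 where "z1 y = Z1 y $ k / l y $ k" and "z2 y = Z2 y $ k / l y $ k" for y
  have zs: "Z1 y = z1 y *\<^sub>R l y \<and> Z2 y = z2 y *\<^sub>R l y \<and> structure_at (z1 y) (z2 y) y" if y: "y \<in> V" for y
  proof -
    have w: "wedge (Z1 y) (Z2 y) = 0" using wedge VU[OF y] by blast
    obtain \<zeta>1 \<zeta>2 where "Z1 y = \<zeta>1 *\<^sub>R l y" "Z2 y = \<zeta>2 *\<^sub>R l y" "structure_at \<zeta>1 \<zeta>2 y"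
      using cky_structure[OF cky A y _ _ w] unfolding Z by blast
    then show ?thesis using lk[OF y] by (simp add: z1_def z2_def)
  qed
  have sA: "smooth_on U (\<lambda>x. A x $ i $ j)" for i j
    using tf by (intro smooth_on_nth open_U) (simp add: two_form_on_def)
  have sz: "smooth_on V z1" "smooth_on V z2"
    unfolding z1_def z2_def Z
    by (intro smooth_on_divide smooth_on_nth N(1) sm lk smooth_on_subset[OF smooth_codifferential[OF sA] N(3)]
        smooth_on_subset[OF smooth_codifferential[OF smooth_hodge] N(3)];
        (use tf in \<open>simp add: two_form_on_def\<close>)?)+
  have skew: "cd g l p v t = - cd g l p t v" for v t
  proof -
    have "cd g l p v t = ((z1 p * (a p \<bullet> v) - z2 p * (b p \<bullet> v)) * (l p \<bullet> t) - (l p \<bullet> v) * (z1 p * (a p \<bullet> t) - z2 p * (b p \<bullet> t))) / 3" for v t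
      using zs[OF N(2)] unfolding structure_at_def by blast
    note this[of v t] this[of t v]
    then show ?thesis by (simp add: field_simps)
  qed
  have "fd z1 p v = 0" "fd z2 p v = 0" for v
    by (rule killing_multiple_const[OF N(2) killing(1) _ sz(1) skew], use zs in blast,
        rule killing_multiple_const[OF N(2) killing(2) _ sz(2) skew], use zs in blast)
  then have "scalar_curvature g p = - (4 / 3) * ((z1 p)^2 + (z2 p)^2)"
    using structure_curvature[of z1 z2 p] zs N(2) sz by blast
  then have "scalar_curvature g p = 0 \<longleftrightarrow> (z1 p)^2 + (z2 p)^2 = 0"
    by (simp only: mult_eq_0_iff) simp
  then have "scalar_curvature g p = 0 \<longleftrightarrow> z1 p = 0 \<and> z2 p = 0"
    by (simp only: sum_power2_eq_zero_iff)
  moreover have "l p \<noteq> 0" using lk[OF N(2)] by auto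
  ultimately show ?thesis using zs[OF N(2)] by simp
qed

text \<open>The right side of the CKY equation is linear in the codifferential of the self-dual
  form, a combination of the two vanishing codifferentials.\<close>

lemma self_dual_form_parallel:
  assumes cky: "conformal_killing_yano_on U g A" and x: "x \<in> U"
    and Z: "codifferential g A x = 0" "codifferential g (hodge_field g A) x = 0"
  shows "nabla2 g (self_dual_form g A) x i j k = 0"
proof -
  have sA: "smooth_on U A" using cky by (simp add: conformal_killing_yano_on_def two_form_on_def)
  have d: "(\<lambda>y. A y $ i $ j) differentiable (at x)" "(\<lambda>y. hodge_field g A y $ i $ j) differentiable (at x)" for i j
    using smooth_on_differentiable[OF smooth_on_nth[OF open_U smooth_on_nth[OF open_U sA]] x]
      smooth_on_differentiable[OF smooth_hodge[OF sA] x] by auto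
  have "3 * nabla2 g (self_dual_form g A) x i j k = 2 * (\<Sum>a\<in>UNIV. \<Sum>e\<in>UNIV. complex_of_real (ginv g x a e) *
               codifferential g (self_dual_form g A) x $ e * self_dual_G g x a i j k)"
    using cky x by (simp add: conformal_killing_yano_on_def)
  then show ?thesis by (simp add: codifferential_self_dual[OF d] Z)
qed

end

text \<open>Quantifying the pointwise equivalence over \<open>U\<close> gives the first claim. For
  the second claim vanishing on a whole neighbourhood matters, since the coordinates come from
  integrating a parallel frame there.\<close>

theorem proposition4:
  fixes U :: "(real^4) set" and g A :: "real^4 \<Rightarrow> real^4^4" and Z1 Z2 :: "real^4 \<Rightarrow> real^4"
  assumes "Z1 = codifferential g A" and "Z2 = codifferential g (hodge_field g A)"
    and "spacetime U g"
    and "conformal_killing_yano_on U g A" and "null_on U g A"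
    and "killing_on U g Z1" and "killing_on U g Z2"
    and "\<forall>x\<in>U. wedge (Z1 x) (Z2 x) = 0"
  shows "((\<forall>x\<in>U. Lambda g x = 0) \<longleftrightarrow> (\<forall>x\<in>U. Z1 x = 0 \<and> Z2 x = 0)) \<and>
    ((\<forall>x\<in>U. Lambda g x = 0) \<longrightarrow>
       (\<forall>x\<in>U. \<forall>a b c. nabla2 g (self_dual_form g A) x a b c = 0) \<and>
       (\<forall>p\<in>U. \<exists>V u v \<xi> H. p \<in> V \<and> V \<subseteq> U \<and> pp_wave_coordinates_on V g u v \<xi> H \<and>
          (\<forall>x\<in>V.
             let l = differential u x; m = differential \<xi> x; cA = self_dual_form g A x;
                 cH = (\<lambda>q. complex_of_real (H q));
                 \<sigma> = 2 * d_xibar (d_xi cH) (u x, \<xi> x);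
                 \<psi> = d_xi (d_xi cH) (u x, \<xi> x)
             in cA = wedge (complexify l) m \<and>
                (\<forall>a b. complex_of_real (ricci g x a b) = \<sigma> * complex_of_real (l $ a * l $ b)) \<and>
                (\<forall>a b c d. self_dual_weyl g x a b c d = \<psi> * cA $ a $ b * cA $ c $ d))))"
proof -
  interpret spacetime_chart U g by unfold_locales (rule assms(3))
  note cky = assms(4) and null = assms(5)
  have iff: "(\<forall>x\<in>U. Lambda g x = 0) \<longleftrightarrow> (\<forall>x\<in>U. Z1 x = 0 \<and> Z2 x = 0)"
    using scalar_curvature_zero_iff[OF cky null assms(1,2,6,7,8)] by (simp add: Lambda_def)
  show ?thesis
  proof (intro conjI impI iff)
    assume "\<forall>x\<in>U. Lambda g x = 0"
    then have Z: "codifferential g A x = 0" "codifferential g (hodge_field g A) x = 0" if "x \<in> U" for x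
      using iff that unfolding assms(1,2) by blast+
    show "\<forall>x\<in>U. \<forall>a b c. nabla2 g (self_dual_form g A) x a b c = 0"
      using self_dual_form_parallel[OF cky _ Z] by blast
    show "\<forall>p\<in>U. \<exists>V u v \<xi> H. p \<in> V \<and> V \<subseteq> U \<and> pp_wave_coordinates_on V g u v \<xi> H \<and>
          (\<forall>x\<in>V.
             let l = differential u x; m = differential \<xi> x; cA = self_dual_form g A x;
                 cH = (\<lambda>q. complex_of_real (H q));
                 \<sigma> = 2 * d_xibar (d_xi cH) (u x, \<xi> x);
                 \<psi> = d_xi (d_xi cH) (u x, \<xi> x)
             in cA = wedge (complexify l) m \<and>
                (\<forall>a b. complex_of_real (ricci g x a b) = \<sigma> * complex_of_real (l $ a * l $ b)) \<and>
                (\<forall>a b c d. self_dual_weyl g x a b c d = \<psi> * cA $ a $ b * cA $ c $ d))"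
    proof
      fix p assume pU: "p \<in> U"
      have "\<exists>V l n a b u w X Y h s r. p \<in> V \<and> pp_frame U g V l n a b A u w X Y h s r"
        by (rule ex_pp_frame[OF cky null _ _ pU]) (rule Z, assumption)+
      then obtain V l n a b u w X Y h s r where p: "p \<in> V" and pp: "pp_frame U g V l n a b A u w X Y h s r"
        by (elim exE conjE)
      show "\<exists>V u v \<xi> H. p \<in> V \<and> V \<subseteq> U \<and> pp_wave_coordinates_on V g u v \<xi> H \<and>
          (\<forall>x\<in>V.
             let l = differential u x; m = differential \<xi> x; cA = self_dual_form g A x;
                 cH = (\<lambda>q. complex_of_real (H q));
                 \<sigma> = 2 * d_xibar (d_xi cH) (u x, \<xi> x);
                 \<psi> = d_xi (d_xi cH) (u x, \<xi> x)
             in cA = wedge (complexify l) m \<and>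
                (\<forall>a b. complex_of_real (ricci g x a b) = \<sigma> * complex_of_real (l $ a * l $ b)) \<and>
                (\<forall>a b c d. self_dual_weyl g x a b c d = \<psi> * cA $ a $ b * cA $ c $ d))"
        by (rule pp_frame.pp_wave[OF pp p])
    qed
  qed
qed

end
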